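(* Let $U$ be a free $\mathbb Z$-module of rank $d$, $n\ge 2$ an integer, and let $x_1\in U$, $x_1^*\in U^*$ satisfy $x_1^*(x_1)=1$. Let the ring $\mathfrak R$, the element $\pmb\delta\in\mathfrak R$, the free $\mathfrak R$-modules $B_r$, the $\mathfrak R$-modules $G_r$, and the $\mathfrak R$-module homomorphisms $\tau_r:B_r\to G_r$ be as defined in the context. Then, for each $r$ with $0\le r\le d$: (a) $\tau_r(B_r)$ is a free $\mathfrak R$-submodule of $G_r$; (b) $\tau_r:B_r\to\tau_r(B_r)$ is an isomorphism; and (c) $(\tau_rB_r)_{\pmb\delta}=(G_r)_{\pmb\delta}$ (localization at the powers of $\pmb\delta$).
   Context: Notation. Unadorned $\otimes,\bigwedge,\operatorname{Sym},D$ (divided powers), $(\ )^*$ are over $\mathbb Z$. $\operatorname{Sym}_\bullet U$ acts on $D_\bullet(U^* )$ (the graded dual of $\operatorname{Sym}_\bullet U$) by contraction, $[\mu(\nu)](\mu')=\nu(\mu\mu')$. $U^*$ acts on $\bigwedge^\bullet U$ by $u^*(u_1\wedge\dots\wedge u_r)=\sum_i(-1)^{i+1}u^*(u_i)\,u_1\wedge\dots\widehat{u_i}\dots\wedge u_r$. $\mathfrak R=\operatorname{Sym}_\bullet(U\oplus\operatorname{Sym}_{2n-2}U)$ is bigraded with $\mathfrak R_{(1,0)}=U$ and $\mathfrak R_{(0,1)}=\operatorname{Sym}_{2n-2}U$. $\Phi\in\mathfrak R\otimes D_{2n-2}(U^* )$ is the element corresponding to the inclusion $\operatorname{Sym}_{2n-2}U=\mathfrak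 R_{(0,1)}\subseteq\mathfrak R$. $p:\operatorname{Sym}_{n-1}U\to\mathfrak R\otimes D_{n-1}(U^* )$ is $p(\mu)=\mu(\Phi)$; $\pmb\delta\in\mathfrak R$ is the determinant of $p$ with respect to a basis of $\operatorname{Sym}_{n-1}U$ and the dual basis of $D_{n-1}(U^* )$; $q:D_{n-1}(U^* )\to\mathfrak R\otimes\operatorname{Sym}_{n-1}U$ is the classical adjoint of $p$, i.e. the unique homomorphism with $[q(\nu)](\Phi)=\pmb\delta\nu$ for all $\nu$. $U_0=\ker(x_1^* )$, so $U=\mathbb Zx_1\oplus U_0$; $U_0^*=\{u^*\in U^*\mid u^*(x_1)=0\}$. $\widetilde\Phi\in\mathfrak R\otimes D_{2n-1}(U^* )$ is the unique element with $x_1(\widetilde\Phi)=\Phi$ and $\mu(\widetilde\Phi)=0$ for all $\mu\in\operatorname{Sym}_{2n-1}(U_0)$. Let $x_2,\dots,x_d$ be a basis of $U_0$ and $x_1^*,\dots,x_d^*$ the basis of $U^*$ dual to $x_1,\dots,x_d$ (the constructions do not depend on it). Put $\kappa(\theta\otimes\mu)=\sum_{i=1}^d x_i^*(\theta)\otimes x_i\mu$ on $\bigwedge^aU\otimes\operatorname{Sym}_bU$ and $\eta(\theta\otimes\nu)=\sum_{i=1}^d x_i^*(\theta)\otimes x_i(\nu)$ on $\bigwedge^aU\otimes D_b(U^* )$; $L_{a,b}U=\ker(\kappa:\bigwedge^aU\otimes\operatorname{Sym}_bU\to\bigwedge^{a-1}U\otimes\operatorname{Sym}_{b+1}U)$,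 $K_{a,b}U=\ker(\eta:\bigwedge^aU\otimes D_b(U^* )\to\bigwedge^{a-1}U\otimes D_{b-1}(U^* ))$, and similarly $L_{a,b}U_0$, $K_{a,b}U_0$ with $U_0$ in place of $U$. Maps are extended $\mathfrak R$-linearly. Modules: $B_0=\mathfrak R$; $B_r=\mathfrak R\otimes(K_{r-1,n-1}U_0\oplus L_{r-1,n}U_0)$ for $1\le r\le d-1$; $B_d=\mathfrak R\otimes\bigwedge^{d-1}U_0$. $G_0=\mathfrak R$; $G_d=\mathfrak R\otimes\bigwedge^dU$; for $1\le r\le d-1$, $G_r=\ker(\underline{\mathrm v}_r:\mathfrak R\otimes L_{r-1,n}U\to\mathfrak R\otimes K_{r-1,n-2}U)$, where $\underline{\mathrm v}_r$ is the restriction of the map $\theta\otimes\mu\mapsto\theta\otimes\mu(\Phi)$ on $\bigwedge^{r-1}U\otimes\operatorname{Sym}_nU$. Maps: $\tau_0$ is the identity of $\mathfrak R$. For $1\le r\le d-1$, $\tau_r$ is the restriction to $\mathfrak R\otimes K_{r-1,n-1}U_0$ of $\theta\otimes\nu\mapsto\pmb\delta^{r-1}\kappa((x_1\wedge\theta)\otimes q(\nu))$ ($\theta\in\bigwedge^{r-1}U_0$, $\nu\in D_{n-1}(U_0^* )$), and the restriction to $\mathfrak R\otimes L_{r-1,n}U_0$ of $\theta\otimes\mu\mapsto\pmb\delta^{r-1}[\pmb\delta\,\theta\otimes\mu-\kappa((x_1\wedge\theta)\otimes q(\mu(\widetilde\Phi)))]$ ($\theta\in\bigwedge^{r-1}U_0$,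 $\mu\in\operatorname{Sym}_nU_0$); its image lies in $G_r$. $\tau_d(\omega)=\pmb\delta^{d-1}x_1\wedge\omega$ for $\omega\in\bigwedge^{d-1}U_0$. *)

theory Defs
  imports
    "HOL-Library.Poly_Mapping"
    "HOL-Library.Multiset"
    "HOL-Library.Product_Plus"
    "HOL-Library.Cardinality"
    "Jordan_Normal_Form.Determinant"
begin

section \<open>Abelian groups as modules over the integers\<close>

definition zmul :: "int \<Rightarrow> 'a \<Rightarrow> 'a::ab_group_add" where
  "zmul k a = (\<Sum>i<nat k. a) - (\<Sum>i<nat (- k). a)"

lemma zmul_diff_int: "zmul (int m - int n) a = (\<Sum>i<m. a) - (\<Sum>i<n. a)"
proof -
  have s: "(\<Sum>i<(k + l::nat). a) = (\<Sum>i<k. a) + (\<Sum>i<l. a)" for k l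
    by (induction l) (simp_all add: algebra_simps)
  show ?thesis
  proof (cases "n \<le> m")
    case True
    then obtain k where "m = n + k" using le_Suc_ex by blast
    then show ?thesis by (simp add: zmul_def s)
  next
    case False
    then obtain k where "n = m + k" by (metis le_Suc_ex nat_le_linear)
    then show ?thesis by (simp add: zmul_def s)
  qed
qed

interpretation zmod: Modules.module "zmul :: int \<Rightarrow> 'a \<Rightarrow> 'a::ab_group_add"
proof
  have s: "(\<Sum>i<(k + l::nat). a) = (\<Sum>i<k. a) + (\<Sum>i<l. a)" for k l and a :: 'a
    by (induction l) (simp_all add: algebra_simps)
  have p: "(\<Sum>i<(k * l::nat). a) = (\<Sum>i<k. \<Sum>j<l. a)" for k l and a :: 'a
    by (induction k) (simp_all add: s algebra_simps)
  fix a b :: int and x y :: 'a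
  obtain m n where a: "a = int m - int n" using int_diff_cases by blast
  obtain k l where b: "b = int k - int l" using int_diff_cases by blast
  show "zmul a (x + y) = zmul a x + zmul a y"
    by (simp add: a zmul_diff_int sum.distrib)
  have ab: "a + b = int (m + k) - int (n + l)" by (simp add: a b)
  show "zmul (a + b) x = zmul a x + zmul b x"
    unfolding ab unfolding a b zmul_diff_int s by simp
  have ab: "a * b = int (m * k + n * l) - int (m * l + n * k)"
    by (simp add: a b algebra_simps)
  show "zmul a (zmul b x) = zmul (a * b) x"
    unfolding ab unfolding a b zmul_diff_int s p by (simp add: sum_subtractf)
  show "zmul 1 x = x" by (simp add: zmul_def)
qed

abbreviation zspan :: "'a::ab_group_add set \<Rightarrow> 'a set" where
  "zspan \<equiv> Modules.module.span zmul"

text \<open>The family \<open>(x i)\<close>, \<open>i \<in> I\<close>, is a basis of the subgroup \<open>M\<close>.\<close>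

definition zbasis :: "'i set \<Rightarrow> ('i \<Rightarrow> 'a::ab_group_add) \<Rightarrow> 'a set \<Rightarrow> bool" where
  "zbasis I x M \<longleftrightarrow>
     inj_on x I \<and> \<not> Modules.module.dependent zmul (x ` I) \<and> zspan (x ` I) = M"

lemma additive_zmul: "Modules.additive f \<Longrightarrow> f (zmul k a) = zmul k (f a)"
  unfolding zmul_def by (simp add: additive.diff additive.sum)

lemma additive_eq_on_zspan:
  assumes "Modules.additive f" "Modules.additive g" "\<And>s. s \<in> S \<Longrightarrow> f s = g s" "x \<in> zspan S"
  shows "f x = g x"
  using assms(4)
  by (induction rule: zmod.span_induct_alt)
     (simp_all add: additive.zero[OF assms(1)] additive.zero[OF assms(2)]
       additive.add[OF assms(1)] additive.add[OF assms(2)]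
       additive_zmul[OF assms(1)] additive_zmul[OF assms(2)] assms(3))

text \<open>The additive extension to \<open>'k \<Rightarrow>\<^sub>0 int\<close> (the free abelian group on \<open>'k\<close>) of a map on \<open>'k\<close>.\<close>

definition zlin :: "('k \<Rightarrow> 'c::ab_group_add) \<Rightarrow> ('k \<Rightarrow>\<^sub>0 int) \<Rightarrow> 'c" where
  "zlin f P = (\<Sum>k\<in>Poly_Mapping.keys P. zmul (Poly_Mapping.lookup P k) (f k))"

lemma zlin_superset:
  assumes "finite A" "Poly_Mapping.keys P \<subseteq> A"
  shows "zlin f P = (\<Sum>k\<in>A. zmul (Poly_Mapping.lookup P k) (f k))"
  unfolding zlin_def using assms
  by (intro sum.mono_neutral_left) (auto simp: in_keys_iff)

lemma additive_zlin: "Modules.additive (zlin f)"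
proof
  fix P Q :: "'a \<Rightarrow>\<^sub>0 int"
  let ?A = "Poly_Mapping.keys P \<union> Poly_Mapping.keys Q"
  have "Poly_Mapping.keys (P + Q) \<subseteq> ?A" by (rule Poly_Mapping.keys_add)
  then have "zlin f (P + Q) = (\<Sum>k\<in>?A. zmul (Poly_Mapping.lookup (P + Q) k) (f k))"
    by (intro zlin_superset) auto
  also have "\<dots> = zlin f P + zlin f Q"
    by (subst (1 2) zlin_superset[of ?A])
       (auto simp: lookup_add zmod.scale_left_distrib sum.distrib)
  finally show "zlin f (P + Q) = zlin f P + zlin f Q" .
qed

lemma zlin_single [simp]: "zlin f (Poly_Mapping.single k c) = zmul c (f k)"
  by (simp add: zlin_def)

lemma poly_mapping_in_zspan: "P \<in> zspan (range frag_of)"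
  by (rule frag_induction[of P UNIV])
     (auto intro: zmod.span_zero zmod.span_diff zmod.span_base)


lemma zspan_additive_image:
  assumes "Modules.additive f" "x \<in> zspan S"
  shows "f x \<in> zspan (f ` S)"
  using assms(2)
proof (induction rule: zmod.span_induct_alt)
  case base
  show ?case by (simp add: additive.zero[OF assms(1)] zmod.span_zero)
next
  case (step c x y)
  then show ?case
    by (simp add: additive.add[OF assms(1)] additive_zmul[OF assms(1)]
        zmod.span_add zmod.span_scale zmod.span_base)
qed

lemma equivp_zspan: "equivp (\<lambda>P Q. P - Q \<in> zspan S)"
proof (rule equivpI)
  show "reflp (\<lambda>P Q. P - Q \<in> zspan S)" by (simp add: reflp_def zmod.span_zero)
  show "symp (\<lambda>P Q. P - Q \<in> zspan S)"
    by (rule sympI) (metis minus_diff_eq zmod.span_neg)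
  show "transp (\<lambda>P Q. P - Q \<in> zspan S)"
  proof (rule transpI)
    fix P Q T assume "P - Q \<in> zspan S" "Q - T \<in> zspan S"
    from zmod.span_add[OF this] show "P - T \<in> zspan S" by simp
  qed
qed

lemma zspan_add_diff:
  "P - Q \<in> zspan S \<Longrightarrow> P' - Q' \<in> zspan S \<Longrightarrow> (P + P') - (Q + Q') \<in> zspan S"
  by (simp only: add_diff_add zmod.span_add)

lemma zspan_diff_diff:
  assumes "P - Q \<in> zspan S" "P' - Q' \<in> zspan S"
  shows "(P - P') - (Q - Q') \<in> zspan S"
  using zmod.span_diff[OF assms] by (simp add: algebra_simps)

lemma zspan_uminus_diff:
  assumes "P - Q \<in> zspan S"
  shows "(- P) - (- Q) \<in> zspan S"
  using zmod.span_neg[OF assms] by simp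

lemma quotient_in_zspan:
  assumes "Quotient3 R ab rep" "Modules.additive ab"
  shows "z \<in> zspan (range (\<lambda>k. ab (frag_of k)))"
proof -
  have "ab (rep z) = z" using assms(1) by (simp add: Quotient3_def)
  with zspan_additive_image[OF assms(2) poly_mapping_in_zspan[of "rep z"]] show ?thesis
    by (simp add: image_image)
qed

lemma quotient_lift_unique:
  assumes Q: "Quotient3 R ab rep" and R: "\<And>P Q. R P Q \<longleftrightarrow> P - Q \<in> zspan S"
    and ab: "Modules.additive ab" and f: "\<And>s. s \<in> S \<Longrightarrow> zlin f s = 0"
  shows "\<exists>!g. Modules.additive g \<and> (\<forall>k. g (ab (frag_of k)) = f k)"
proof (rule ex_ex1I)
  note a = additive_zlin[of f]
  have 0: "zlin f P = 0" if "P \<in> zspan S" for P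
    by (rule additive_eq_on_zspan[OF a _ _ that, of "\<lambda>_. 0"]) (simp_all add: additive_def f)
  have eq: "zlin f P = zlin f Q" if "R P Q" for P Q
    using 0[OF that[unfolded R]] by (simp add: additive.diff[OF a])
  define g where "g z = zlin f (rep z)" for z
  have g: "g (ab P) = zlin f P" for P
    unfolding g_def by (rule eq, rule Quotient3_rep_abs[OF Q]) (simp add: R zmod.span_zero)
  have "Modules.additive g"
  proof
    fix x y
    have "ab (rep x) = x" "ab (rep y) = y" using Q by (simp_all add: Quotient3_def)
    then have "g (x + y) = g (ab (rep x + rep y))" by (simp add: additive.add[OF ab])
    then show "g (x + y) = g x + g y" by (simp only: g) (simp add: additive.add[OF a] g_def)
  qed
  moreover have "g (ab (frag_of k)) = f k" for k by (simp add: g)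
  ultimately show "\<exists>g. Modules.additive g \<and> (\<forall>k. g (ab (frag_of k)) = f k)" by blast
next
  fix g h
  assume "Modules.additive g \<and> (\<forall>k. g (ab (frag_of k)) = f k)"
         "Modules.additive h \<and> (\<forall>k. h (ab (frag_of k)) = f k)"
  then have "g x = h x" for x
    by - (rule additive_eq_on_zspan[OF _ _ _ quotient_in_zspan[OF Q ab, of x]]; auto)
  then show "g = h" by blast
qed


section \<open>Tensor products over the integers\<close>

definition tensor_rels :: "('a::ab_group_add \<times> 'b::ab_group_add \<Rightarrow>\<^sub>0 int) set" where
  "tensor_rels =
     {frag_of (a + a', b) - frag_of (a, b)
        - frag_of (a', b) | a a' b. True} \<union>
     {frag_of (a, b + b') - frag_of (a, b)
        - frag_of (a, b') | a b b'. True}"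

definition tensor_eq :: "('a::ab_group_add \<times> 'b::ab_group_add \<Rightarrow>\<^sub>0 int) \<Rightarrow> _ \<Rightarrow> bool" where
  "tensor_eq P Q \<longleftrightarrow> P - Q \<in> zspan tensor_rels"

quotient_type (overloaded) ('a, 'b) tensor =
    "('a::ab_group_add \<times> 'b::ab_group_add) \<Rightarrow>\<^sub>0 int" / tensor_eq
  unfolding tensor_eq_def[abs_def] by (rule equivp_zspan)

instantiation tensor :: (ab_group_add, ab_group_add) ab_group_add
begin
lift_definition zero_tensor :: "('a, 'b) tensor" is 0 .
lift_definition plus_tensor :: "('a, 'b) tensor \<Rightarrow> ('a, 'b) tensor \<Rightarrow> ('a, 'b) tensor" is "(+)"
  unfolding tensor_eq_def by (rule zspan_add_diff)
lift_definition minus_tensor :: "('a, 'b) tensor \<Rightarrow> ('a, 'b) tensor \<Rightarrow> ('a, 'b) tensor" is "(-)"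
  unfolding tensor_eq_def by (rule zspan_diff_diff)
lift_definition uminus_tensor :: "('a, 'b) tensor \<Rightarrow> ('a, 'b) tensor" is "uminus"
  unfolding tensor_eq_def by (rule zspan_uminus_diff)
instance
  by standard (transfer; simp add: tensor_eq_def zmod.span_zero algebra_simps)+
end

lift_definition tens :: "'a::ab_group_add \<Rightarrow> 'b::ab_group_add \<Rightarrow> ('a, 'b) tensor"  (infixr \<open>\<otimes>\<^sub>t\<close> 72)
  is "\<lambda>a b. frag_of (a, b)" .

definition biadditive :: "('a::ab_group_add \<Rightarrow> 'b::ab_group_add \<Rightarrow> 'c::ab_group_add) \<Rightarrow> bool" where
  "biadditive f \<longleftrightarrow>
     (\<forall>b. Modules.additive (\<lambda>a. f a b)) \<and> (\<forall>a. Modules.additive (f a))"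

definition tensor_lift ::
    "('a::ab_group_add \<Rightarrow> 'b::ab_group_add \<Rightarrow> 'c::ab_group_add) \<Rightarrow> ('a, 'b) tensor \<Rightarrow> 'c" where
  "tensor_lift f = (THE g. Modules.additive g \<and> (\<forall>a b. g (a \<otimes>\<^sub>t b) = f a b))"

lemma biadditive_tens: "biadditive (\<otimes>\<^sub>t)"
proof -
  have "(a + a') \<otimes>\<^sub>t b = a \<otimes>\<^sub>t b + a' \<otimes>\<^sub>t b" for a a' :: 'a and b :: 'b
    by transfer (unfold tensor_eq_def diff_diff_eq[symmetric],
        rule zmod.span_base, unfold tensor_rels_def, blast)
  moreover have "a \<otimes>\<^sub>t (b + b') = a \<otimes>\<^sub>t b + a \<otimes>\<^sub>t b'" for a :: 'a and b b' :: 'b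
    by transfer (unfold tensor_eq_def diff_diff_eq[symmetric],
        rule zmod.span_base, unfold tensor_rels_def, blast)
  ultimately show ?thesis by (simp add: biadditive_def additive_def)
qed

lemma tens_add_left: "(a + a') \<otimes>\<^sub>t b = a \<otimes>\<^sub>t b + a' \<otimes>\<^sub>t b"
  and tens_add_right: "a \<otimes>\<^sub>t (b + b') = a \<otimes>\<^sub>t b + a \<otimes>\<^sub>t b'"
  using biadditive_tens unfolding biadditive_def additive_def by blast+

lemma tensor_in_zspan: "z \<in> zspan {a \<otimes>\<^sub>t b | a b. True}"
proof -
  have "Modules.additive abs_tensor" by (simp add: additive_def plus_tensor.abs_eq)
  from quotient_in_zspan[OF Quotient3_tensor this, of z] show ?thesis
    by (rule set_mp[OF zmod.span_mono, rotated]) (auto simp: tens.abs_eq)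
qed

lemma tensor_lift_unique:
  assumes "biadditive f"
  shows "\<exists>!g. Modules.additive g \<and> (\<forall>a b. g (a \<otimes>\<^sub>t b) = f a b)"
proof -
  have "\<exists>!g. Modules.additive g \<and> (\<forall>k. g (abs_tensor (frag_of k)) = (\<lambda>(a, b). f a b) k)"
  proof (rule quotient_lift_unique[OF Quotient3_tensor tensor_eq_def])
    show "Modules.additive abs_tensor" by (simp add: additive_def plus_tensor.abs_eq)
    show "zlin (\<lambda>(a, b). f a b) s = 0" if "s \<in> tensor_rels" for s
      using that assms unfolding tensor_rels_def biadditive_def additive_def
      by (auto simp: additive.diff[OF additive_zlin])
  qed
  then show ?thesis by (simp add: tens.abs_eq)
qed

lemma
  assumes "biadditive f"
  shows additive_tensor_lift: "Modules.additive (tensor_lift f)"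
    and tensor_lift_tens: "tensor_lift f (a \<otimes>\<^sub>t b) = f a b"
  using theI'[OF tensor_lift_unique[OF assms]] unfolding tensor_lift_def by auto


section \<open>Exterior algebra\<close>

text \<open>\<open>[u\<^sub>1, \<dots>, u\<^sub>r]\<close> in the free abelian group on lists stands for
  \<open>u\<^sub>1 \<otimes> \<dots> \<otimes> u\<^sub>r\<close>; the relations make this tensor algebra out of it and then kill the
  two-sided ideal generated by the squares \<open>a \<otimes> a\<close>.\<close>

definition ext_rels :: "('u::ab_group_add list \<Rightarrow>\<^sub>0 int) set" where
  "ext_rels =
     {frag_of (us @ (a + b) # vs) - frag_of (us @ a # vs) - frag_of (us @ b # vs)
        | us a b vs. True} \<union>
     {frag_of (us @ a # a # vs) | us a vs. True}"

definition ext_eq :: "('u::ab_group_add list \<Rightarrow>\<^sub>0 int) \<Rightarrow> _ \<Rightarrow> bool" where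
  "ext_eq P Q \<longleftrightarrow> P - Q \<in> zspan ext_rels"

quotient_type (overloaded) 'u ext = "'u::ab_group_add list \<Rightarrow>\<^sub>0 int" / ext_eq
  unfolding ext_eq_def[abs_def] by (rule equivp_zspan)

instantiation ext :: (ab_group_add) ab_group_add
begin
lift_definition zero_ext :: "'a ext" is 0 .
lift_definition plus_ext :: "'a ext \<Rightarrow> 'a ext \<Rightarrow> 'a ext" is "(+)"
  unfolding ext_eq_def by (rule zspan_add_diff)
lift_definition minus_ext :: "'a ext \<Rightarrow> 'a ext \<Rightarrow> 'a ext" is "(-)"
  unfolding ext_eq_def by (rule zspan_diff_diff)
lift_definition uminus_ext :: "'a ext \<Rightarrow> 'a ext" is "uminus"
  unfolding ext_eq_def by (rule zspan_uminus_diff)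
instance
  by standard (transfer; simp add: ext_eq_def zmod.span_zero algebra_simps)+
end

lift_definition wedge :: "'u::ab_group_add list \<Rightarrow> 'u ext" is "\<lambda>us. frag_of us" .

definition ext_lift :: "('u::ab_group_add list \<Rightarrow> 'c::ab_group_add) \<Rightarrow> 'u ext \<Rightarrow> 'c" where
  "ext_lift f = (THE g. Modules.additive g \<and> (\<forall>us. g (wedge us) = f us))"

definition alternating :: "('u::ab_group_add list \<Rightarrow> 'c::ab_group_add) \<Rightarrow> bool" where
  "alternating f \<longleftrightarrow>
     (\<forall>us a b vs. f (us @ (a + b) # vs) = f (us @ a # vs) + f (us @ b # vs)) \<and>
     (\<forall>us a vs. f (us @ a # a # vs) = 0)"

lemma ext_lift_unique:
  assumes "alternating f"
  shows "\<exists>!g. Modules.additive g \<and> (\<forall>us. g (wedge us) = f us)"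
proof -
  have "\<exists>!g. Modules.additive g \<and> (\<forall>us. g (abs_ext (frag_of us)) = f us)"
  proof (rule quotient_lift_unique[OF Quotient3_ext ext_eq_def])
    show "Modules.additive abs_ext" by (simp add: additive_def plus_ext.abs_eq)
    show "zlin f s = 0" if "s \<in> ext_rels" for s
      using that assms unfolding ext_rels_def alternating_def
      by (auto simp: additive.diff[OF additive_zlin])
  qed
  then show ?thesis by (simp add: wedge.abs_eq)
qed

lemma
  assumes "alternating f"
  shows additive_ext_lift: "Modules.additive (ext_lift f)"
    and ext_lift_wedge: "ext_lift f (wedge us) = f us"
  using theI'[OF ext_lift_unique[OF assms]] unfolding ext_lift_def by auto

lemma alternating_wedge: "alternating wedge"
proof -
  have "wedge (us @ (a + b) # vs) = wedge (us @ a # vs) + wedge (us @ b # vs)"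
    for us vs and a b :: 'a
    by transfer (unfold ext_eq_def diff_diff_eq[symmetric],
        rule zmod.span_base, unfold ext_rels_def, blast)
  moreover have "wedge (us @ a # a # vs) = 0" for us vs and a :: 'a
    by transfer (unfold ext_eq_def diff_zero,
        rule zmod.span_base, unfold ext_rels_def, blast)
  ultimately show ?thesis by (simp add: alternating_def)
qed

definition wedge_left :: "'u::ab_group_add \<Rightarrow> 'u ext \<Rightarrow> 'u ext" where
  "wedge_left u = ext_lift (\<lambda>us. wedge (u # us))"

lemma alternating_wedge_Cons: "alternating (\<lambda>us. wedge (u # us))"
  using alternating_wedge unfolding alternating_def by (metis append_Cons)

text \<open>The action of \<open>f \<in> U\<^sup>*\<close> on the exterior algebra; the factors are numbered from 0.\<close>

definition ext_contract_list :: "('u::ab_group_add \<Rightarrow> int) \<Rightarrow> 'u list \<Rightarrow> 'u ext" where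
  "ext_contract_list f us =
     (\<Sum>i<length us. zmul ((-1) ^ i * f (us ! i)) (wedge (take i us @ drop (Suc i) us)))"

definition ext_contract :: "('u::ab_group_add \<Rightarrow> int) \<Rightarrow> 'u ext \<Rightarrow> 'u ext" where
  "ext_contract f = ext_lift (ext_contract_list f)"

lemma ext_contract_list_Cons:
  "ext_contract_list f (u # us) = zmul (f u) (wedge us) - wedge_left u (ext_contract_list f us)"
proof -
  note a = additive_ext_lift[OF alternating_wedge_Cons[of u], folded wedge_left_def]
  note w = ext_lift_wedge[OF alternating_wedge_Cons[of u], folded wedge_left_def]
  show ?thesis
    unfolding ext_contract_list_def
    by (simp add: sum.lessThan_Suc_shift additive.sum[OF a] additive_zmul[OF a] w
        sum_negf[symmetric] del: sum.lessThan_Suc)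
qed

lemma alternating_ext_contract_list:
  assumes f: "Modules.additive f"
  shows "alternating (ext_contract_list f)"
proof -
  note A = additive_ext_lift[OF alternating_wedge_Cons, folded wedge_left_def]
  note W = ext_lift_wedge[OF alternating_wedge_Cons, folded wedge_left_def]
  note E = alternating_wedge[unfolded alternating_def]
  have add: "wedge_left (a + b) z = wedge_left a z + wedge_left b z" for a b :: 'a and z
  proof (rule additive_eq_on_zspan[of "wedge_left (a + b)" "\<lambda>z. wedge_left a z + wedge_left b z"
        "range wedge"])
    show "z \<in> zspan (range wedge)"
      using quotient_in_zspan[OF Quotient3_ext, of z]
      by (simp add: additive_def plus_ext.abs_eq wedge.abs_eq)
    show "wedge_left (a + b) s = wedge_left a s + wedge_left b s" if "s \<in> range wedge" for s
    proof -
      obtain us where s: "s = wedge us" using \<open>s \<in> range wedge\<close> by blast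
      have "wedge ([] @ (a + b) # us) = wedge ([] @ a # us) + wedge ([] @ b # us)"
        using E by blast
      then show ?thesis by (simp add: s W)
    qed
  qed (simp_all add: A additive_def additive.add[OF A])
  have sq: "wedge_left a (wedge_left a z) = 0" for a :: 'a and z
  proof (rule additive_eq_on_zspan[of "\<lambda>z. wedge_left a (wedge_left a z)" "\<lambda>_. 0" "range wedge"])
    show "z \<in> zspan (range wedge)"
      using quotient_in_zspan[OF Quotient3_ext, of z]
      by (simp add: additive_def plus_ext.abs_eq wedge.abs_eq)
    show "wedge_left a (wedge_left a s) = 0" if "s \<in> range wedge" for s
    proof -
      obtain us where s: "s = wedge us" using \<open>s \<in> range wedge\<close> by blast
      have "wedge ([] @ a # a # us) = 0" using E by blast
      then show ?thesis by (simp add: s W)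
    qed
  qed (simp_all add: additive_def additive.add[OF A])
  have "ext_contract_list f (us @ (a + b) # vs)
      = ext_contract_list f (us @ a # vs) + ext_contract_list f (us @ b # vs)" for us vs a b
  proof (induction us)
    case Nil
    show ?case
      by (simp add: ext_contract_list_Cons add additive.add[OF f] zmod.scale_left_distrib)
  next
    case (Cons u us)
    have "wedge (us @ (a + b) # vs) = wedge (us @ a # vs) + wedge (us @ b # vs)"
      using E by blast
    with Cons show ?case
      by (simp add: ext_contract_list_Cons additive.add[OF A] zmod.scale_right_distrib)
  qed
  moreover have "ext_contract_list f (us @ a # a # vs) = 0" for us vs a
  proof (induction us)
    case Nil
    show ?case
      by (simp add: ext_contract_list_Cons additive.diff[OF A] additive_zmul[OF A] W sq)
  next
    case (Cons u us)
    have "wedge (us @ a # a # vs) = 0" using E by blast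
    with Cons show ?case
      by (simp add: ext_contract_list_Cons additive.zero[OF A])
  qed
  ultimately show ?thesis by (simp add: alternating_def)
qed

text \<open>The image of the \<open>a\<close>-th exterior power of the subgroup \<open>V\<close>.\<close>

definition ext_pow :: "'u::ab_group_add set \<Rightarrow> nat \<Rightarrow> 'u ext set" where
  "ext_pow V a = zspan {wedge us | us. set us \<subseteq> V \<and> length us = a}"


section \<open>Symmetric algebra\<close>

text \<open>The free commutative ring on the elements of \<open>M\<close>, i.e. the monoid ring of the
  multisets over \<open>M\<close>, modulo the ideal generated by the elements \<open>[a + b] - [a] - [b]\<close>.\<close>

definition sym_rels :: "('m::ab_group_add multiset \<Rightarrow>\<^sub>0 int) set" where
  "sym_rels = {frag_of (m + {#a + b#}) - frag_of (m + {#a#}) - frag_of (m + {#b#}) | m a b. True}"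

definition sym_eq :: "('m::ab_group_add multiset \<Rightarrow>\<^sub>0 int) \<Rightarrow> _ \<Rightarrow> bool" where
  "sym_eq P Q \<longleftrightarrow> P - Q \<in> zspan sym_rels"

quotient_type (overloaded) 'm sym = "'m::ab_group_add multiset \<Rightarrow>\<^sub>0 int" / sym_eq
  unfolding sym_eq_def[abs_def] by (rule equivp_zspan)

lemma sym_rels_ideal:
  assumes "Q \<in> zspan sym_rels"
  shows "P * Q \<in> zspan sym_rels"
proof (rule frag_induction[of P UNIV])
  fix m :: "'a multiset"
  have a: "Modules.additive ((*) (frag_of m))" by (simp add: additive_def distrib_left)
  have "frag_of m * s \<in> sym_rels" if s0: "s \<in> sym_rels" for s
  proof -
    obtain k a b where
      s: "s = frag_of (k + {#a + b#}) - frag_of (k + {#a#}) - frag_of (k + {#b#})"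
      using s0 unfolding sym_rels_def by blast
    have "frag_of m * s = frag_of ((m + k) + {#a + b#}) - frag_of ((m + k) + {#a#})
        - frag_of ((m + k) + {#b#})"
      by (simp only: s right_diff_distrib mult_single add.assoc mult_1)
    then show ?thesis unfolding sym_rels_def by blast
  qed
  then have "(*) (frag_of m) ` sym_rels \<subseteq> sym_rels" by blast
  then show "frag_of m * Q \<in> zspan sym_rels"
    using zspan_additive_image[OF a assms] zmod.span_mono by blast
qed (auto simp: zmod.span_zero left_diff_distrib intro: zmod.span_diff)

instantiation sym :: (ab_group_add) comm_ring_1
begin
lift_definition zero_sym :: "'a sym" is 0 .
lift_definition one_sym :: "'a sym" is 1 .
lift_definition plus_sym :: "'a sym \<Rightarrow> 'a sym \<Rightarrow> 'a sym" is "(+)"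
  unfolding sym_eq_def by (rule zspan_add_diff)
lift_definition minus_sym :: "'a sym \<Rightarrow> 'a sym \<Rightarrow> 'a sym" is "(-)"
  unfolding sym_eq_def by (rule zspan_diff_diff)
lift_definition uminus_sym :: "'a sym \<Rightarrow> 'a sym" is "uminus"
  unfolding sym_eq_def by (rule zspan_uminus_diff)
lift_definition times_sym :: "'a sym \<Rightarrow> 'a sym \<Rightarrow> 'a sym" is "(*)"
proof -
  fix P Q P' Q' :: "'a multiset \<Rightarrow>\<^sub>0 int"
  assume "sym_eq P Q" "sym_eq P' Q'"
  then have "P' * (P - Q) + Q * (P' - Q') \<in> zspan sym_rels"
    unfolding sym_eq_def by (intro zmod.span_add sym_rels_ideal)
  moreover have "P' * (P - Q) + Q * (P' - Q') = P * P' - Q * Q'"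
    by (simp add: algebra_simps)
  ultimately show "sym_eq (P * P') (Q * Q')" by (simp add: sym_eq_def)
qed
instance
proof
  show "(0 :: 'a sym) \<noteq> 1"
  proof (transfer, rule notI)
    assume "sym_eq (0 :: 'a multiset \<Rightarrow>\<^sub>0 int) 1"
    then have *: "- 1 \<in> zspan (sym_rels :: ('a multiset \<Rightarrow>\<^sub>0 int) set)"
      by (simp add: sym_eq_def)
    have "Poly_Mapping.lookup (- 1 :: 'a multiset \<Rightarrow>\<^sub>0 int) {#} = 0"
      by (rule additive_eq_on_zspan[OF _ _ _ *, of "\<lambda>P. Poly_Mapping.lookup P {#}" "\<lambda>_. 0"])
         (auto simp: additive_def lookup_add sym_rels_def lookup_minus lookup_single when_def)
    then show False by (simp add: lookup_one)
  qed
qed (transfer; simp add: sym_eq_def zmod.span_zero algebra_simps)+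
end

lift_definition sym_of :: "'m::ab_group_add \<Rightarrow> 'm sym" is "\<lambda>a. frag_of {#a#}" .

lemma additive_sym_of: "Modules.additive sym_of"
proof
  fix a b :: 'a
  show "sym_of (a + b) = sym_of a + sym_of b"
  proof (transfer, unfold sym_eq_def diff_diff_eq[symmetric], rule zmod.span_base)
    fix a b :: 'a
    have "frag_of ({#} + {#a + b#}) - frag_of ({#} + {#a#}) - frag_of ({#} + {#b#}) \<in> sym_rels"
      unfolding sym_rels_def by blast
    then show "frag_of {#a + b#} - frag_of {#a#} - frag_of {#b#} \<in> sym_rels" by simp
  qed
qed

lifting_forget sym.lifting

text \<open>The image of the \<open>b\<close>-th symmetric power of the subgroup \<open>V\<close>.\<close>

definition sym_pow :: "'u::ab_group_add set \<Rightarrow> nat \<Rightarrow> 'u sym set" where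
  "sym_pow V b = zspan {prod_mset (image_mset sym_of m) | m. set_mset m \<subseteq> V \<and> size m = b}"

lemma sym_induct_products:
  "z \<in> zspan (range (\<lambda>m. prod_mset (image_mset sym_of m)))"
proof -
  have *: "abs_sym (frag_of m) = prod_mset (image_mset sym_of m)" for m :: "'a multiset"
  proof (induction m)
    case empty
    show ?case by (simp add: one_sym.abs_eq flip: single_one)
  next
    case (add a m)
    have "frag_of (add_mset a m) = frag_of {#a#} * frag_of m" by (simp add: mult_single)
    then have "abs_sym (frag_of (add_mset a m)) = sym_of a * abs_sym (frag_of m)"
      by (simp add: sym_of.abs_eq times_sym.abs_eq)
    then show ?case by (simp add: add)
  qed
  show ?thesis
    using quotient_in_zspan[OF Quotient3_sym, of z]
    by (simp add: additive_def plus_sym.abs_eq *)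
qed

lemma prod_mult_sym_pow:
  assumes "\<mu> \<in> sym_pow UNIV b"
  shows "prod_mset (image_mset sym_of m) * \<mu> \<in> sym_pow UNIV (size m + b)"
proof -
  let ?f = "(*) (prod_mset (image_mset sym_of m))"
  have a: "Modules.additive ?f" by (simp add: additive_def distrib_left)
  have "?f ` {prod_mset (image_mset sym_of k) | k. set_mset k \<subseteq> UNIV \<and> size k = b}
      \<subseteq> {prod_mset (image_mset sym_of k) | k. set_mset k \<subseteq> UNIV \<and> size k = size m + b}"
    by auto (metis image_mset_union prod_mset.union size_union)
  with zspan_additive_image[OF a assms[unfolded sym_pow_def]] show ?thesis
    unfolding sym_pow_def using zmod.span_mono by blast
qed


section \<open>Divided powers of the dual\<close>

text \<open>The graded dual of the symmetric algebra of \<open>U\<close>: linear functionals vanishing on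
  almost all graded components.\<close>

typedef (overloaded) 'u dpow =
    "{\<nu> :: 'u::ab_group_add sym \<Rightarrow> int. Modules.additive \<nu> \<and>
        (\<exists>N. \<forall>b>N. \<forall>\<mu>\<in>sym_pow UNIV b. \<nu> \<mu> = 0)}"
  morphisms dapply Abs_dpow
  by (rule exI[of _ "\<lambda>_. 0"]) (simp add: additive_def)

setup_lifting type_definition_dpow

instantiation dpow :: (ab_group_add) ab_group_add
begin
lift_definition zero_dpow :: "'a dpow" is "\<lambda>_. 0" by (simp add: additive_def)
lift_definition plus_dpow :: "'a dpow \<Rightarrow> 'a dpow \<Rightarrow> 'a dpow"
  is "\<lambda>\<nu> \<nu>' \<mu>. \<nu> \<mu> + \<nu>' \<mu>"
proof (elim conjE exE, intro conjI)
  fix \<nu> \<nu>' :: "'a sym \<Rightarrow> int" and N N'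
  assume N: "\<forall>b>N. \<forall>\<mu>\<in>sym_pow UNIV b. \<nu> \<mu> = 0" "\<forall>b>N'. \<forall>\<mu>\<in>sym_pow UNIV b. \<nu>' \<mu> = 0"
  have "\<nu> \<mu> + \<nu>' \<mu> = 0" if "b > max N N'" "\<mu> \<in> sym_pow UNIV b" for b \<mu>
    using N that by (metis add_0 max_less_iff_conj)
  then show "\<exists>N. \<forall>b>N. \<forall>\<mu>\<in>sym_pow UNIV b. \<nu> \<mu> + \<nu>' \<mu> = 0" by blast
qed (simp add: additive_def)
lift_definition uminus_dpow :: "'a dpow \<Rightarrow> 'a dpow" is "\<lambda>\<nu> \<mu>. - \<nu> \<mu>"
  by (simp add: additive_def)
lift_definition minus_dpow :: "'a dpow \<Rightarrow> 'a dpow \<Rightarrow> 'a dpow"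
  is "\<lambda>\<nu> \<nu>' \<mu>. \<nu> \<mu> - \<nu>' \<mu>"
proof (elim conjE exE, intro conjI)
  fix \<nu> \<nu>' :: "'a sym \<Rightarrow> int" and N N'
  assume N: "\<forall>b>N. \<forall>\<mu>\<in>sym_pow UNIV b. \<nu> \<mu> = 0" "\<forall>b>N'. \<forall>\<mu>\<in>sym_pow UNIV b. \<nu>' \<mu> = 0"
  have "\<nu> \<mu> - \<nu>' \<mu> = 0" if "b > max N N'" "\<mu> \<in> sym_pow UNIV b" for b \<mu>
    using N that by (metis diff_self max_less_iff_conj)
  then show "\<exists>N. \<forall>b>N. \<forall>\<mu>\<in>sym_pow UNIV b. \<nu> \<mu> - \<nu>' \<mu> = 0" by blast
qed (simp add: additive_def)
instance
  by standard (transfer, simp add: fun_eq_iff)+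
end

lift_definition contract :: "'u::ab_group_add sym \<Rightarrow> 'u dpow \<Rightarrow> 'u dpow"
  is "\<lambda>\<mu> \<nu> \<mu>'. \<nu> (\<mu> * \<mu>')"
proof (elim conjE exE, intro conjI)
  fix \<mu> :: "'u sym" and \<nu> :: "'u sym \<Rightarrow> int" and N
  assume a: "Modules.additive \<nu>" and N: "\<forall>b>N. \<forall>\<mu>\<in>sym_pow UNIV b. \<nu> \<mu> = 0"
  show "Modules.additive (\<lambda>\<mu>'. \<nu> (\<mu> * \<mu>'))"
    by (simp add: additive_def distrib_left additive.add[OF a])
  have "\<nu> (\<mu> * \<mu>') = 0" if "b > N" "\<mu>' \<in> sym_pow UNIV b" for b \<mu>'
  proof (rule additive_eq_on_zspan[OF _ _ _ sym_induct_products[of \<mu>],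
        of "\<lambda>\<mu>. \<nu> (\<mu> * \<mu>')" "\<lambda>_. 0"])
    fix s assume "s \<in> range (\<lambda>m. prod_mset (image_mset sym_of m) :: 'u sym)"
    then obtain m where "s = prod_mset (image_mset sym_of m)" by blast
    moreover have "size m + b > N" using that(1) by simp
    ultimately show "\<nu> (s * \<mu>') = 0" using prod_mult_sym_pow[OF that(2), of m] N by blast
  qed (simp_all add: additive_def distrib_right additive.add[OF a])
  then show "\<exists>N. \<forall>b>N. \<forall>\<mu>'\<in>sym_pow UNIV b. \<nu> (\<mu> * \<mu>') = 0" by blast
qed

definition dpow_deg :: "nat \<Rightarrow> 'u::ab_group_add dpow set" where
  "dpow_deg b = {\<nu>. \<forall>c. c \<noteq> b \<longrightarrow> (\<forall>\<mu>\<in>sym_pow UNIV c. dapply \<nu> \<mu> = 0)}"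

text \<open>\<open>D\<^sub>b(U\<^sub>0\<^sup>*)\<close> for \<open>U\<^sub>0\<^sup>* = {f \<in> U\<^sup>*. f x1 = 0}\<close>. The inclusion of \<open>U\<^sub>0\<^sup>*\<close> into \<open>U\<^sup>*\<close> is dual
  to the projection of \<open>U\<close> onto \<open>U / \<int>x1\<close> (which \<open>U\<^sub>0\<close> maps to isomorphically), so that the
  functionals on the \<open>b\<close>-th symmetric power of \<open>U / \<int>x1\<close> become the functionals killing all
  multiples of \<open>x1\<close>.\<close>

definition dpow_deg0 :: "'u::ab_group_add \<Rightarrow> nat \<Rightarrow> 'u dpow set" where
  "dpow_deg0 x1 b = {\<nu> \<in> dpow_deg b. contract (sym_of x1) \<nu> = 0}"


section \<open>Base change\<close>

text \<open>For a commutative ring \<open>R\<close>, the type \<open>(R, M) tensor\<close> is the \<open>R\<close>-module \<open>R \<otimes> M\<close>.\<close>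

definition tscale ::
    "'r::comm_ring_1 \<Rightarrow> ('r, 'm::ab_group_add) tensor \<Rightarrow> ('r, 'm) tensor" where
  "tscale r = tensor_lift (\<lambda>s m. (r * s) \<otimes>\<^sub>t m)"

text \<open>The image of \<open>R \<otimes> N\<close> in \<open>R \<otimes> M\<close>, for a subgroup \<open>N\<close> of \<open>M\<close>. Here \<open>R\<close> is always the ring
  \<open>\<RR>\<close> below, which is free over the integers, so this is \<open>R \<otimes> N\<close>.\<close>

definition base_change :: "'m::ab_group_add set \<Rightarrow> ('r::comm_ring_1, 'm) tensor set" where
  "base_change N = zspan {r \<otimes>\<^sub>t m | r m. m \<in> N}"

text \<open>The \<open>R\<close>-linear extensions of \<open>f : M \<rightarrow> N\<close> and of \<open>F : M \<rightarrow> R \<otimes> N\<close>.\<close>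

definition rmap :: "('m::ab_group_add \<Rightarrow> 'n::ab_group_add) \<Rightarrow>
    ('r::comm_ring_1, 'm) tensor \<Rightarrow> ('r, 'n) tensor" where
  "rmap f = tensor_lift (\<lambda>r m. r \<otimes>\<^sub>t f m)"

definition rext :: "('m::ab_group_add \<Rightarrow> ('r::comm_ring_1, 'n::ab_group_add) tensor) \<Rightarrow>
    ('r, 'm) tensor \<Rightarrow> ('r, 'n) tensor" where
  "rext F = tensor_lift (\<lambda>r m. tscale r (F m))"

text \<open>\<open>\<theta> \<otimes> y \<in> R \<otimes> (E \<otimes> M)\<close> for \<open>\<theta> \<in> E\<close> and \<open>y \<in> R \<otimes> M\<close>\<close>

definition tens_left :: "'e::ab_group_add \<Rightarrow> ('r::comm_ring_1, 'm::ab_group_add) tensor \<Rightarrow>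
    ('r, ('e, 'm) tensor) tensor" where
  "tens_left \<theta> = rmap (\<lambda>m. \<theta> \<otimes>\<^sub>t m)"

definition rcontract :: "'u::ab_group_add sym \<Rightarrow> ('r::comm_ring_1, 'u dpow) tensor \<Rightarrow>
    ('r, 'u dpow) tensor" where
  "rcontract \<mu> = rmap (contract \<mu>)"

definition reval :: "('r::comm_ring_1, 'u::ab_group_add dpow) tensor \<Rightarrow> 'u sym \<Rightarrow> 'r" where
  "reval \<phi> \<mu> = tensor_lift (\<lambda>r \<nu>. r * of_int (dapply \<nu> \<mu>)) \<phi>"

lemma additive_rmap:
  fixes f :: "'m::ab_group_add \<Rightarrow> 'n::ab_group_add" and r :: "'r::comm_ring_1"
  assumes "Modules.additive f"
  shows "Modules.additive (rmap f :: ('r, 'm) tensor \<Rightarrow> ('r, 'n) tensor)" "rmap f (r \<otimes>\<^sub>t m) = r \<otimes>\<^sub>t f m"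
proof -
  have "biadditive (\<lambda>(r::'r) m. r \<otimes>\<^sub>t f m)"
    using biadditive_tens[where 'a = 'r and 'b = 'n] assms by (auto simp: biadditive_def additive_def)
  from additive_tensor_lift[OF this] tensor_lift_tens[OF this]
  show "Modules.additive (rmap f :: ('r, 'm) tensor \<Rightarrow> ('r, 'n) tensor)" "rmap f (r \<otimes>\<^sub>t m) = r \<otimes>\<^sub>t f m"
    by (simp_all add: rmap_def)
qed

lemma module_tscale:
  "Modules.module (tscale :: 'r::comm_ring_1 \<Rightarrow> ('r, 'm::ab_group_add) tensor \<Rightarrow> _)"
  and tscale_tens: "tscale (r :: 'r) (s \<otimes>\<^sub>t m) = (r * s) \<otimes>\<^sub>t (m :: 'm)"
proof -
  have bi: "biadditive (\<lambda>(s::'r) (m::'m). (r * s) \<otimes>\<^sub>t m)" for r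
    using biadditive_tens[where 'a = 'r and 'b = 'm]
    by (auto simp: biadditive_def additive_def distrib_left)
  note a = additive_tensor_lift[OF bi, folded tscale_def]
  note t = tensor_lift_tens[OF bi, folded tscale_def]
  show "tscale r (s \<otimes>\<^sub>t m) = (r * s) \<otimes>\<^sub>t m" for r s :: 'r and m :: 'm by (rule t)
  have add1: "(r + s) \<otimes>\<^sub>t m = r \<otimes>\<^sub>t m + s \<otimes>\<^sub>t m" for r s :: 'r and m :: 'm
    using biadditive_tens[where 'a = 'r and 'b = 'm] by (simp add: biadditive_def additive_def)
  have i: "f z = g z"
    if "Modules.additive f" "Modules.additive g" "\<And>s m. f (s \<otimes>\<^sub>t m) = g (s \<otimes>\<^sub>t m)"
    for f g :: "('r, 'm) tensor \<Rightarrow> ('r, 'm) tensor" and z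
    by (rule additive_eq_on_zspan[OF that(1,2) _ tensor_in_zspan]) (auto simp: that(3))
  show "Modules.module (tscale :: 'r \<Rightarrow> ('r, 'm) tensor \<Rightarrow> _)"
  proof
    fix r s :: 'r and x y :: "('r, 'm) tensor"
    show "tscale r (x + y) = tscale r x + tscale r y" by (rule additive.add[OF a])
    show "tscale (r + s) x = tscale r x + tscale s x"
      by (rule i) (auto simp: additive_def additive.add[OF a] t add1 distrib_right)
    show "tscale r (tscale s x) = tscale (r * s) x"
      by (rule i) (auto simp: additive_def additive.add[OF a] t mult.assoc)
    show "tscale 1 x = x"
      by (rule i) (auto simp: additive_def additive.add[OF a] t)
  qed
qed

lemma additive_rext:
  assumes "Modules.additive F"
  shows "Modules.additive (rext F)" "rext F (r \<otimes>\<^sub>t m) = tscale r (F m)"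
proof -
  have "biadditive (\<lambda>(r::'b) m. tscale r (F m))"
    using module_tscale[where 'r = 'b and 'm = 'c] assms
    by (auto simp: biadditive_def additive_def Modules.module_def)
  from additive_tensor_lift[OF this] tensor_lift_tens[OF this]
  show "Modules.additive (rext F)" "rext F (r \<otimes>\<^sub>t m) = tscale r (F m)"
    by (simp_all add: rext_def)
qed


section \<open>The complexes of modules\<close>

subsection \<open>Koszul-type maps\<close>

text \<open>In \<open>kappa I x xd\<close> and \<open>eta I x xd\<close>, the \<open>x i\<close> with \<open>i \<in> I\<close> form a basis of \<open>U\<close> (or of \<open>U\<^sub>0\<close>),
  and the functionals \<open>xd i\<close> the dual basis.\<close>

definition kappa :: "nat set \<Rightarrow> (nat \<Rightarrow> 'u::ab_group_add) \<Rightarrow> (nat \<Rightarrow> 'u \<Rightarrow> int) \<Rightarrow>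
    ('u ext, 'u sym) tensor \<Rightarrow> ('u ext, 'u sym) tensor" where
  "kappa I x xd =
     tensor_lift (\<lambda>\<theta> \<mu>. \<Sum>i\<in>I. ext_contract (xd i) \<theta> \<otimes>\<^sub>t (sym_of (x i) * \<mu>))"

definition eta :: "nat set \<Rightarrow> (nat \<Rightarrow> 'u::ab_group_add) \<Rightarrow> (nat \<Rightarrow> 'u \<Rightarrow> int) \<Rightarrow>
    ('u ext, 'u dpow) tensor \<Rightarrow> ('u ext, 'u dpow) tensor" where
  "eta I x xd =
     tensor_lift (\<lambda>\<theta> \<nu>. \<Sum>i\<in>I. ext_contract (xd i) \<theta> \<otimes>\<^sub>t contract (sym_of (x i)) \<nu>)"

lemma biadditive_sum_tens:
  assumes "\<And>i. i \<in> I \<Longrightarrow> Modules.additive (f i)" "\<And>i. i \<in> I \<Longrightarrow> Modules.additive (g i)"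
  shows "biadditive (\<lambda>a b. \<Sum>i\<in>I. f i a \<otimes>\<^sub>t g i b)"
  using assms unfolding biadditive_def additive_def
  by (simp add: sum.distrib tens_add_left tens_add_right)

lemma
  fixes x :: "nat \<Rightarrow> 'a::ab_group_add"
  assumes "\<And>i. i \<in> I \<Longrightarrow> Modules.additive (xd i)"
  shows additive_kappa: "Modules.additive (kappa I x xd)"
    and kappa_tens: "kappa I x xd (\<theta> \<otimes>\<^sub>t \<mu>) =
      (\<Sum>i\<in>I. ext_contract (xd i) \<theta> \<otimes>\<^sub>t (sym_of (x i) * \<mu>))"
    and additive_eta: "Modules.additive (eta I x xd)"
    and eta_tens: "eta I x xd (\<theta> \<otimes>\<^sub>t \<nu>) =
      (\<Sum>i\<in>I. ext_contract (xd i) \<theta> \<otimes>\<^sub>t contract (sym_of (x i)) \<nu>)"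
proof -
  have c: "Modules.additive (ext_contract (xd i))" if "i \<in> I" for i
    unfolding ext_contract_def
    by (rule additive_ext_lift, rule alternating_ext_contract_list, rule assms, fact)
  have k: "biadditive (\<lambda>\<theta> \<mu>. \<Sum>i\<in>I. ext_contract (xd i) \<theta> \<otimes>\<^sub>t (sym_of (x i) * \<mu>))"
    by (rule biadditive_sum_tens, rule c) (simp_all add: additive_def distrib_left)
  have "Modules.additive (contract \<mu>)" for \<mu> :: "'a sym"
    by (unfold additive_def, transfer) (simp add: fun_eq_iff)
  then have e: "biadditive (\<lambda>\<theta> \<nu>. \<Sum>i\<in>I. ext_contract (xd i) \<theta> \<otimes>\<^sub>t contract (sym_of (x i)) \<nu>)"
    by (intro biadditive_sum_tens c)
  show "Modules.additive (kappa I x xd)" "Modules.additive (eta I x xd)"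
    "kappa I x xd (\<theta> \<otimes>\<^sub>t \<mu>) = (\<Sum>i\<in>I. ext_contract (xd i) \<theta> \<otimes>\<^sub>t (sym_of (x i) * \<mu>))"
    "eta I x xd (\<theta> \<otimes>\<^sub>t \<nu>) = (\<Sum>i\<in>I. ext_contract (xd i) \<theta> \<otimes>\<^sub>t contract (sym_of (x i)) \<nu>)"
    unfolding kappa_def eta_def
    by (rule additive_tensor_lift[OF k] additive_tensor_lift[OF e]
        tensor_lift_tens[OF k] tensor_lift_tens[OF e])+
qed

text \<open>The subgroup \<open>A \<otimes> B\<close>, for (free) direct summands \<open>A\<close> and \<open>B\<close>\<close>

definition tens_span :: "'a::ab_group_add set \<Rightarrow> 'b::ab_group_add set \<Rightarrow> ('a, 'b) tensor set" where
  "tens_span A B = zspan {a \<otimes>\<^sub>t b | a b. a \<in> A \<and> b \<in> B}"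

text \<open>\<open>L\<^sub>a\<^sub>,\<^sub>b V\<close> for \<open>V = U\<close> or \<open>V = U\<^sub>0\<close>, and \<open>K\<^sub>a\<^sub>,\<^sub>b U\<^sub>0\<close>, where \<open>U\<^sub>0\<close> is the kernel of \<open>x1s\<close>\<close>

definition L_mod :: "nat set \<Rightarrow> (nat \<Rightarrow> 'u::ab_group_add) \<Rightarrow> (nat \<Rightarrow> 'u \<Rightarrow> int) \<Rightarrow> 'u set \<Rightarrow>
    nat \<Rightarrow> nat \<Rightarrow> ('u ext, 'u sym) tensor set" where
  "L_mod I x xd V a b = {z \<in> tens_span (ext_pow V a) (sym_pow V b). kappa I x xd z = 0}"

definition K_mod0 :: "nat set \<Rightarrow> (nat \<Rightarrow> 'u::ab_group_add) \<Rightarrow> (nat \<Rightarrow> 'u \<Rightarrow> int) \<Rightarrow> 'u \<Rightarrow> 'u set \<Rightarrow>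
    nat \<Rightarrow> nat \<Rightarrow> ('u ext, 'u dpow) tensor set" where
  "K_mod0 I x xd x1 U0 a b =
     {z \<in> tens_span (ext_pow U0 a) (dpow_deg0 x1 b). eta I x xd z = 0}"


subsection \<open>The generic ring and the generic Macaulay inverse system\<close>

text \<open>The integer \<open>n\<close> is encoded as \<open>CARD('n)\<close>, so that \<open>Sym\<^bsub>2n-2\<^esub> U\<close>, and with it the ring \<open>\<RR>\<close>,
  are types.\<close>

typedef (overloaded) ('u::ab_group_add, 'n::finite) hsym =
    "sym_pow (UNIV :: 'u set) (2 * CARD('n) - 2)"
  morphisms sym_of_hsym Abs_hsym
  unfolding sym_pow_def using zmod.span_zero by blast

setup_lifting type_definition_hsym

instantiation hsym :: (ab_group_add, finite) ab_group_add
begin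
lift_definition zero_hsym :: "('a, 'b) hsym" is 0
  unfolding sym_pow_def by (rule zmod.span_zero)
lift_definition plus_hsym :: "('a, 'b) hsym \<Rightarrow> ('a, 'b) hsym \<Rightarrow> ('a, 'b) hsym" is "(+)"
  unfolding sym_pow_def by (rule zmod.span_add)
lift_definition minus_hsym :: "('a, 'b) hsym \<Rightarrow> ('a, 'b) hsym \<Rightarrow> ('a, 'b) hsym" is "(-)"
  unfolding sym_pow_def by (rule zmod.span_diff)
lift_definition uminus_hsym :: "('a, 'b) hsym \<Rightarrow> ('a, 'b) hsym" is uminus
  unfolding sym_pow_def by (rule zmod.span_neg)
instance
  by standard (transfer, simp add: algebra_simps)+
end

text \<open>The bigraded ring \<open>\<RR> = Sym (U \<oplus> Sym\<^bsub>2n-2\<^esub> U)\<close>\<close>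

type_synonym ('u, 'n) RR = "('u \<times> ('u, 'n) hsym) sym"

definition Phi :: "(('u::ab_group_add, 'n::finite) RR, 'u dpow) tensor" where
  "Phi = (THE \<phi>. \<phi> \<in> base_change (dpow_deg (2 * CARD('n) - 2)) \<and>
     (\<forall>\<mu> :: ('u, 'n) hsym. reval \<phi> (sym_of_hsym \<mu>) = sym_of (0, \<mu>)))"

definition p_map :: "'u::ab_group_add sym \<Rightarrow> (('u, 'n::finite) RR, 'u dpow) tensor" where
  "p_map \<mu> = rcontract \<mu> Phi"

text \<open>Let \<open>ms\<close> be a basis of \<open>Sym\<^bsub>n-1\<^esub> U\<close>. The coefficient of an element of \<open>\<RR> \<otimes> D\<^bsub>n-1\<^esub>(U\<^sup>*)\<close> at the
  \<open>i\<close>-th member of the dual basis is its value at \<open>ms ! i\<close>.\<close>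

definition delta :: "'u::ab_group_add sym list \<Rightarrow> ('u, 'n::finite) RR" where
  "delta ms = Determinant.det
     (mat (length ms) (length ms) (\<lambda>(i, j). reval (p_map (ms ! j)) (ms ! i)))"

text \<open>The adjoint \<open>q\<close> of \<open>p\<close>, extended by zero to the components \<open>D\<^sub>c(U\<^sup>*)\<close> with \<open>c \<noteq> n - 1\<close>\<close>

definition q_map :: "'u::ab_group_add sym list \<Rightarrow> 'u dpow \<Rightarrow>
    (('u, 'n::finite) RR, 'u sym) tensor" where
  "q_map ms = (THE q. Modules.additive q \<and>
     (\<forall>\<nu> \<in> dpow_deg (CARD('n) - 1).
        q \<nu> \<in> base_change (sym_pow UNIV (CARD('n) - 1)) \<and>
        rext p_map (q \<nu>) = delta ms \<otimes>\<^sub>t \<nu>) \<and>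
     (\<forall>c. c \<noteq> CARD('n) - 1 \<longrightarrow> (\<forall>\<nu> \<in> dpow_deg c. q \<nu> = 0)))"

definition Phi_tilde :: "'u::ab_group_add \<Rightarrow> 'u set \<Rightarrow> (('u, 'n::finite) RR, 'u dpow) tensor" where
  "Phi_tilde x1 U0 = (THE \<phi>. \<phi> \<in> base_change (dpow_deg (2 * CARD('n) - 1)) \<and>
     rcontract (sym_of x1) \<phi> = Phi \<and>
     (\<forall>\<mu> \<in> sym_pow U0 (2 * CARD('n) - 1). rcontract \<mu> \<phi> = 0))"


subsection \<open>The modules and maps of the theorem\<close>

text \<open>\<open>\<RR> \<otimes> (K \<oplus> L)\<close> is written as \<open>(\<RR> \<otimes> K) \<oplus> (\<RR> \<otimes> L)\<close>. Below, \<open>x 1, \<dots>, x d\<close> is a basis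
  of \<open>U\<close> with dual basis \<open>xd 1, \<dots>, xd d\<close>, where \<open>x 1\<close> and \<open>xd 1\<close> are the given \<open>x1\<close> and \<open>x1\<^sup>*\<close>,
  so that \<open>U\<^sub>0\<close> is the kernel of \<open>xd 1\<close>.\<close>

definition pscale :: "'r::comm_ring_1 \<Rightarrow>
    ('r, 'm::ab_group_add) tensor \<times> ('r, 'k::ab_group_add) tensor \<Rightarrow>
    ('r, 'm) tensor \<times> ('r, 'k) tensor" where
  "pscale r = (\<lambda>(a, b). (tscale r a, tscale r b))"

definition B_mod :: "nat \<Rightarrow> (nat \<Rightarrow> 'u::ab_group_add) \<Rightarrow> (nat \<Rightarrow> 'u \<Rightarrow> int) \<Rightarrow> nat \<Rightarrow>
    ((('u, 'n::finite) RR, ('u ext, 'u dpow) tensor) tensor \<times>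
     (('u, 'n) RR, ('u ext, 'u sym) tensor) tensor) set" where
  "B_mod d x xd r =
     base_change (K_mod0 {2..d} x xd (x 1) {u. xd 1 u = 0} (r - 1) (CARD('n) - 1)) \<times>
     base_change (L_mod {2..d} x xd {u. xd 1 u = 0} (r - 1) CARD('n))"

definition B_top :: "nat \<Rightarrow> (nat \<Rightarrow> 'u \<Rightarrow> int) \<Rightarrow>
    (('u::ab_group_add, 'n::finite) RR, 'u ext) tensor set" where
  "B_top d xd = base_change (ext_pow {u. xd 1 u = 0} (d - 1))"

definition v_map :: "(('u::ab_group_add, 'n::finite) RR, ('u ext, 'u sym) tensor) tensor \<Rightarrow>
    (('u, 'n) RR, ('u ext, 'u dpow) tensor) tensor" where
  "v_map = rext (tensor_lift (\<lambda>\<theta> \<mu>. tens_left \<theta> (rcontract \<mu> Phi)))"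

definition G_mod :: "nat \<Rightarrow> (nat \<Rightarrow> 'u::ab_group_add) \<Rightarrow> (nat \<Rightarrow> 'u \<Rightarrow> int) \<Rightarrow> nat \<Rightarrow>
    (('u, 'n::finite) RR, ('u ext, 'u sym) tensor) tensor set" where
  "G_mod d x xd r =
     {z \<in> base_change (L_mod {1..d} x xd UNIV (r - 1) CARD('n)). v_map z = 0}"

definition G_top :: "nat \<Rightarrow> (('u::ab_group_add, 'n::finite) RR, 'u ext) tensor set" where
  "G_top d = base_change (ext_pow UNIV d)"

definition tau_K :: "nat \<Rightarrow> (nat \<Rightarrow> 'u::ab_group_add) \<Rightarrow> (nat \<Rightarrow> 'u \<Rightarrow> int) \<Rightarrow> 'u sym list \<Rightarrow> nat \<Rightarrow>
    (('u, 'n::finite) RR, ('u ext, 'u dpow) tensor) tensor \<Rightarrow>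
    (('u, 'n) RR, ('u ext, 'u sym) tensor) tensor" where
  "tau_K d x xd ms r = rext (tensor_lift (\<lambda>\<theta> \<nu>.
     tscale (delta ms ^ (r - 1))
       (rmap (kappa {1..d} x xd) (tens_left (wedge_left (x 1) \<theta>) (q_map ms \<nu>)))))"

definition tau_L :: "nat \<Rightarrow> (nat \<Rightarrow> 'u::ab_group_add) \<Rightarrow> (nat \<Rightarrow> 'u \<Rightarrow> int) \<Rightarrow> 'u sym list \<Rightarrow> nat \<Rightarrow>
    (('u, 'n::finite) RR, ('u ext, 'u sym) tensor) tensor \<Rightarrow>
    (('u, 'n) RR, ('u ext, 'u sym) tensor) tensor" where
  "tau_L d x xd ms r = rext (tensor_lift (\<lambda>\<theta> \<mu>.
     tscale (delta ms ^ (r - 1))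
       (delta ms \<otimes>\<^sub>t (\<theta> \<otimes>\<^sub>t \<mu>)
        - rmap (kappa {1..d} x xd) (tens_left (wedge_left (x 1) \<theta>)
            (rext (q_map ms) (rcontract \<mu> (Phi_tilde (x 1) {u. xd 1 u = 0})))))))"

definition tau :: "nat \<Rightarrow> (nat \<Rightarrow> 'u::ab_group_add) \<Rightarrow> (nat \<Rightarrow> 'u \<Rightarrow> int) \<Rightarrow> 'u sym list \<Rightarrow> nat \<Rightarrow>
    (('u, 'n::finite) RR, ('u ext, 'u dpow) tensor) tensor \<times>
    (('u, 'n) RR, ('u ext, 'u sym) tensor) tensor \<Rightarrow>
    (('u, 'n) RR, ('u ext, 'u sym) tensor) tensor" where
  "tau d x xd ms r = (\<lambda>(y, z). tau_K d x xd ms r y + tau_L d x xd ms r z)"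

definition tau_top :: "nat \<Rightarrow> (nat \<Rightarrow> 'u::ab_group_add) \<Rightarrow> 'u sym list \<Rightarrow>
    (('u, 'n::finite) RR, 'u ext) tensor \<Rightarrow> (('u, 'n) RR, 'u ext) tensor" where
  "tau_top d x ms = rext (\<lambda>\<omega>. (delta ms ^ (d - 1)) \<otimes>\<^sub>t wedge_left (x 1) \<omega>)"


subsection \<open>Free submodules, isomorphisms and localization\<close>

definition free_submodule ::
    "('r::comm_ring_1 \<Rightarrow> 'g::ab_group_add \<Rightarrow> 'g) \<Rightarrow> 'g set \<Rightarrow> 'g set \<Rightarrow> bool" where
  "free_submodule sc N G \<longleftrightarrow> N \<subseteq> G \<and> Modules.module.subspace sc N \<and>
     (\<exists>E. \<not> Modules.module.dependent sc E \<and> Modules.module.span sc E = N)"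

definition module_iso_on ::
    "('r::comm_ring_1 \<Rightarrow> 'b::ab_group_add \<Rightarrow> 'b) \<Rightarrow> ('r \<Rightarrow> 'g::ab_group_add \<Rightarrow> 'g) \<Rightarrow>
     ('b \<Rightarrow> 'g) \<Rightarrow> 'b set \<Rightarrow> 'g set \<Rightarrow> bool" where
  "module_iso_on scB scG f B N \<longleftrightarrow> bij_betw f B N \<and>
     (\<forall>b\<in>B. \<forall>b'\<in>B. f (b + b') = f b + f b') \<and> (\<forall>r. \<forall>b\<in>B. f (scB r b) = scG r (f b))"

text \<open>The pair \<open>(m, i)\<close> represents the fraction \<open>m / \<delta>\<^sup>i\<close>. The localization of a submodule \<open>N\<close> of \<open>G\<close>
  is identified with the submodule of the localization of \<open>G\<close> formed by the fractions with
  numerator in \<open>N\<close>.\<close>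

definition frac_rel ::
    "('r::comm_ring_1 \<Rightarrow> 'g::ab_group_add \<Rightarrow> 'g) \<Rightarrow> 'r \<Rightarrow> 'g set \<Rightarrow> (('g \<times> nat) \<times> ('g \<times> nat)) set"
  where "frac_rel sc \<delta> G = {((m, i), (m', j)) | m i m' j. m \<in> G \<and> m' \<in> G \<and>
     (\<exists>k. sc (\<delta> ^ k) (sc (\<delta> ^ j) m - sc (\<delta> ^ i) m') = 0)}"

definition localization ::
    "('r::comm_ring_1 \<Rightarrow> 'g::ab_group_add \<Rightarrow> 'g) \<Rightarrow> 'r \<Rightarrow> 'g set \<Rightarrow> ('g \<times> nat) set set" where
  "localization sc \<delta> G = (G \<times> UNIV) // frac_rel sc \<delta> G"

definition localized_submodule ::
    "('r::comm_ring_1 \<Rightarrow> 'g::ab_group_add \<Rightarrow> 'g) \<Rightarrow> 'r \<Rightarrow> 'g set \<Rightarrow> 'g set \<Rightarrow> ('g \<times> nat) set set" where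
  "localized_submodule sc \<delta> N G = (\<lambda>f. frac_rel sc \<delta> G `` {f}) ` (N \<times> UNIV)"

definition free_iso_generically_onto ::
    "('r::comm_ring_1 \<Rightarrow> 'b::ab_group_add \<Rightarrow> 'b) \<Rightarrow> ('r \<Rightarrow> 'g::ab_group_add \<Rightarrow> 'g) \<Rightarrow> 'r \<Rightarrow>
     ('b \<Rightarrow> 'g) \<Rightarrow> 'b set \<Rightarrow> 'g set \<Rightarrow> bool" where
  "free_iso_generically_onto scB scG \<delta> \<tau> B G \<longleftrightarrow>
     free_submodule scG (\<tau> ` B) G \<and>
     module_iso_on scB scG \<tau> B (\<tau> ` B) \<and>
     localized_submodule scG \<delta> (\<tau> ` B) G = localization scG \<delta> G"

end

theory Submission
  imports Defs
begin

text \<open>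
  Write \<open>a = r - 1\<close>. The essential case is \<open>1 \<le> r \<le> d - 1\<close>, where the proof rests on an explicit
  description of \<open>G\<^sub>r\<close>. Sorting the terms of the equation \<open>\<kappa>(z) = 0\<close> by powers of \<open>x\<^sub>1\<close> in both factors shows
  that every element of \<open>\<RR> \<otimes> L\<^sub>a\<^sub>,\<^sub>n U\<close> can be written uniquely as
  \<open>z = b\<^sub>0 + \<kappa>(x\<^sub>1 \<and> b\<^sub>1)\<close> with \<open>b\<^sub>0\<close> in \<open>\<RR> \<otimes> L\<^sub>a\<^sub>,\<^sub>n U\<^sub>0\<close> and \<open>b\<^sub>1\<close> in \<open>\<RR> \<otimes> \<And>\<^sup>a U\<^sub>0 \<otimes> Sym\<^bsub>n-1\<^esub> U\<close>
  (lemmas \<open>L_decomposition\<close> and \<open>KS_W_injective\<close>). Since evaluation at \<open>\<Phi>\<close> carries \<open>\<kappa>\<close> to \<open>\<eta>\<close>, and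
  \<open>\<eta>(x\<^sub>1 \<and> y) = x\<^sub>1 y - x\<^sub>1 \<and> \<eta>(y)\<close>, for \<open>z\<close> in \<open>G\<^sub>r\<close> the element
  \<open>g = p(b\<^sub>1) + b\<^sub>0(\<Phi>')\<close> lies in \<open>\<RR> \<otimes> K\<^bsub>a,n-1\<^esub> U\<^sub>0\<close>, where \<open>\<Phi>'\<close> is the lift of \<open>\<Phi>\<close> with
  \<open>x\<^sub>1(\<Phi>') = \<Phi>\<close> (lemma \<open>V_kernel\<close>).

  Thus \<open>z \<mapsto> (g, b\<^sub>0)\<close> maps \<open>G\<^sub>r\<close> to \<open>B\<^sub>r\<close>. As \<open>p\<close> and \<open>q\<close> are inverse to each other up to the factor \<open>\<delta>\<close>, the
  map \<open>\<tau>\<^sub>r\<close> is, in these coordinates, multiplication by \<open>\<delta>\<^sup>r\<close>. This gives \<open>\<delta>\<^sup>r G\<^sub>r \<subseteq> \<tau>\<^sub>r(B\<^sub>r)\<close>, and it gives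
  injectivity of \<open>\<tau>\<^sub>r\<close> because \<open>\<delta>\<close> does not divide zero. For \<open>r = d\<close> the corresponding statement is that
  multiplication by \<open>x\<^sub>1\<close> is an isomorphism of \<open>\<And>\<^bsup>d-1\<^esup> U\<^sub>0\<close> with \<open>\<And>\<^sup>d U\<close>; it follows from
  \<open>\<And>U = \<And>U\<^sub>0 \<oplus> x\<^sub>1 \<and> \<And>U\<^sub>0\<close> and \<open>\<And>\<^sup>d U\<^sub>0 = 0\<close>.

  The ring theory behind this is elementary. The ring \<open>\<RR>\<close> is a polynomial ring over the integers, hence free
  as an abelian group, so that kernels commute with \<open>\<RR> \<otimes> _\<close>, and subgroups of free abelian groups of
  finite rank are free, so that \<open>B\<^sub>r\<close> is free. That \<open>\<RR>\<close> has no zero divisors is seen by Kronecker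
  substitution into univariate polynomials. Finally \<open>\<delta> \<noteq> 0\<close>, since \<open>\<Phi>\<close> can be specialised to a sum of
  evaluations at integral points that makes the form \<open>(\<mu>, \<mu>') \<mapsto> \<Phi>(\<mu> \<mu>')\<close> on \<open>Sym\<^bsub>n-1\<^esub> U\<close> positive definite
  (lemmas \<open>positive_definite_functional\<close> and \<open>dlt_nonzero\<close>).
\<close>

section \<open>Additive maps and finitely generated free abelian groups\<close>

abbreviation zhom :: "('a::ab_group_add \<Rightarrow> 'b::ab_group_add) \<Rightarrow> bool" where
  "zhom \<equiv> Modules.additive"

lemmas zhom_add = additive.add and zhom_zero = additive.zero and zhom_diff = additive.diff
  and zhom_minus = additive.minus and zhom_sum = additive.sum and zhom_zmul = additive_zmul

lemma zhomI: "(\<And>a b. f (a + b) = f a + f b) \<Longrightarrow> zhom f"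
  by (simp add: additive_def)

lemma zhom_comp: "zhom f \<Longrightarrow> zhom g \<Longrightarrow> zhom (\<lambda>a. f (g a))"
  by (simp add: additive_def)

lemma zhom_ident [simp]: "zhom (\<lambda>a. a)" "zhom id"
  by (simp_all add: additive_def)

lemma zhom_const_zero [simp]: "zhom (\<lambda>a. 0)"
  by (simp add: additive_def)

lemma zhom_plus: "zhom f \<Longrightarrow> zhom g \<Longrightarrow> zhom (\<lambda>a. f a + g a)"
  by (simp add: additive_def)

lemma zhom_minus2: "zhom f \<Longrightarrow> zhom g \<Longrightarrow> zhom (\<lambda>a. f a - g a)"
  by (simp add: additive_def)

lemma zhom_sum_fun: "(\<And>i. i \<in> I \<Longrightarrow> zhom (f i)) \<Longrightarrow> zhom (\<lambda>a. \<Sum>i\<in>I. f i a)"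
  by (simp add: additive_def sum.distrib)

lemma zmul_int [simp]: "zmul k (a::int) = k * a"
proof -
  have "zmul k a = (of_nat (nat k) - of_nat (nat (- k))) * a"
    by (simp add: zmul_def left_diff_distrib)
  then show ?thesis by simp
qed

lemma zmul_ring: "zmul k (a::'r::comm_ring_1) = of_int k * a"
proof -
  have "zmul k a = (of_nat (nat k) - of_nat (nat (- k))) * a"
    by (simp add: zmul_def left_diff_distrib)
  moreover have "(of_nat (nat k) - of_nat (nat (- k)) :: 'r) = of_int k"
    by (cases "k \<ge> 0") (simp_all)
  ultimately show ?thesis by simp
qed

lemma zhom_zmul_left: "zhom (\<lambda>k. zmul k a)"
  by (simp add: additive_def zmod.scale_left_distrib)

lemma zhom_zmul_right: "zhom (zmul k)"
  by (simp add: additive_def zmod.scale_right_distrib)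

lemma zhom_mult_left: "zhom ((*) (a::'r::comm_ring_1))"
  by (simp add: additive_def distrib_left)

text \<open>The induction principle for spans, in the form used throughout: \<open>f\<close> maps the span of \<open>S\<close> into a
  subgroup as soon as it maps \<open>S\<close> there.\<close>

lemma zspan_image_subset:
  assumes "zhom f" "x \<in> zspan S" "zmod.subspace N" "\<And>s. s \<in> S \<Longrightarrow> f s \<in> N"
  shows "f x \<in> N"
proof -
  have "f x \<in> zspan (f ` S)" by (rule zspan_additive_image[OF assms(1,2)])
  moreover have "zspan (f ` S) \<subseteq> N" using assms(3,4) by (intro zmod.span_minimal) auto
  ultimately show ?thesis by blast
qed

lemma subspace_ker: "zhom f \<Longrightarrow> zmod.subspace N \<Longrightarrow> zmod.subspace {a \<in> N. f a = 0}"
  unfolding zmod.subspace_def by (auto simp: zhom_zero zhom_add zhom_zmul)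

text \<open>The elements of \<open>N\<close> are separated from zero by finitely many integral functionals, as is
  the case in a finitely generated free abelian group.\<close>

definition finitely_separated :: "'a::ab_group_add set \<Rightarrow> bool" where
  "finitely_separated N \<longleftrightarrow>
     (\<exists>C :: ('a \<Rightarrow> int) set. finite C \<and> (\<forall>c\<in>C. zhom c) \<and> (\<forall>a\<in>N. (\<forall>c\<in>C. c a = 0) \<longrightarrow> a = 0))"

lemma finitely_separated_subset: "finitely_separated N \<Longrightarrow> M \<subseteq> N \<Longrightarrow> finitely_separated M"
  unfolding finitely_separated_def by (meson subsetD)

text \<open>Division with remainder by a value of least absolute value splits off one functional at a
  time, so that a subgroup of a free abelian group of finite rank is free of finite rank.\<close>

lemma finitely_separated_basis:
  fixes N :: "'a::ab_group_add set"
  assumes "finitely_separated N" "zmod.subspace N"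
  obtains E where "finite E" "\<not> zmod.dependent E" "zspan E = N"
proof -
  obtain C :: "('a \<Rightarrow> int) set" where C: "finite C" "\<forall>c\<in>C. zhom c"
    "\<forall>a\<in>N. (\<forall>c\<in>C. c a = 0) \<longrightarrow> a = 0"
    using assms(1) unfolding finitely_separated_def by blast
  have "\<exists>E. finite E \<and> \<not> zmod.dependent E \<and> zspan E = N"
    using C assms(2)
  proof (induction arbitrary: N rule: finite_induct)
    case empty
    then have "N = {0}" using zmod.subspace_0 by auto
    then show ?case
      by (intro exI[of _ "{}"]) (auto simp: zmod.independent_empty)
  next
    case (insert c C)
    note c = \<open>\<forall>c\<in>insert c C. zhom c\<close>[THEN bspec, OF insertI1]
    note N = \<open>zmod.subspace N\<close>
    let ?N = "{a \<in> N. c a = 0}"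
    have "zmod.subspace ?N" by (rule subspace_ker[OF c N])
    moreover have "\<forall>c\<in>C. zhom c" using insert.prems(1) by blast
    moreover have "\<forall>a\<in>?N. (\<forall>c\<in>C. c a = 0) \<longrightarrow> a = 0" using insert.prems(2) by blast
    ultimately obtain E where E: "finite E" "\<not> zmod.dependent E" "zspan E = ?N"
      using insert.IH[of ?N] by blast
    show ?case
    proof (cases "\<forall>a\<in>N. c a = 0")
      case True
      then have "?N = N" by blast
      with E show ?thesis by auto
    next
      case False
      define m where "m = arg_min (\<lambda>a. nat \<bar>c a\<bar>) (\<lambda>a. a \<in> N \<and> c a \<noteq> 0)"
      have m: "m \<in> N" "c m \<noteq> 0"
        and least: "\<And>a. a \<in> N \<Longrightarrow> c a \<noteq> 0 \<Longrightarrow> nat \<bar>c m\<bar> \<le> nat \<bar>c a\<bar>"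
        using arg_min_nat_lemma[of "\<lambda>a. a \<in> N \<and> c a \<noteq> 0" _ "\<lambda>a. nat \<bar>c a\<bar>"] False
        unfolding m_def by blast+
      have rem: "a - zmul (c a div c m) m \<in> ?N" if "a \<in> N" for a
      proof -
        let ?b = "a - zmul (c a div c m) m"
        have b: "?b \<in> N" using that m N zmod.subspace_diff zmod.subspace_scale by blast
        have "c ?b = c a mod c m"
          by (simp add: zhom_diff[OF c] zhom_zmul[OF c] minus_div_mult_eq_mod)
        moreover have "\<bar>c a mod c m\<bar> < \<bar>c m\<bar>" using m(2) by (rule abs_mod_less)
        ultimately have "c ?b = 0" using least[OF b] by (cases "c ?b = 0") auto
        with b show ?thesis by simp
      qed
      have mE: "m \<notin> E" using E(3) m(2) zmod.span_base by blast
      have cE: "c v = 0" if "v \<in> E" for v using E(3) that zmod.span_base by blast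
      have "\<not> zmod.dependent (insert m E)"
      proof
        assume "zmod.dependent (insert m E)"
        then obtain u v where u: "v \<in> insert m E" "u v \<noteq> 0"
          "(\<Sum>v\<in>insert m E. zmul (u v) v) = 0"
          using zmod.dependent_finite E(1) by (metis finite.insertI)
        have s: "zmul (u m) m + (\<Sum>v\<in>E. zmul (u v) v) = 0" using u(3) E(1) mE by simp
        have "c (zmul (u m) m + (\<Sum>v\<in>E. zmul (u v) v)) = u m * c m"
          by (simp add: zhom_add[OF c] zhom_sum[OF c] zhom_zmul[OF c] cE)
        then have um: "u m = 0" using s m(2) by (simp add: zhom_zero[OF c])
        then have "(\<Sum>v\<in>E. zmul (u v) v) = 0" using s by simp
        then have "\<forall>v\<in>E. u v = 0" using E(1,2) zmod.dependent_finite by blast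
        with um u show False by auto
      qed
      moreover have "zspan (insert m E) = N"
      proof
        have "insert m E \<subseteq> N" using m(1) E(3) zmod.span_base by blast
        then show "zspan (insert m E) \<subseteq> N" using N by (rule zmod.span_minimal)
        show "N \<subseteq> zspan (insert m E)"
        proof
          fix a assume "a \<in> N"
          then have "a - zmul (c a div c m) m \<in> zspan (insert m E)"
            using rem E(3) zmod.span_mono[of E "insert m E"] by blast
          from zmod.span_add[OF this zmod.span_scale[OF zmod.span_base[OF insertI1]]]
          have "a - zmul (c a div c m) m + zmul (c a div c m) m \<in> zspan (insert m E)" .
          then show "a \<in> zspan (insert m E)" by simp
        qed
      qed
      moreover have "finite (insert m E)" using E(1) by simp
      ultimately show ?thesis by blast
    qed
  qed
  then show thesis using that by blast
qed

lemma zspan_finite_sum: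
  assumes "finite E" "x \<in> zspan E"
  obtains a where "x = (\<Sum>v\<in>E. zmul (a v) v)"
  using assms zmod.span_finite[OF assms(1)] by auto

lemma independent_sum_zero:
  assumes "finite E" "\<not> zmod.dependent E" "(\<Sum>v\<in>E. zmul (a v) v) = 0" "v \<in> E"
  shows "a v = 0"
  using assms zmod.dependent_finite by blast

section \<open>Tensor products\<close>

subsection \<open>Additive maps out of tensor products\<close>

lemma tens_zhom: "zhom (\<lambda>a. a \<otimes>\<^sub>t b)" "zhom ((\<otimes>\<^sub>t) a)"
  using biadditive_tens unfolding biadditive_def by blast+

lemmas tens_simps =
  tens_add_left tens_add_right
  zhom_zero[OF tens_zhom(1)] zhom_zero[OF tens_zhom(2)]
  zhom_diff[OF tens_zhom(1)] zhom_diff[OF tens_zhom(2)]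
  zhom_minus[OF tens_zhom(1)] zhom_minus[OF tens_zhom(2)]

lemma tens_zmul: "zmul k a \<otimes>\<^sub>t b = zmul k (a \<otimes>\<^sub>t b)" "a \<otimes>\<^sub>t zmul k b = zmul k (a \<otimes>\<^sub>t b)"
  by (rule zhom_zmul[OF tens_zhom(1)] zhom_zmul[OF tens_zhom(2)])+

lemma tens_sum: "(\<Sum>i\<in>I. f i) \<otimes>\<^sub>t b = (\<Sum>i\<in>I. f i \<otimes>\<^sub>t b)" "a \<otimes>\<^sub>t (\<Sum>i\<in>I. g i) = (\<Sum>i\<in>I. a \<otimes>\<^sub>t g i)"
  by (rule zhom_sum[OF tens_zhom(1)] zhom_sum[OF tens_zhom(2)])+

lemma tensor_zhom_eqI:
  assumes "zhom f" "zhom g" "\<And>a b. f (a \<otimes>\<^sub>t b) = g (a \<otimes>\<^sub>t b)"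
  shows "f z = g z"
  by (rule additive_eq_on_zspan[OF assms(1,2) _ tensor_in_zspan]) (use assms(3) in auto)

lemma tensor_zhom_eqI3:
  assumes "zhom f" "zhom g" "\<And>a b c. f (a \<otimes>\<^sub>t (b \<otimes>\<^sub>t c)) = g (a \<otimes>\<^sub>t (b \<otimes>\<^sub>t c))"
  shows "f z = g z"
proof (rule tensor_zhom_eqI[OF assms(1,2)])
  fix a b
  show "f (a \<otimes>\<^sub>t b) = g (a \<otimes>\<^sub>t b)"
    by (rule tensor_zhom_eqI[of "\<lambda>b. f (a \<otimes>\<^sub>t b)" "\<lambda>b. g (a \<otimes>\<^sub>t b)"])
       (simp_all add: zhom_comp[OF _ tens_zhom(2)] assms)
qed

lemma base_change_subspace: "zmod.subspace (base_change N)"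
  unfolding base_change_def by (rule zmod.subspace_span)

lemma tens_span_subspace: "zmod.subspace (tens_span A B)"
  unfolding tens_span_def by (rule zmod.subspace_span)

lemma tens_in_tens_span: "a \<in> A \<Longrightarrow> b \<in> B \<Longrightarrow> a \<otimes>\<^sub>t b \<in> tens_span A B"
  unfolding tens_span_def by (rule zmod.span_base) blast

lemma tens_in_base_change: "b \<in> N \<Longrightarrow> r \<otimes>\<^sub>t b \<in> base_change N"
  unfolding base_change_def by (rule zmod.span_base) blast

text \<open>An additive map carrying the generators of \<open>R \<otimes> A \<otimes> B\<close> into a subgroup carries all of it
  there; the same for equality of two additive maps.\<close>

lemma base_change_induct:
  assumes "z \<in> base_change N" "zhom f" "zmod.subspace S" "\<And>r b. b \<in> N \<Longrightarrow> f (r \<otimes>\<^sub>t b) \<in> S"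
  shows "f z \<in> S"
  by (rule zspan_image_subset[OF assms(2) assms(1)[unfolded base_change_def] assms(3)])
     (use assms(4) in auto)

lemma base_change_tens_span_induct:
  assumes "z \<in> base_change (tens_span A B)" "zhom f" "zmod.subspace S"
    "\<And>r a b. a \<in> A \<Longrightarrow> b \<in> B \<Longrightarrow> f (r \<otimes>\<^sub>t (a \<otimes>\<^sub>t b)) \<in> S"
  shows "f z \<in> S"
proof (rule base_change_induct[OF assms(1-3)])
  fix r b assume "b \<in> tens_span A B"
  then show "f (r \<otimes>\<^sub>t b) \<in> S"
    unfolding tens_span_def
    by (rule zspan_image_subset[OF zhom_comp[OF assms(2) tens_zhom(2)] _ assms(3)])
       (use assms(4) in auto)
qed

lemma subspace_zero: "zmod.subspace {0}"
  by (simp add: zmod.subspace_def)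

lemma base_change_eqI:
  assumes "z \<in> base_change N" "zhom f" "zhom g"
    "\<And>r b. b \<in> N \<Longrightarrow> f (r \<otimes>\<^sub>t b) = g (r \<otimes>\<^sub>t b)"
  shows "f z = g z"
  using base_change_induct[OF assms(1) zhom_minus2[OF assms(2,3)] subspace_zero] assms(4) by simp

lemma base_change_tens_span_eqI:
  assumes "z \<in> base_change (tens_span A B)" "zhom f" "zhom g"
    "\<And>r a b. a \<in> A \<Longrightarrow> b \<in> B \<Longrightarrow> f (r \<otimes>\<^sub>t (a \<otimes>\<^sub>t b)) = g (r \<otimes>\<^sub>t (a \<otimes>\<^sub>t b))"
  shows "f z = g z"
  using base_change_tens_span_induct[OF assms(1) zhom_minus2[OF assms(2,3)] subspace_zero] assms(4)
  by simp

subsection \<open>Scalar extension of additive maps\<close>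

interpretation tsc: Modules.module "tscale :: 'r::comm_ring_1 \<Rightarrow> ('r, 'm::ab_group_add) tensor \<Rightarrow> _"
  by (rule module_tscale)

lemma zhom_tscale: "zhom (tscale r)"
  by (simp add: additive_def tsc.scale_right_distrib)

lemmas zhom_rmap = additive_rmap(1) and rmap_tens = additive_rmap(2)
  and zhom_rext = additive_rext(1) and rext_tens = additive_rext(2)

lemma rmap_tscale: "zhom f \<Longrightarrow> rmap f (tscale r z) = tscale r (rmap f z)"
  by (rule tensor_zhom_eqI[of "\<lambda>z. rmap f (tscale r z)" "\<lambda>z. tscale r (rmap f z)"])
     (simp_all add: zhom_comp[OF zhom_rmap zhom_tscale] zhom_comp[OF zhom_tscale zhom_rmap]
        rmap_tens tscale_tens)

lemma rext_tscale: "zhom F \<Longrightarrow> rext F (tscale r z) = tscale r (rext F z)"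
  by (rule tensor_zhom_eqI[of "\<lambda>z. rext F (tscale r z)" "\<lambda>z. tscale r (rext F z)"])
     (simp_all add: zhom_comp[OF zhom_rext zhom_tscale] zhom_comp[OF zhom_tscale zhom_rext]
        rext_tens tscale_tens)

lemma tens_left_tens: "tens_left \<theta> (r \<otimes>\<^sub>t m) = r \<otimes>\<^sub>t (\<theta> \<otimes>\<^sub>t m)"
  by (simp add: tens_left_def rmap_tens tens_zhom)

lemma zhom_tens_left: "zhom (tens_left \<theta>)"
  unfolding tens_left_def by (intro zhom_rmap tens_zhom)

lemma tens_left_tscale: "tens_left \<theta> (tscale r y) = tscale r (tens_left \<theta> y)"
  unfolding tens_left_def by (intro rmap_tscale tens_zhom)

lemma zhom_tens_left_left: "zhom (\<lambda>\<theta>. tens_left \<theta> y)"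
proof (rule zhomI)
  fix a b
  show "tens_left (a + b) y = tens_left a y + tens_left b y"
    by (rule tensor_zhom_eqI[OF zhom_tens_left zhom_plus[OF zhom_tens_left zhom_tens_left]])
       (simp add: tens_left_tens tens_simps)
qed

text \<open>\<open>tmap f g = f \<otimes> g\<close>, and \<open>lmap f g = 1 \<otimes> f \<otimes> g\<close> on \<open>R \<otimes> (A \<otimes> B)\<close>.\<close>

definition tmap :: "('a::ab_group_add \<Rightarrow> 'a'::ab_group_add) \<Rightarrow> ('b::ab_group_add \<Rightarrow> 'b'::ab_group_add)
    \<Rightarrow> ('a, 'b) tensor \<Rightarrow> ('a', 'b') tensor" where
  "tmap f g = tensor_lift (\<lambda>a b. f a \<otimes>\<^sub>t g b)"

definition lmap :: "('a::ab_group_add \<Rightarrow> 'a'::ab_group_add) \<Rightarrow> ('b::ab_group_add \<Rightarrow> 'b'::ab_group_add)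
    \<Rightarrow> ('r::comm_ring_1, ('a, 'b) tensor) tensor \<Rightarrow> ('r, ('a', 'b') tensor) tensor" where
  "lmap f g = rmap (tmap f g)"

lemma
  assumes "zhom f" "zhom g"
  shows zhom_tmap: "zhom (tmap f g)"
    and tmap_tens: "tmap f g (a \<otimes>\<^sub>t b) = f a \<otimes>\<^sub>t g b"
proof -
  have "biadditive (\<lambda>a b. f a \<otimes>\<^sub>t g b)"
    unfolding biadditive_def
    by (intro conjI allI zhom_comp[OF tens_zhom(1) assms(1)] zhom_comp[OF tens_zhom(2) assms(2)])
  from additive_tensor_lift[OF this] tensor_lift_tens[OF this]
  show "zhom (tmap f g)" "tmap f g (a \<otimes>\<^sub>t b) = f a \<otimes>\<^sub>t g b"
    by (simp_all add: tmap_def)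
qed

lemma
  assumes "zhom f" "zhom g"
  shows zhom_lmap: "zhom (lmap f g)"
    and lmap_tens: "lmap f g (r \<otimes>\<^sub>t (a \<otimes>\<^sub>t b)) = r \<otimes>\<^sub>t (f a \<otimes>\<^sub>t g b)"
    and lmap_tscale: "lmap f g (tscale r z) = tscale r (lmap f g z)"
    and lmap_tens_left: "lmap f g (tens_left a y) = tens_left (f a) (rmap g y)"
proof -
  note t = zhom_tmap[OF assms] tmap_tens[OF assms]
  show z: "zhom (lmap f g)" unfolding lmap_def by (intro zhom_rmap t)
  show e: "lmap f g (r \<otimes>\<^sub>t (a \<otimes>\<^sub>t b)) = r \<otimes>\<^sub>t (f a \<otimes>\<^sub>t g b)" for r a b
    by (simp add: lmap_def rmap_tens t)
  show "lmap f g (tscale r z) = tscale r (lmap f g z)"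
    unfolding lmap_def by (intro rmap_tscale t)
  show "lmap f g (tens_left a y) = tens_left (f a) (rmap g y)"
    by (rule tensor_zhom_eqI[OF zhom_comp[OF z zhom_tens_left]
          zhom_comp[OF zhom_tens_left zhom_rmap[OF assms(2)]]])
       (simp add: tens_left_tens e rmap_tens assms)
qed

lemma lmap_lmap:
  assumes "zhom f" "zhom g" "zhom f'" "zhom g'"
  shows "lmap f g (lmap f' g' z) = lmap (\<lambda>a. f (f' a)) (\<lambda>b. g (g' b)) z"
  by (rule tensor_zhom_eqI3[OF zhom_comp[OF zhom_lmap zhom_lmap] zhom_lmap])
     (simp_all add: assms zhom_comp lmap_tens)

lemma lmap_ident: "lmap (\<lambda>a. a) (\<lambda>a. a) z = z"
  by (rule tensor_zhom_eqI3[OF zhom_lmap]) (simp_all add: lmap_tens)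

lemma
  assumes "zhom f" "zhom g"
  shows lmap_plus_left: "zhom f' \<Longrightarrow> lmap (\<lambda>a. f a + f' a) g z = lmap f g z + lmap f' g z"
    and lmap_minus_left: "zhom f' \<Longrightarrow> lmap (\<lambda>a. f a - f' a) g z = lmap f g z - lmap f' g z"
    and lmap_plus_right: "zhom g' \<Longrightarrow> lmap f (\<lambda>a. g a + g' a) z = lmap f g z + lmap f g' z"
  by (rule tensor_zhom_eqI3; use assms in \<open>simp add: zhom_plus zhom_minus2 zhom_lmap lmap_tens tens_simps\<close>)+

lemma lmap_zero_left: "zhom g \<Longrightarrow> lmap (\<lambda>a. 0) g z = 0"
  and lmap_zero_right: "zhom f \<Longrightarrow> lmap f (\<lambda>b. 0) z = 0"
  by (rule tensor_zhom_eqI3; simp add: zhom_lmap lmap_tens tens_simps)+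

lemma lmap_in_base_change:
  assumes "zhom f" "zhom g" "z \<in> base_change (tens_span A B)"
    "\<And>a. a \<in> A \<Longrightarrow> f a \<in> A'" "\<And>b. b \<in> B \<Longrightarrow> g b \<in> B'"
  shows "lmap f g z \<in> base_change (tens_span A' B')"
  by (rule base_change_tens_span_induct[OF assms(3) zhom_lmap[OF assms(1,2)] base_change_subspace])
     (simp add: lmap_tens assms tens_in_base_change tens_in_tens_span)

text \<open>The \<open>R\<close>-linear map \<open>\<theta> \<otimes> \<mu> \<mapsto> \<theta> \<otimes> F \<mu>\<close> from \<open>R \<otimes> (E \<otimes> M)\<close> to \<open>R \<otimes> (E \<otimes> N)\<close>, for
  \<open>F : M \<rightarrow> R \<otimes> N\<close>.\<close>

definition opm :: "('m::ab_group_add \<Rightarrow> ('r::comm_ring_1, 'n::ab_group_add) tensor) \<Rightarrow>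
    ('r, ('e::ab_group_add, 'm) tensor) tensor \<Rightarrow> ('r, ('e, 'n) tensor) tensor" where
  "opm F = rext (tensor_lift (\<lambda>\<theta> \<mu>. tens_left \<theta> (F \<mu>)))"

lemma
  assumes "zhom F"
  shows zhom_opm: "zhom (opm F)"
    and opm_tens: "opm F (r \<otimes>\<^sub>t (\<theta> \<otimes>\<^sub>t \<mu>)) = tscale r (tens_left \<theta> (F \<mu>))"
    and opm_tscale: "opm F (tscale r z) = tscale r (opm F z)"
    and opm_tens_left: "opm F (tens_left \<theta> y) = tens_left \<theta> (rext F y)"
proof -
  have b: "biadditive (\<lambda>\<theta> \<mu>. tens_left \<theta> (F \<mu>))"
    unfolding biadditive_def
    by (intro conjI allI zhom_tens_left_left zhom_comp[OF zhom_tens_left assms])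
  note t = additive_tensor_lift[OF b] tensor_lift_tens[OF b]
  show z: "zhom (opm F)" unfolding opm_def by (intro zhom_rext t)
  show e: "opm F (r \<otimes>\<^sub>t (\<theta> \<otimes>\<^sub>t \<mu>)) = tscale r (tens_left \<theta> (F \<mu>))" for r \<theta> \<mu>
    by (simp add: opm_def rext_tens t)
  show "opm F (tscale r z) = tscale r (opm F z)" unfolding opm_def by (intro rext_tscale t)
  show "opm F (tens_left \<theta> y) = tens_left \<theta> (rext F y)"
    by (rule tensor_zhom_eqI[OF zhom_comp[OF z zhom_tens_left]
          zhom_comp[OF zhom_tens_left zhom_rext[OF assms]]])
       (simp add: tens_left_tens e rext_tens assms tens_left_tscale)
qed

lemma lmap_opm:
  assumes "zhom F" "zhom g"
  shows "lmap (\<lambda>a. a) g (opm F z) = opm (\<lambda>\<mu>. rmap g (F \<mu>)) z"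
  by (rule tensor_zhom_eqI3[OF zhom_comp[OF zhom_lmap zhom_opm] zhom_opm])
     (simp_all add: assms zhom_comp[OF zhom_rmap] opm_tens lmap_tscale lmap_tens_left)

lemma opm_opm:
  assumes "zhom F" "zhom G"
  shows "opm F (opm G z) = opm (\<lambda>\<mu>. rext F (G \<mu>)) z"
  by (rule tensor_zhom_eqI3[OF zhom_comp[OF zhom_opm zhom_opm] zhom_opm])
     (simp_all add: assms zhom_comp[OF zhom_rext] opm_tens opm_tscale opm_tens_left)

lemma opm_scalar:
  assumes "z \<in> base_change (tens_span A B)" "zhom F" "\<And>\<mu>. \<mu> \<in> B \<Longrightarrow> F \<mu> = r \<otimes>\<^sub>t \<mu>"
  shows "opm F z = tscale r z"
  by (rule base_change_tens_span_eqI[OF assms(1) zhom_opm[OF assms(2)] zhom_tscale])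
     (simp add: opm_tens assms tens_left_tens tscale_tens mult.commute)

lemma opm_in_base_change:
  assumes "zhom F" "z \<in> base_change (tens_span A B)" "\<And>b. b \<in> B \<Longrightarrow> F b \<in> base_change B'"
  shows "opm F z \<in> base_change (tens_span A B')"
proof (rule base_change_tens_span_induct[OF assms(2) zhom_opm[OF assms(1)] base_change_subspace])
  fix r a b assume ab: "a \<in> A" "b \<in> B"
  have "tscale r (tens_left a (F b)) \<in> base_change (tens_span A B')"
    by (rule base_change_induct[OF assms(3)[OF ab(2)] zhom_comp[OF zhom_tscale zhom_tens_left]
          base_change_subspace])
       (simp add: tens_left_tens tscale_tens tens_in_base_change tens_in_tens_span ab)
  then show "opm F (r \<otimes>\<^sub>t (a \<otimes>\<^sub>t b)) \<in> base_change (tens_span A B')"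
    by (simp add: opm_tens assms)
qed

lemma base_change_tscale:
  assumes "z \<in> base_change N"
  shows "tscale r z \<in> base_change N"
  by (rule base_change_induct[OF assms zhom_tscale base_change_subspace])
     (simp add: tscale_tens tens_in_base_change)

lemma rmap_in_base_change:
  assumes "zhom f" "z \<in> base_change N" "\<And>b. b \<in> N \<Longrightarrow> f b \<in> N'"
  shows "rmap f z \<in> base_change N'"
  by (rule base_change_induct[OF assms(2) zhom_rmap[OF assms(1)] base_change_subspace])
     (simp add: rmap_tens assms tens_in_base_change)

subsection \<open>Coefficient rings that are free abelian groups\<close>

text \<open>\<open>Bs\<close> is a basis of \<open>R\<close> over the integers. This makes \<open>R \<otimes> M\<close> a direct sum of copies of \<open>M\<close>,
  from which flatness of \<open>R\<close> can be read off.\<close>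

locale zfree_ring =
  fixes Bs :: "'r::comm_ring_1 set"
  assumes indep: "\<not> zmod.dependent Bs" and span: "zspan Bs = UNIV"
begin

text \<open>The coefficient of \<open>b\<close> in \<open>r\<close>; it is zero if \<open>b\<close> is not in the basis.\<close>

definition rcoord :: "'r \<Rightarrow> 'r \<Rightarrow> int" where
  "rcoord b r = zmod.representation Bs r b"

lemma zhom_rcoord: "zhom (rcoord b)"
  by (rule zhomI) (simp add: rcoord_def zmod.representation_add indep span)

lemma finite_rcoord: "finite {b. rcoord b r \<noteq> 0}"
  unfolding rcoord_def by (rule zmod.finite_representation)

lemma rcoord_expansion: "(\<Sum>b | rcoord b r \<noteq> 0. zmul (rcoord b r) b) = r"
  unfolding rcoord_def by (rule zmod.sum_nonzero_representation_eq) (simp_all add: indep span)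

lemma rcoord_eq_0: "(\<And>b. rcoord b r = 0) \<Longrightarrow> r = 0"
  using rcoord_expansion[of r] by simp

text \<open>The coefficient of \<open>b\<close> in \<open>R \<otimes> M = \<Oplus>\<^sub>b b \<otimes> M\<close>\<close>

definition tcoord :: "'r \<Rightarrow> ('r, 'm::ab_group_add) tensor \<Rightarrow> 'm" where
  "tcoord b = tensor_lift (\<lambda>r m. zmul (rcoord b r) m)"

lemma biadditive_tcoord: "biadditive (\<lambda>r m. zmul (rcoord b r) m)"
  unfolding biadditive_def
  by (intro conjI allI zhom_comp[OF zhom_zmul_left zhom_rcoord] zhom_zmul_right)

lemmas zhom_tcoord = additive_tensor_lift[OF biadditive_tcoord, folded tcoord_def]
  and tcoord_tens = tensor_lift_tens[OF biadditive_tcoord, folded tcoord_def]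

lemma tcoord_expansion:
  obtains F where "finite F" "z = (\<Sum>b\<in>F. b \<otimes>\<^sub>t tcoord b z)"
proof -
  have "\<exists>F. finite F \<and> (\<forall>b. b \<notin> F \<longrightarrow> tcoord b z = 0) \<and> z = (\<Sum>b\<in>F. b \<otimes>\<^sub>t tcoord b z)"
    using tensor_in_zspan[of z]
  proof (induction rule: zmod.span_induct_alt)
    case base
    show ?case by (intro exI[of _ "{}"]) (simp add: zhom_zero[OF zhom_tcoord])
  next
    case (step c x y)
    obtain r m where x: "x = r \<otimes>\<^sub>t m" using step(1) by blast
    obtain F where F: "finite F" "\<forall>b. b \<notin> F \<longrightarrow> tcoord b y = 0" "y = (\<Sum>b\<in>F. b \<otimes>\<^sub>t tcoord b y)"
      using step(2) by blast
    let ?G = "F \<union> {b. rcoord b r \<noteq> 0}"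
    have G: "finite ?G" using F(1) finite_rcoord by blast
    have "y = (\<Sum>b\<in>?G. b \<otimes>\<^sub>t tcoord b y)"
      by (subst F(3), rule sum.mono_neutral_left[OF G]) (use F(2) in \<open>auto simp: tens_simps\<close>)
    moreover have "x = (\<Sum>b\<in>?G. b \<otimes>\<^sub>t tcoord b x)"
    proof -
      have "x = (\<Sum>b | rcoord b r \<noteq> 0. b \<otimes>\<^sub>t tcoord b x)"
        unfolding x tcoord_tens
        by (subst rcoord_expansion[of r, symmetric]) (simp add: tens_sum tens_zmul)
      also have "\<dots> = (\<Sum>b\<in>?G. b \<otimes>\<^sub>t tcoord b x)"
        by (rule sum.mono_neutral_left[OF G]) (auto simp: x tcoord_tens tens_simps)
      finally show ?thesis .
    qed
    ultimately have "zmul c x + y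
        = zmul c (\<Sum>b\<in>?G. b \<otimes>\<^sub>t tcoord b x) + (\<Sum>b\<in>?G. b \<otimes>\<^sub>t tcoord b y)" by simp
    also have "\<dots> = (\<Sum>b\<in>?G. b \<otimes>\<^sub>t tcoord b (zmul c x + y))"
      by (simp add: zmod.scale_sum_right sum.distrib[symmetric] zhom_add[OF zhom_tcoord]
          zhom_zmul[OF zhom_tcoord] tens_simps tens_zmul)
    finally have "zmul c x + y = (\<Sum>b\<in>?G. b \<otimes>\<^sub>t tcoord b (zmul c x + y))" .
    moreover have "tcoord b (zmul c x + y) = 0" if "b \<notin> ?G" for b
      using that F(2) by (simp add: zhom_add[OF zhom_tcoord] zhom_zmul[OF zhom_tcoord] x tcoord_tens)
    ultimately show ?case using G by (intro exI[of _ ?G]) blast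
  qed
  then show thesis using that by blast
qed

lemma tcoord_eq_0: "(\<And>b. tcoord b z = 0) \<Longrightarrow> z = 0"
  using tcoord_expansion[of z] by (metis (no_types, lifting) sum.neutral zhom_zero[OF tens_zhom(2)])

lemma tcoord_rmap:
  assumes "zhom f"
  shows "tcoord b (rmap f z) = f (tcoord b z)"
  by (rule tensor_zhom_eqI[OF zhom_comp[OF zhom_tcoord zhom_rmap] zhom_comp[OF _ zhom_tcoord]])
     (simp_all add: assms rmap_tens tcoord_tens zhom_zmul)

lemma base_change_iff_tcoord:
  assumes "zmod.subspace N"
  shows "z \<in> base_change N \<longleftrightarrow> (\<forall>b. tcoord b z \<in> N)"
proof
  assume z: "z \<in> base_change N"
  show "\<forall>b. tcoord b z \<in> N"
    using base_change_induct[OF z zhom_tcoord assms] zmod.subspace_scale[OF assms]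
    by (simp add: tcoord_tens)
next
  assume N: "\<forall>b. tcoord b z \<in> N"
  obtain F where "finite F" "z = (\<Sum>b\<in>F. b \<otimes>\<^sub>t tcoord b z)" by (rule tcoord_expansion)
  moreover have "(\<Sum>b\<in>F. b \<otimes>\<^sub>t tcoord b z) \<in> base_change N"
    by (rule zmod.subspace_sum[OF base_change_subspace]) (simp add: N tens_in_base_change)
  ultimately show "z \<in> base_change N" by simp
qed

text \<open>Flatness of \<open>R\<close>: kernels commute with base change.\<close>

lemma base_change_ker:
  assumes "zmod.subspace N" "zhom f"
  shows "base_change {a \<in> N. f a = 0} = {z \<in> base_change N. rmap f z = (0 :: ('r, _) tensor)}"
proof -
  have "rmap f z = 0 \<longleftrightarrow> (\<forall>b. f (tcoord b z) = 0)" for z :: "('r, _) tensor"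
    using tcoord_eq_0[of "rmap f z"] zhom_zero[OF zhom_tcoord] tcoord_rmap[OF assms(2)] by metis
  then show ?thesis
    using base_change_iff_tcoord[OF assms(1)] base_change_iff_tcoord[OF subspace_ker[OF assms(2,1)]]
    by auto
qed

text \<open>A finite basis of a subgroup \<open>N\<close> is an \<open>R\<close>-basis of \<open>R \<otimes> N\<close>.\<close>

lemma base_change_basis:
  fixes E :: "'m::ab_group_add set"
  assumes E: "finite E" "\<not> zmod.dependent E" "zspan E = N"
  shows "z \<in> base_change N \<Longrightarrow> \<exists>a. z = (\<Sum>e\<in>E. (a e :: 'r) \<otimes>\<^sub>t e)"
    and "(\<Sum>e\<in>E. (a e :: 'r) \<otimes>\<^sub>t e) = 0 \<Longrightarrow> e \<in> E \<Longrightarrow> a e = 0"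
proof -
  let ?S = "{z. \<exists>a. z = (\<Sum>e\<in>E. (a e :: 'r) \<otimes>\<^sub>t e)}"
  have S: "zmod.subspace ?S"
    unfolding zmod.subspace_def
  proof (safe, goal_cases)
    case 1 show ?case by (rule exI[of _ "\<lambda>_. 0"]) (simp add: tens_simps)
  next
    case (2 _ _ a b) show ?case
      by (rule exI[of _ "\<lambda>e. a e + b e"]) (simp add: tens_simps sum.distrib)
  next
    case (3 c _ a) show ?case
      by (rule exI[of _ "\<lambda>e. zmul c (a e)"]) (simp add: tens_zmul zmod.scale_sum_right)
  qed
  show "\<exists>a. z = (\<Sum>e\<in>E. (a e :: 'r) \<otimes>\<^sub>t e)" if "z \<in> base_change N"
  proof -
    have "z \<in> ?S"
    proof (rule base_change_induct[OF that zhom_ident(1) S])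
      fix r :: 'r and b assume "b \<in> N"
      then obtain a where "b = (\<Sum>e\<in>E. zmul (a e) e)" using zspan_finite_sum E by metis
      then have "r \<otimes>\<^sub>t b = (\<Sum>e\<in>E. zmul (a e) r \<otimes>\<^sub>t e)" by (simp add: tens_sum tens_zmul)
      then show "r \<otimes>\<^sub>t b \<in> ?S"
        by (intro CollectI exI[of _ "\<lambda>e. zmul (a e) r"])
    qed
    then show ?thesis by blast
  qed
  show "a e = 0" if "(\<Sum>e\<in>E. (a e :: 'r) \<otimes>\<^sub>t e) = 0" "e \<in> E"
  proof (rule rcoord_eq_0)
    fix b
    have "(\<Sum>e\<in>E. zmul (rcoord b (a e)) e) = tcoord b (\<Sum>e\<in>E. a e \<otimes>\<^sub>t e)"
      by (simp add: zhom_sum[OF zhom_tcoord] tcoord_tens)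
    then have "(\<Sum>e\<in>E. zmul (rcoord b (a e)) e) = 0"
      using that(1) by (simp add: zhom_zero[OF zhom_tcoord])
    then show "rcoord b (a e) = 0" by (rule independent_sum_zero[OF E(1,2) _ that(2)])
  qed
qed

lemma base_change_nonzerodivisor:
  fixes z :: "('r, 'm::ab_group_add) tensor"
  assumes N: "finitely_separated N" "zmod.subspace N" and z: "z \<in> base_change N" "tscale r z = 0"
    and r: "\<And>s. r * s = 0 \<Longrightarrow> s = 0"
  shows "z = 0"
proof -
  obtain E where E: "finite E" "\<not> zmod.dependent E" "zspan E = N"
    by (rule finitely_separated_basis[OF N])
  obtain a where a: "z = (\<Sum>e\<in>E. a e \<otimes>\<^sub>t e)" using base_change_basis(1)[OF E z(1)] by blast
  have "(\<Sum>e\<in>E. (r * a e) \<otimes>\<^sub>t e) = 0"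
    using z(2) by (simp add: a zhom_sum[OF zhom_tscale] tscale_tens)
  then have "a e = 0" if "e \<in> E" for e
    by (rule r[OF base_change_basis(2)[OF E _ that, of "\<lambda>e. r * a e"]])
  then show ?thesis by (simp add: a tens_simps)
qed

end

section \<open>Symmetric algebras\<close>

subsection \<open>The universal property\<close>

text \<open>The product in \<open>Sym M\<close> of the members of a multiset over \<open>M\<close>\<close>

abbreviation smon :: "'m::ab_group_add multiset \<Rightarrow> 'm sym" where
  "smon m \<equiv> prod_mset (image_mset sym_of m)"

lemma sym_zhom_eqI:
  assumes "zhom f" "zhom g" "\<And>m. f (smon m) = g (smon m)"
  shows "f z = g z"
  by (rule additive_eq_on_zspan[OF assms(1,2) _ sym_induct_products]) (use assms(3) in auto)

text \<open>The ring homomorphism out of \<open>Sym M\<close> that extends an additive map \<open>f\<close>\<close>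

definition sym_hom :: "('m::ab_group_add \<Rightarrow> 'c::comm_ring_1) \<Rightarrow> 'm sym \<Rightarrow> 'c" where
  "sym_hom f = (THE g. zhom g \<and> (\<forall>m. g (smon m) = prod_mset (image_mset f m)))"

context
  fixes f :: "'m::ab_group_add \<Rightarrow> 'c::comm_ring_1"
  assumes f: "zhom f"
begin

lemma sym_hom_unique: "\<exists>!g. zhom g \<and> (\<forall>m. g (smon m) = prod_mset (image_mset f m))"
proof -
  have abs: "abs_sym (frag_of m) = smon m" for m :: "'m multiset"
  proof (induction m)
    case empty
    show ?case by (simp add: one_sym.abs_eq flip: single_one)
  next
    case (add a m)
    have "frag_of (add_mset a m) = frag_of {#a#} * frag_of m" by (simp add: mult_single)
    then have "abs_sym (frag_of (add_mset a m)) = sym_of a * abs_sym (frag_of m)"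
      by (simp add: sym_of.abs_eq times_sym.abs_eq)
    then show ?case by (simp add: add)
  qed
  have "\<exists>!g. zhom g \<and> (\<forall>k. g (abs_sym (frag_of k)) = prod_mset (image_mset f k))"
  proof (rule quotient_lift_unique[OF Quotient3_sym sym_eq_def])
    show "zhom abs_sym" by (simp add: additive_def plus_sym.abs_eq)
    show "zlin (\<lambda>k. prod_mset (image_mset f k)) s = 0" if "s \<in> sym_rels" for s
      using that unfolding sym_rels_def
      by (elim CollectE exE conjE, hypsubst)
         (simp add: zhom_diff[OF additive_zlin] zhom_add[OF f] distrib_right)
  qed
  then show ?thesis by (simp add: abs)
qed

lemma zhom_sym_hom: "zhom (sym_hom f)"
  and sym_hom_mon: "sym_hom f (smon m) = prod_mset (image_mset f m)"
  using theI'[OF sym_hom_unique] unfolding sym_hom_def by auto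

lemma sym_hom_one: "sym_hom f 1 = 1"
  using sym_hom_mon[of "{#}"] by simp

lemma sym_hom_sym_of: "sym_hom f (sym_of u) = f u"
  using sym_hom_mon[of "{#u#}"] by simp

lemma sym_hom_mult: "sym_hom f (a * b) = sym_hom f a * sym_hom f b"
proof (rule sym_zhom_eqI[of "\<lambda>a. sym_hom f (a * b)" "\<lambda>a. sym_hom f a * sym_hom f b"])
  fix m
  show "sym_hom f (smon m * b) = sym_hom f (smon m) * sym_hom f b"
  proof (rule sym_zhom_eqI[of "\<lambda>b. sym_hom f (smon m * b)" "\<lambda>b. sym_hom f (smon m) * sym_hom f b"])
    fix k
    have "smon m * smon k = smon (m + k)" by simp
    then show "sym_hom f (smon m * smon k) = sym_hom f (smon m) * sym_hom f (smon k)"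
      by (simp only: sym_hom_mon) simp
  qed (simp_all add: additive_def distrib_left zhom_add[OF zhom_sym_hom])
qed (simp_all add: additive_def distrib_right zhom_add[OF zhom_sym_hom])

end

lemma sym_hom_eqI:
  assumes "zhom f" "zhom g" "f 1 = g 1" "\<And>a b. f (a * b) = f a * f b" "\<And>a b. g (a * b) = g a * g b"
    "\<And>u. f (sym_of u) = g (sym_of u)"
  shows "f z = g z"
proof (rule sym_zhom_eqI[OF assms(1,2)])
  fix m show "f (smon m) = g (smon m)" by (induction m) (simp_all add: assms)
qed

subsection \<open>Homogeneous components\<close>

lemma sym_pow_subspace: "zmod.subspace (sym_pow V b)"
  unfolding sym_pow_def by (rule zmod.subspace_span)

lemma mon_in_sym_pow: "set_mset m \<subseteq> V \<Longrightarrow> smon m \<in> sym_pow V (size m)"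
  unfolding sym_pow_def by (rule zmod.span_base) blast

lemma sym_pow_induct:
  assumes "z \<in> sym_pow V b" "zhom f" "zmod.subspace S"
    "\<And>m. set_mset m \<subseteq> V \<Longrightarrow> size m = b \<Longrightarrow> f (smon m) \<in> S"
  shows "f z \<in> S"
  by (rule zspan_image_subset[OF assms(2) assms(1)[unfolded sym_pow_def] assms(3)])
     (use assms(4) in auto)

lemma sym_pow_eqI:
  assumes "z \<in> sym_pow V b" "zhom f" "zhom g"
    "\<And>m. set_mset m \<subseteq> V \<Longrightarrow> size m = b \<Longrightarrow> f (smon m) = g (smon m)"
  shows "f z = g z"
  using sym_pow_induct[OF assms(1) zhom_minus2[OF assms(2,3)] subspace_zero] assms(4) by simp

lemma sym_pow_mono: "V \<subseteq> V' \<Longrightarrow> sym_pow V b \<subseteq> sym_pow V' b"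
  unfolding sym_pow_def by (rule zmod.span_mono) blast

lemma sym_pow_mult:
  assumes "\<mu> \<in> sym_pow V a" "\<mu>' \<in> sym_pow V b"
  shows "\<mu> * \<mu>' \<in> sym_pow V (a + b)"
proof (rule sym_pow_induct[OF assms(1) _ sym_pow_subspace, of "\<lambda>\<mu>. \<mu> * \<mu>'"])
  fix m assume m: "set_mset m \<subseteq> V" "size m = a"
  show "smon m * \<mu>' \<in> sym_pow V (a + b)"
  proof (rule sym_pow_induct[OF assms(2) zhom_mult_left sym_pow_subspace])
    fix k assume k: "set_mset k \<subseteq> V" "size k = b"
    then show "smon m * smon k \<in> sym_pow V (a + b)"
      using mon_in_sym_pow[of "m + k" V] m by simp
  qed
qed (simp add: additive_def distrib_right)

lemma sym_of_in_sym_pow: "u \<in> V \<Longrightarrow> sym_of u \<in> sym_pow V 1"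
  using mon_in_sym_pow[of "{#u#}" V] by simp

text \<open>The coefficients of \<open>grade \<mu>\<close> are the homogeneous components of \<open>\<mu>\<close>.\<close>

definition grade :: "'u::ab_group_add sym \<Rightarrow> 'u sym poly" where
  "grade = sym_hom (\<lambda>u. monom (sym_of u) (Suc 0))"

definition sym_comp :: "nat \<Rightarrow> 'u::ab_group_add sym \<Rightarrow> 'u sym" where
  "sym_comp b \<mu> = coeff (grade \<mu>) b"

lemma zhom_grade_gen: "zhom (\<lambda>u. monom (sym_of u) (Suc 0))"
  by (rule zhomI) (simp add: zhom_add[OF additive_sym_of] add_monom)

lemma grade_mon: "grade (smon m) = monom (smon m) (size m)"
proof -
  have "prod_mset (image_mset (\<lambda>u. monom (sym_of u) (Suc 0)) m) = monom (smon m) (size m)"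
    by (induction m) (simp_all add: mult_monom monom_0 one_pCons)
  then show ?thesis by (simp add: grade_def sym_hom_mon[OF zhom_grade_gen])
qed

lemma zhom_grade: "zhom grade"
  unfolding grade_def by (rule zhom_sym_hom[OF zhom_grade_gen])

lemma zhom_sym_comp: "zhom (sym_comp b)"
  by (rule zhomI) (simp add: sym_comp_def zhom_add[OF zhom_grade])

lemma sym_comp_mon: "sym_comp b (smon m) = (if b = size m then smon m else 0)"
  by (simp add: sym_comp_def grade_mon)

lemma sym_comp_in_sym_pow: "sym_comp b \<mu> \<in> sym_pow UNIV b"
  by (rule zspan_image_subset[OF zhom_sym_comp sym_induct_products sym_pow_subspace])
     (auto simp: sym_comp_mon intro: mon_in_sym_pow[of _ UNIV, simplified]
       zmod.subspace_0[OF sym_pow_subspace])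

lemma sym_comp_homogeneous:
  assumes "\<mu> \<in> sym_pow V c"
  shows "sym_comp b \<mu> = (if b = c then \<mu> else 0)"
proof (cases "b = c")
  case True
  then show ?thesis
    using sym_pow_eqI[OF assms zhom_sym_comp zhom_ident(1)] by (simp add: sym_comp_mon)
next
  case False
  then show ?thesis
    using sym_pow_eqI[OF assms zhom_sym_comp zhom_const_zero] by (simp add: sym_comp_mon)
qed

lemma sum_sym_comp:
  assumes "degree (grade \<mu>) \<le> N"
  shows "(\<Sum>b\<le>N. sym_comp b \<mu>) = \<mu>"
proof -
  have "poly (grade \<mu>) 1 = \<mu>"
    by (rule sym_zhom_eqI[of "\<lambda>\<mu>. poly (grade \<mu>) 1"])
       (simp_all add: additive_def zhom_add[OF zhom_grade] grade_mon poly_monom)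
  moreover have "poly (grade \<mu>) 1 = (\<Sum>b\<le>degree (grade \<mu>). sym_comp b \<mu>)"
    by (simp add: poly_altdef sym_comp_def)
  moreover have "\<dots> = (\<Sum>b\<le>N. sym_comp b \<mu>)"
    by (rule sum.mono_neutral_left) (use assms in \<open>auto simp: sym_comp_def coeff_eq_0\<close>)
  ultimately show ?thesis by simp
qed

subsection \<open>Splitting off a basis vector\<close>

text \<open>A vector \<open>e\<close> and a functional \<open>f\<close> with \<open>f e = 1\<close> split \<open>U\<close> as \<open>\<int>e \<oplus> ker f\<close>. This makes
  \<open>Sym U\<close> the polynomial ring over \<open>Sym (ker f)\<close> in the variable \<open>e\<close>: \<open>rho\<close> takes the constant
  term, and \<open>del\<close> divides the rest by \<open>e\<close>.\<close>

locale splitting =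
  fixes e :: "'u::ab_group_add" and f :: "'u \<Rightarrow> int"
  assumes zhom_f: "zhom f" and f_e: "f e = 1"
begin

text \<open>The projection of \<open>U\<close> onto \<open>ker f\<close> along \<open>e\<close>\<close>

definition prj :: "'u \<Rightarrow> 'u" where "prj u = u - zmul (f u) e"

lemma zhom_prj: "zhom prj"
  by (rule zhomI) (simp add: prj_def zhom_add[OF zhom_f] zmod.scale_left_distrib)

lemma f_prj: "f (prj u) = 0"
  by (simp add: prj_def zhom_diff[OF zhom_f] zhom_zmul[OF zhom_f] f_e)

lemma prj_ker: "f u = 0 \<Longrightarrow> prj u = u"
  by (simp add: prj_def)

lemma prj_e: "prj e = 0"
  by (simp add: prj_def f_e)

lemma sym_of_split: "sym_of u = sym_of (prj u) + of_int (f u) * sym_of e"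
  by (simp add: prj_def zhom_diff[OF additive_sym_of] zhom_zmul[OF additive_sym_of] zmul_ring)

definition rho :: "'u sym \<Rightarrow> 'u sym" where
  "rho = sym_hom (\<lambda>u. sym_of (prj u))"

text \<open>\<open>\<mu>\<close> as a polynomial in a formal variable with coefficients in \<open>Sym (ker f)\<close>; its value at \<open>e\<close>
  is \<open>\<mu>\<close>.\<close>

definition expand :: "'u sym \<Rightarrow> 'u sym poly" where
  "expand = sym_hom (\<lambda>u. [:sym_of (prj u), of_int (f u):])"

definition del :: "'u sym \<Rightarrow> 'u sym" where
  "del \<mu> = poly (poly_shift (Suc 0) (expand \<mu>)) (sym_of e)"

lemma rho_gen: "zhom (\<lambda>u. sym_of (prj u))"
  by (rule zhom_comp[OF additive_sym_of zhom_prj])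

lemma expand_gen: "zhom (\<lambda>u. [:sym_of (prj u), of_int (f u):] :: 'u sym poly)"
  by (rule zhomI) (simp add: zhom_add[OF rho_gen] zhom_add[OF zhom_f])

lemmas zhom_rho = zhom_sym_hom[OF rho_gen, folded rho_def]
  and rho_mult = sym_hom_mult[OF rho_gen, folded rho_def]
  and rho_one = sym_hom_one[OF rho_gen, folded rho_def]
  and rho_sym_of = sym_hom_sym_of[OF rho_gen, folded rho_def]
  and zhom_expand = zhom_sym_hom[OF expand_gen, folded expand_def]
  and expand_mult = sym_hom_mult[OF expand_gen, folded expand_def]
  and expand_one = sym_hom_one[OF expand_gen, folded expand_def]
  and expand_sym_of = sym_hom_sym_of[OF expand_gen, folded expand_def]

lemma rho_e: "rho (sym_of e) = 0"
  by (simp add: rho_sym_of prj_e zhom_zero[OF additive_sym_of])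

lemma rho_rho: "rho (rho \<mu>) = rho \<mu>"
  by (rule sym_hom_eqI[of "\<lambda>\<mu>. rho (rho \<mu>)"])
     (simp_all add: zhom_comp zhom_rho rho_mult rho_one rho_sym_of prj_ker f_prj)

lemma zhom_del: "zhom del"
  by (rule zhomI)
     (simp add: del_def zhom_add[OF zhom_expand] poly_eq_iff coeff_poly_shift flip: poly_add,
      rule arg_cong2[of _ _ _ _ poly], simp_all add: poly_eq_iff coeff_poly_shift)

lemma poly_expand: "poly (expand \<mu>) (sym_of e) = \<mu>"
  by (rule sym_hom_eqI[of "\<lambda>\<mu>. poly (expand \<mu>) (sym_of e)"])
     (simp_all add: additive_def zhom_add[OF zhom_expand] expand_mult expand_one expand_sym_of
       sym_of_split[symmetric] mult.commute[of "sym_of e"])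

lemma poly_expand_0: "poly (expand \<mu>) 0 = rho \<mu>"
  by (rule sym_hom_eqI[of "\<lambda>\<mu>. poly (expand \<mu>) 0"])
     (simp_all add: additive_def zhom_add[OF zhom_expand] zhom_add[OF zhom_rho] expand_mult
       expand_one expand_sym_of rho_mult rho_one rho_sym_of)

lemma poly_shift_pCons: "poly_shift (Suc 0) (pCons a q) = q"
  by (simp add: poly_eq_iff coeff_poly_shift)

lemma rho_del: "rho \<mu> + sym_of e * del \<mu> = \<mu>"
proof -
  obtain a q where p: "expand \<mu> = pCons a q" by (rule pCons_cases)
  show ?thesis
    using poly_expand[of \<mu>] poly_expand_0[of \<mu>] by (simp add: del_def p poly_shift_pCons)
qed

lemma del_e: "del (sym_of e * \<mu>) = \<mu>"
proof -
  have "expand (sym_of e * \<mu>) = pCons 0 (expand \<mu>)"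
    by (simp add: expand_mult expand_sym_of prj_e f_e zhom_zero[OF additive_sym_of])
  then show ?thesis by (simp add: del_def poly_shift_pCons poly_expand)
qed

lemma del_rho: "del (rho \<mu>) = 0"
proof -
  have "expand (rho \<mu>) = [:rho \<mu>:]"
    by (rule sym_hom_eqI[of "\<lambda>\<mu>. expand (rho \<mu>)"])
       (simp_all add: zhom_comp[OF zhom_expand zhom_rho] additive_def zhom_add[OF zhom_rho]
         rho_mult rho_one rho_sym_of expand_mult expand_one expand_sym_of f_prj prj_ker one_pCons)
  then show ?thesis by (simp add: del_def poly_shift_pCons)
qed

lemma rho_sym_of_ker: "f u = 0 \<Longrightarrow> rho (sym_of u * \<mu>) = sym_of u * rho \<mu>"
  by (simp add: rho_mult rho_sym_of prj_ker)

lemma del_sym_of_ker: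
  assumes "f u = 0"
  shows "del (sym_of u * \<mu>) = sym_of u * del \<mu>"
proof -
  have "sym_of u * \<mu> = rho (sym_of u * \<mu>) + sym_of e * (sym_of u * del \<mu>)"
    unfolding rho_sym_of_ker[OF assms]
    by (subst (1) rho_del[of \<mu>, symmetric]) (simp add: algebra_simps)
  then have "del (sym_of u * \<mu>) = del (rho (sym_of u * \<mu>) + sym_of e * (sym_of u * del \<mu>))"
    by simp
  then show ?thesis by (simp add: zhom_add[OF zhom_del] del_rho del_e)
qed

lemma rho_mon: "rho (smon m) = smon (image_mset prj m)"
  by (induction m) (simp_all add: rho_one rho_mult rho_sym_of)

lemma rho_in_sym_pow:
  assumes "\<mu> \<in> sym_pow UNIV b"
  shows "rho \<mu> \<in> sym_pow {u. f u = 0} b"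
proof (rule sym_pow_induct[OF assms zhom_rho sym_pow_subspace])
  fix m :: "'u multiset" assume "size m = b"
  then show "rho (smon m) \<in> sym_pow {u. f u = 0} b"
    unfolding rho_mon using mon_in_sym_pow[of "image_mset prj m" "{u. f u = 0}"]
    by (simp add: f_prj image_subset_iff)
qed

lemma rho_ker:
  assumes "\<mu> \<in> sym_pow {u. f u = 0} b"
  shows "rho \<mu> = \<mu>"
proof (rule sym_pow_eqI[OF assms zhom_rho zhom_ident(1)])
  fix m :: "'u multiset" assume "set_mset m \<subseteq> {u. f u = 0}"
  then have "image_mset prj m = m" by (induction m) (auto simp: prj_ker)
  then show "rho (smon m) = smon m" by (simp add: rho_mon)
qed

lemma del_in_sym_pow:
  assumes "\<mu> \<in> sym_pow UNIV (Suc b)"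
  shows "del \<mu> \<in> sym_pow UNIV b"
proof (rule sym_pow_induct[OF assms zhom_del sym_pow_subspace])
  fix m :: "'u multiset"
  show "size m = Suc b \<Longrightarrow> del (smon m) \<in> sym_pow UNIV b"
  proof (induction m arbitrary: b)
    case (add u m)
    have m: "smon m \<in> sym_pow UNIV b" using mon_in_sym_pow[of m UNIV] add.prems by simp
    have "smon (add_mset u m) = sym_of (prj u) * smon m + sym_of e * zmul (f u) (smon m)"
      using sym_of_split[of u] by (simp add: zmul_ring algebra_simps)
    then have "del (smon (add_mset u m)) = sym_of (prj u) * del (smon m) + zmul (f u) (smon m)"
      by (simp add: zhom_add[OF zhom_del] del_e del_sym_of_ker f_prj)
    moreover have "sym_of (prj u) * del (smon m) \<in> sym_pow UNIV b"
    proof (cases b)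
      case 0
      then have "del (smon m) = del (rho 1)" using add.prems by (simp add: rho_one)
      then show ?thesis by (simp add: del_rho zmod.subspace_0[OF sym_pow_subspace])
    next
      case (Suc c)
      then show ?thesis
        using sym_pow_mult[OF sym_of_in_sym_pow[OF UNIV_I] add.IH[of c]] add.prems by simp
    qed
    ultimately show ?case
      using m zmod.subspace_add[OF sym_pow_subspace] zmod.subspace_scale[OF sym_pow_subspace] by metis
  qed simp
qed

lemma del_degree_0:
  assumes "\<mu> \<in> sym_pow UNIV 0"
  shows "del \<mu> = 0"
  by (rule sym_pow_eqI[OF assms zhom_del zhom_const_zero]) (use del_rho[of 1] in \<open>simp add: rho_one\<close>)

end

section \<open>Exterior algebras\<close>

lemma ext_in_zspan: "z \<in> zspan (range wedge)"
  using quotient_in_zspan[OF Quotient3_ext, of z]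
  by (simp add: additive_def plus_ext.abs_eq wedge.abs_eq)

lemma ext_zhom_eqI:
  assumes "zhom f" "zhom g" "\<And>us. f (wedge us) = g (wedge us)"
  shows "f z = g z"
  by (rule additive_eq_on_zspan[OF assms(1,2) _ ext_in_zspan]) (use assms(3) in auto)

lemmas zhom_wedge_left = additive_ext_lift[OF alternating_wedge_Cons, folded wedge_left_def]
  and wedge_left_wedge = ext_lift_wedge[OF alternating_wedge_Cons, folded wedge_left_def]

text \<open>Every identity between additive maps on the exterior algebra follows by building up a product
  from the left.\<close>

lemma ext_zhom_eq_induct:
  assumes "zhom f" "zhom g" "f (wedge []) = g (wedge [])"
    "\<And>u z. f z = g z \<Longrightarrow> f (wedge_left u z) = g (wedge_left u z)"
  shows "f z = g z"
proof (rule ext_zhom_eqI[OF assms(1,2)])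
  fix us show "f (wedge us) = g (wedge us)"
    by (induction us) (use assms(3,4) in \<open>simp_all add: wedge_left_wedge[symmetric]\<close>)
qed

lemma zhom_wedge_left_left: "zhom (\<lambda>u. wedge_left u z)"
proof (rule zhomI)
  fix a b :: 'a
  show "wedge_left (a + b) z = wedge_left a z + wedge_left b z"
  proof (rule ext_zhom_eqI[OF zhom_wedge_left zhom_plus[OF zhom_wedge_left zhom_wedge_left]])
    fix us
    have "wedge ([] @ (a + b) # us) = wedge ([] @ a # us) + wedge ([] @ b # us)"
      using alternating_wedge unfolding alternating_def by blast
    then show "wedge_left (a + b) (wedge us) = wedge_left a (wedge us) + wedge_left b (wedge us)"
      by (simp add: wedge_left_wedge)
  qed
qed

lemma wedge_left_square: "wedge_left a (wedge_left a z) = 0"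
proof (rule ext_zhom_eqI[OF zhom_comp[OF zhom_wedge_left zhom_wedge_left] zhom_const_zero])
  fix us
  have "wedge ([] @ a # a # us) = 0"
    using alternating_wedge unfolding alternating_def by blast
  then show "wedge_left a (wedge_left a (wedge us)) = 0" by (simp add: wedge_left_wedge)
qed

lemmas wedge_left_simps =
  zhom_add[OF zhom_wedge_left] zhom_diff[OF zhom_wedge_left] zhom_zero[OF zhom_wedge_left]
  zhom_minus[OF zhom_wedge_left] zhom_zmul[OF zhom_wedge_left]
  zhom_add[OF zhom_wedge_left_left] zhom_diff[OF zhom_wedge_left_left]
  zhom_zero[OF zhom_wedge_left_left] zhom_minus[OF zhom_wedge_left_left]
  zhom_zmul[OF zhom_wedge_left_left] wedge_left_square

lemma wedge_left_anticommute: "wedge_left a (wedge_left b z) = - wedge_left b (wedge_left a z)"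
proof -
  have "wedge_left (a + b) (wedge_left (a + b) z) = 0" by (rule wedge_left_square)
  then show ?thesis by (simp add: wedge_left_simps eq_neg_iff_add_eq_0 add.commute)
qed

lemma
  assumes "zhom f"
  shows zhom_ext_contract: "zhom (ext_contract f)"
    and ext_contract_wedge: "ext_contract f (wedge us) = ext_contract_list f us"
  unfolding ext_contract_def
  by (rule additive_ext_lift ext_lift_wedge, rule alternating_ext_contract_list, fact)+

lemma ext_contract_Nil: "zhom f \<Longrightarrow> ext_contract f (wedge []) = 0"
  by (simp add: ext_contract_wedge ext_contract_list_def)

lemma ext_contract_wedge_left:
  assumes "zhom f"
  shows "ext_contract f (wedge_left u z) = zmul (f u) z - wedge_left u (ext_contract f z)"
  by (rule ext_zhom_eqI[of "\<lambda>z. ext_contract f (wedge_left u z)"])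
     (simp_all add: zhom_comp zhom_ext_contract zhom_wedge_left zhom_minus2 zhom_zmul_right assms
       wedge_left_wedge ext_contract_wedge ext_contract_list_Cons)

lemma ext_contract_anticommute:
  assumes "zhom f" "zhom g"
  shows "ext_contract f (ext_contract g z) + ext_contract g (ext_contract f z) = 0"
proof -
  note c = zhom_ext_contract[OF assms(1)] zhom_ext_contract[OF assms(2)]
  show ?thesis
  proof (rule ext_zhom_eq_induct[OF zhom_plus[OF zhom_comp[OF c(1,2)] zhom_comp[OF c(2,1)]]
        zhom_const_zero])
    fix u z
    assume IH: "ext_contract f (ext_contract g z) + ext_contract g (ext_contract f z) = 0"
    have "ext_contract f (ext_contract g (wedge_left u z)) + ext_contract g (ext_contract f (wedge_left u z))
        = wedge_left u (ext_contract f (ext_contract g z) + ext_contract g (ext_contract f z))"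
      by (simp add: assms ext_contract_wedge_left zhom_diff[OF c(1)] zhom_diff[OF c(2)]
          zhom_zmul[OF c(1)] zhom_zmul[OF c(2)] zhom_add[OF zhom_wedge_left])
    then show "ext_contract f (ext_contract g (wedge_left u z))
        + ext_contract g (ext_contract f (wedge_left u z)) = 0"
      by (simp add: IH zhom_zero[OF zhom_wedge_left])
  qed (simp add: assms ext_contract_Nil zhom_zero[OF c(1)] zhom_zero[OF c(2)])
qed

lemma ext_contract_square:
  assumes "zhom f"
  shows "ext_contract f (ext_contract f z) = 0"
  by (rule ext_zhom_eq_induct[OF zhom_comp[OF zhom_ext_contract[OF assms] zhom_ext_contract[OF assms]]
        zhom_const_zero])
     (simp_all add: assms ext_contract_Nil ext_contract_wedge_left
       zhom_diff[OF zhom_ext_contract] zhom_zmul[OF zhom_ext_contract]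
       zhom_zero[OF zhom_ext_contract] wedge_left_simps)

lemma ext_pow_subspace: "zmod.subspace (ext_pow V a)"
  unfolding ext_pow_def by (rule zmod.subspace_span)

lemma wedge_in_ext_pow: "set us \<subseteq> V \<Longrightarrow> wedge us \<in> ext_pow V (length us)"
  unfolding ext_pow_def by (rule zmod.span_base) blast

lemma ext_pow_induct:
  assumes "z \<in> ext_pow V a" "zhom f" "zmod.subspace S"
    "\<And>us. set us \<subseteq> V \<Longrightarrow> length us = a \<Longrightarrow> f (wedge us) \<in> S"
  shows "f z \<in> S"
  by (rule zspan_image_subset[OF assms(2) assms(1)[unfolded ext_pow_def] assms(3)])
     (use assms(4) in auto)

lemma ext_pow_mono: "V \<subseteq> V' \<Longrightarrow> ext_pow V a \<subseteq> ext_pow V' a"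
  unfolding ext_pow_def by (rule zmod.span_mono) blast

lemma wedge_left_in_ext_pow:
  assumes "z \<in> ext_pow V a" "u \<in> V"
  shows "wedge_left u z \<in> ext_pow V (Suc a)"
proof (rule ext_pow_induct[OF assms(1) zhom_wedge_left ext_pow_subspace])
  fix us assume "set us \<subseteq> V" "length us = a"
  then show "wedge_left u (wedge us) \<in> ext_pow V (Suc a)"
    using wedge_in_ext_pow[of "u # us" V] assms(2) by (simp add: wedge_left_wedge)
qed

lemma ext_contract_in_ext_pow:
  assumes "zhom f" "z \<in> ext_pow V (Suc a)"
  shows "ext_contract f z \<in> ext_pow V a"
proof (rule ext_pow_induct[OF assms(2) zhom_ext_contract[OF assms(1)] ext_pow_subspace])
  fix us assume us: "set us \<subseteq> V" "length us = Suc a"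
  show "ext_contract f (wedge us) \<in> ext_pow V a"
    unfolding ext_contract_wedge[OF assms(1)] ext_contract_list_def
  proof (intro zmod.subspace_sum[OF ext_pow_subspace] zmod.subspace_scale[OF ext_pow_subspace])
    fix i assume "i \<in> {..<length us}"
    then have "length (take i us @ drop (Suc i) us) = a" using us(2) by simp
    moreover have "set (take i us @ drop (Suc i) us) \<subseteq> V"
      using us(1) set_take_subset[of i us] set_drop_subset[of "Suc i" us] by auto
    ultimately show "wedge (take i us @ drop (Suc i) us) \<in> ext_pow V a"
      using wedge_in_ext_pow by metis
  qed
qed

lemma ext_contract_degree_0:
  assumes "zhom f" "z \<in> ext_pow V 0"
  shows "ext_contract f z = 0"
  using ext_pow_induct[OF assms(2) zhom_ext_contract[OF assms(1)] subspace_zero]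
  by (simp add: ext_contract_Nil assms(1))

lemma ext_contract_in_ext_pow_diff:
  assumes "zhom f" "z \<in> ext_pow V a"
  shows "ext_contract f z \<in> ext_pow V (a - 1)"
proof (cases a)
  case 0
  then show ?thesis
    using ext_contract_degree_0[of f z V] assms zmod.subspace_0[OF ext_pow_subspace] by simp
next
  case (Suc b)
  then show ?thesis using ext_contract_in_ext_pow[of f z V b] assms by simp
qed

text \<open>The map of exterior algebras induced by \<open>f\<close>\<close>

definition ext_map :: "('u::ab_group_add \<Rightarrow> 'v::ab_group_add) \<Rightarrow> 'u ext \<Rightarrow> 'v ext" where
  "ext_map f = ext_lift (\<lambda>us. wedge (map f us))"

lemma
  assumes "zhom f"
  shows zhom_ext_map: "zhom (ext_map f)"
    and ext_map_wedge: "ext_map f (wedge us) = wedge (map f us)"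
    and ext_map_wedge_left: "ext_map f (wedge_left u z) = wedge_left (f u) (ext_map f z)"
proof -
  have a: "alternating (\<lambda>us. wedge (map f us))"
    unfolding alternating_def
    by (simp add: zhom_add[OF assms]
        alternating_wedge[unfolded alternating_def, THEN conjunct1, rule_format]
        alternating_wedge[unfolded alternating_def, THEN conjunct2, rule_format])
  show z: "zhom (ext_map f)" and w: "ext_map f (wedge us) = wedge (map f us)" for us
    unfolding ext_map_def by (rule additive_ext_lift[OF a] ext_lift_wedge[OF a])+
  show "ext_map f (wedge_left u z) = wedge_left (f u) (ext_map f z)"
    by (rule ext_zhom_eqI[OF zhom_comp[OF z zhom_wedge_left] zhom_comp[OF zhom_wedge_left z]])
       (simp add: w wedge_left_wedge)
qed

text \<open>The splitting \<open>\<And>U = \<And>(ker f) \<oplus> e \<and> \<And>(ker f)\<close>, with the projections \<open>wprj\<close> to the first summand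
  and contraction by \<open>f\<close> to the second.\<close>

context splitting
begin

definition wprj :: "'u ext \<Rightarrow> 'u ext" where "wprj = ext_map prj"

lemmas zhom_wprj = zhom_ext_map[OF zhom_prj, folded wprj_def]
  and wprj_wedge = ext_map_wedge[OF zhom_prj, folded wprj_def]
  and wprj_wedge_left = ext_map_wedge_left[OF zhom_prj, folded wprj_def]

lemma wprj_Nil: "wprj (wedge []) = wedge []"
  by (simp add: wprj_wedge)

lemma wprj_e: "wprj (wedge_left e z) = 0"
  by (simp add: wprj_wedge_left prj_e wedge_left_simps)

lemma prj_prj: "prj (prj u) = prj u"
  by (simp add: prj_ker f_prj)

lemma wprj_wprj: "wprj (wprj z) = wprj z"
  by (rule ext_zhom_eq_induct[OF zhom_comp[OF zhom_wprj zhom_wprj] zhom_wprj])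
     (simp_all add: wprj_Nil wprj_wedge_left prj_prj)

lemma contract_wprj: "ext_contract f (wprj z) = 0"
  by (rule ext_zhom_eq_induct[OF zhom_comp[OF zhom_ext_contract[OF zhom_f] zhom_wprj] zhom_const_zero])
     (simp_all add: zhom_f wprj_Nil ext_contract_Nil wprj_wedge_left ext_contract_wedge_left f_prj
       wedge_left_simps)

lemma contract_e: "ext_contract f (wedge_left e z) = z - wedge_left e (ext_contract f z)"
  by (simp add: ext_contract_wedge_left zhom_f f_e)

lemma wprj_contract:
  assumes "zhom g" "g e = 0"
  shows "wprj (ext_contract g z) = ext_contract g (wprj z)"
proof -
  have g_prj: "g (prj u) = g u" for u
    by (simp add: prj_def zhom_diff[OF assms(1)] zhom_zmul[OF assms(1)] assms(2))
  show ?thesis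
    by (rule ext_zhom_eq_induct[OF zhom_comp[OF zhom_wprj zhom_ext_contract[OF assms(1)]]
          zhom_comp[OF zhom_ext_contract[OF assms(1)] zhom_wprj]])
       (simp_all add: assms g_prj wprj_Nil ext_contract_Nil wprj_wedge_left
          ext_contract_wedge_left zhom_zero[OF zhom_wprj] zhom_diff[OF zhom_wprj]
          zhom_zmul[OF zhom_wprj])
qed

lemma wprj_split: "wprj z + wedge_left e (ext_contract f z) = z"
proof (rule ext_zhom_eq_induct[OF zhom_plus[OF zhom_wprj
        zhom_comp[OF zhom_wedge_left zhom_ext_contract[OF zhom_f]]] zhom_ident(1)])
  fix u z assume IH: "wprj z + wedge_left e (ext_contract f z) = z"
  have "wedge_left e (wedge_left u (ext_contract f z)) = - wedge_left u (z - wprj z)"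
    by (subst wedge_left_anticommute, subst (2) IH[symmetric]) simp
  moreover have "wedge_left (prj u) (wprj z) = wedge_left u (wprj z) - zmul (f u) (wedge_left e (wprj z))"
    by (simp add: prj_def wedge_left_simps)
  moreover have "wedge_left e (wprj z) = wedge_left e z"
    by (subst (2) IH[symmetric]) (simp add: wedge_left_simps)
  ultimately show "wprj (wedge_left u z) + wedge_left e (ext_contract f (wedge_left u z))
      = wedge_left u z"
    by (simp add: wprj_wedge_left ext_contract_wedge_left zhom_f wedge_left_simps)
qed (simp_all add: zhom_f wprj_Nil ext_contract_Nil wedge_left_simps)

lemma wprj_in_ext_pow:
  assumes "z \<in> ext_pow V a" "\<And>u. u \<in> V \<Longrightarrow> prj u \<in> V'"
  shows "wprj z \<in> ext_pow V' a"
proof (rule ext_pow_induct[OF assms(1) zhom_wprj ext_pow_subspace])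
  fix us assume "set us \<subseteq> V" "length us = a"
  then show "wprj (wedge us) \<in> ext_pow V' a"
    using wedge_in_ext_pow[of "map prj us" V'] assms(2) by (auto simp: wprj_wedge)
qed

lemma wprj_ker:
  assumes "z \<in> ext_pow {u. f u = 0} a"
  shows "wprj z = z"
proof -
  have "wprj z - z = 0"
    using ext_pow_induct[OF assms zhom_minus2[OF zhom_wprj zhom_ident(1)] subspace_zero]
    by (simp add: wprj_wedge prj_ker subset_iff map_idI)
  then show ?thesis by simp
qed

lemma contract_ker: "z \<in> ext_pow {u. f u = 0} a \<Longrightarrow> ext_contract f z = 0"
  using contract_wprj[of z] by (simp add: wprj_ker)

end

subsection \<open>Finitely generated exterior powers\<close>

text \<open>\<open>U\<close> is free of finite rank with basis \<open>x i\<close>, \<open>i \<in> I\<close>, and dual basis \<open>xd i\<close>.\<close>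

locale dual_bases =
  fixes I :: "nat set" and x :: "nat \<Rightarrow> 'u::ab_group_add" and xd :: "nat \<Rightarrow> 'u \<Rightarrow> int"
  assumes finite_I: "finite I"
    and zhom_xd: "\<And>i. i \<in> I \<Longrightarrow> zhom (xd i)"
    and xd_x: "\<And>i j. i \<in> I \<Longrightarrow> j \<in> I \<Longrightarrow> xd i (x j) = (if i = j then 1 else 0)"
    and x_span: "\<And>u. (\<Sum>i\<in>I. zmul (xd i u) (x i)) = u"
begin

lemma splitting: "i \<in> I \<Longrightarrow> splitting (x i) (xd i)"
  by (simp add: splitting_def zhom_xd xd_x)

text \<open>The span of the basis vectors with index in \<open>J\<close>\<close>

definition below :: "nat set \<Rightarrow> 'u set" where
  "below J = {u. \<forall>i\<in>I - J. xd i u = 0}"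

lemma below_empty: "below {} = {0}"
proof -
  have "u = 0" if "\<forall>i\<in>I. xd i u = 0" for u using x_span[of u] that by simp
  then show ?thesis by (auto simp: below_def zhom_zero[OF zhom_xd])
qed

lemma prj_below:
  assumes "j \<in> I" "u \<in> below (insert j J)"
  shows "splitting.prj (x j) (xd j) u \<in> below J"
proof -
  interpret splitting "x j" "xd j" by (rule splitting[OF assms(1)])
  show ?thesis
    unfolding below_def
  proof (intro CollectI ballI)
    fix i assume i: "i \<in> I - J"
    show "xd i (prj u) = 0"
    proof (cases "i = j")
      case False
      then show ?thesis
        using i assms by (simp add: prj_def zhom_diff[OF zhom_xd] zhom_zmul[OF zhom_xd] xd_x below_def)
    qed (simp add: f_prj)
  qed
qed

lemma contract_below:
  assumes "j \<in> I" "z \<in> ext_pow (below (insert j J)) a"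
  shows "ext_contract (xd j) z \<in> ext_pow (below J) (a - 1)"
proof -
  interpret splitting "x j" "xd j" by (rule splitting[OF assms(1)])
  have "wprj (ext_contract (xd j) z) \<in> ext_pow (below J) (a - 1)"
    by (rule wprj_in_ext_pow[OF ext_contract_in_ext_pow_diff[OF zhom_f assms(2)]
          prj_below[OF assms(1)]])
  moreover have "wprj (ext_contract (xd j) z) = ext_contract (xd j) z"
    using wprj_split[of "ext_contract (xd j) z"]
    by (simp add: ext_contract_square zhom_f wedge_left_simps)
  ultimately show ?thesis by simp
qed

lemma wprj_below:
  assumes "j \<in> I" "z \<in> ext_pow (below (insert j J)) a"
  shows "splitting.wprj (x j) (xd j) z \<in> ext_pow (below J) a"
proof -
  interpret splitting "x j" "xd j" by (rule splitting[OF assms(1)])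
  show ?thesis by (rule wprj_in_ext_pow[OF assms(2) prj_below[OF assms(1)]])
qed

text \<open>Splitting off one basis vector at a time reduces to \<open>\<And>0 = \<int>\<close>.\<close>

lemma finitely_separated_ext_pow: "finitely_separated (ext_pow (UNIV :: 'u set) a)"
proof -
  have "\<exists>C :: ('u ext \<Rightarrow> int) set. finite C \<and> (\<forall>c\<in>C. zhom c) \<and>
      (\<forall>a. \<forall>z\<in>ext_pow (below J) a. (\<forall>c\<in>C. c z = 0) \<longrightarrow> z = 0)" if "finite J" "J \<subseteq> I" for J
    using that
  proof (induction rule: finite_induct)
    case empty
    let ?c = "ext_lift (\<lambda>us :: 'u list. if us = [] then 1 else (0::int))"
    have alt: "alternating (\<lambda>us :: 'u list. if us = [] then 1 else (0::int))"
      by (simp add: alternating_def)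
    have "wedge us = zmul (?c (wedge us)) (wedge [])" if "set us \<subseteq> {0}" for us :: "'u list"
    proof (cases us)
      case (Cons u vs)
      then have "wedge us = wedge_left 0 (wedge vs)" using that by (simp add: wedge_left_wedge)
      then have "wedge us = 0" by (simp add: wedge_left_simps)
      then show ?thesis by (simp add: zhom_zero[OF additive_ext_lift[OF alt]])
    qed (simp add: ext_lift_wedge[OF alt])
    then have "z - zmul (?c z) (wedge []) = 0" if "z \<in> ext_pow (below {}) a" for z a
      using ext_pow_induct[OF that zhom_minus2[OF zhom_ident(1)
          zhom_comp[OF zhom_zmul_left additive_ext_lift[OF alt]]] subspace_zero]
      by (simp add: below_empty)
    then have "z = 0" if "z \<in> ext_pow (below {}) a" "?c z = 0" for z a
      using that by fastforce
    then show ?case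
      by (intro exI[of _ "{?c}"]) (use additive_ext_lift[OF alt] in auto)
  next
    case (insert j J)
    then have j: "j \<in> I" and J: "J \<subseteq> I" by simp_all
    interpret splitting "x j" "xd j" by (rule splitting[OF j])
    obtain C :: "('u ext \<Rightarrow> int) set" where C: "finite C" "\<forall>c\<in>C. zhom c"
      "\<forall>a. \<forall>z\<in>ext_pow (below J) a. (\<forall>c\<in>C. c z = 0) \<longrightarrow> z = 0"
      using insert.IH[OF J] by (elim exE conjE) (rule that)
    let ?C = "(\<lambda>c z. c (wprj z)) ` C \<union> (\<lambda>c z. c (ext_contract (xd j) z)) ` C"
    have "z = 0" if z: "z \<in> ext_pow (below (insert j J)) a" and c: "\<forall>c\<in>?C. c z = 0" for z a
    proof -
      have c: "\<forall>c\<in>C. c (wprj z) = 0" "\<forall>c\<in>C. c (ext_contract (xd j) z) = 0"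
        using c by (simp_all add: ball_Un)
      have "wprj z = 0" by (rule C(3)[THEN spec, THEN bspec, OF wprj_below[OF j z], THEN mp, OF c(1)])
      moreover have "ext_contract (xd j) z = 0"
        by (rule C(3)[THEN spec, THEN bspec, OF contract_below[OF j z], THEN mp, OF c(2)])
      ultimately show ?thesis using wprj_split[of z] by (simp add: wedge_left_simps)
    qed
    moreover have "\<forall>c\<in>?C. zhom c"
    proof (intro ballI, elim UnE imageE)
      fix c c0 assume c: "c0 \<in> C"
      show "zhom c" if "c = (\<lambda>z. c0 (wprj z))"
        unfolding that by (rule zhom_comp[OF bspec[OF C(2) c] zhom_wprj])
      show "zhom c" if "c = (\<lambda>z. c0 (ext_contract (xd j) z))"
        unfolding that by (rule zhom_comp[OF bspec[OF C(2) c] zhom_ext_contract[OF zhom_f]])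
    qed
    moreover have "finite ?C" using C(1) by simp
    ultimately show ?case by (intro exI[of _ ?C]) blast
  qed
  from this[OF finite_I subset_refl] obtain C :: "('u ext \<Rightarrow> int) set" where C: "finite C" "\<forall>c\<in>C. zhom c"
    "\<forall>a. \<forall>z\<in>ext_pow (below I) a. (\<forall>c\<in>C. c z = 0) \<longrightarrow> z = 0"
    by (elim exE conjE) (rule that)
  have "below I = UNIV" by (simp add: below_def)
  with C show ?thesis unfolding finitely_separated_def by (intro exI[of _ C]) simp
qed

text \<open>Exterior powers above the rank vanish.\<close>

lemma ext_pow_below_eq_0:
  assumes "finite J" "J \<subseteq> I" "card J < a" "z \<in> ext_pow (below J) a"
  shows "z = 0"
  using assms
proof (induction arbitrary: a z rule: finite_induct)
  case empty
  have "wedge us = 0" if "set us \<subseteq> {0}" "length us = a" for us :: "'u list"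
  proof (cases us)
    case (Cons u vs)
    then have "wedge us = wedge_left 0 (wedge vs)" using that by (simp add: wedge_left_wedge)
    then show ?thesis by (simp add: wedge_left_simps)
  qed (use that empty in simp)
  then show ?case
    using ext_pow_induct[OF empty(3) zhom_ident(1) subspace_zero] by (simp add: below_empty)
next
  case (insert j J)
  then have j: "j \<in> I" by simp
  interpret splitting "x j" "xd j" by (rule splitting[OF j])
  have "wprj z = 0"
    by (rule insert.IH[OF _ _ wprj_below[OF j insert.prems(3)]]) (use insert in auto)
  moreover have "ext_contract (xd j) z = 0"
    by (rule insert.IH[OF _ _ contract_below[OF j insert.prems(3)]]) (use insert in auto)
  ultimately show ?case using wprj_split[of z] by (simp add: wedge_left_simps)
qed

end

section \<open>Symmetric algebras of free abelian groups of finite rank\<close>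

lemma zspan_image_sum:
  assumes "z \<in> zspan (f ` A)"
  obtains F a where "finite F" "F \<subseteq> A" "z = (\<Sum>m\<in>F. zmul (a m) (f m))"
proof -
  obtain t u where t: "finite t" "t \<subseteq> f ` A" "z = (\<Sum>v\<in>t. zmul (u v) v)"
    using assms by (auto simp: zmod.span_explicit)
  let ?F = "inv_into A f ` t"
  have "inj_on (inv_into A f) t" using t(2) inj_on_inv_into by blast
  then have "(\<Sum>m\<in>?F. zmul (u (f m)) (f m)) = (\<Sum>v\<in>t. zmul (u (f (inv_into A f v))) (f (inv_into A f v)))"
    by (simp add: sum.reindex)
  also have "\<dots> = z" unfolding t(3) using t(2) by (intro sum.cong) (auto simp: f_inv_into_f)
  finally have "z = (\<Sum>m\<in>?F. zmul (u (f m)) (f m))" by simp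
  moreover have "?F \<subseteq> A" using t(2) by (auto intro: inv_into_into)
  ultimately show thesis using that[of ?F "\<lambda>m. u (f m)"] t(1) by blast
qed

lemma digits_unique:
  fixes c c' :: "nat \<Rightarrow> nat"
  assumes "\<And>j. c j < N" "\<And>j. c' j < N" "(\<Sum>j<k. c j * N ^ j) = (\<Sum>j<k. c' j * N ^ j)" "j < k"
  shows "c j = c' j"
  using assms
proof (induction k arbitrary: c c' j)
  case (Suc k)
  have s: "(\<Sum>j<Suc k. c j * N ^ j) = c 0 + N * (\<Sum>j<k. c (Suc j) * N ^ j)" for c :: "nat \<Rightarrow> nat"
    by (simp add: sum.lessThan_Suc_shift sum_distrib_left algebra_simps del: sum.lessThan_Suc)
  let ?s = "\<Sum>j<k. c (Suc j) * N ^ j" and ?s' = "\<Sum>j<k. c' (Suc j) * N ^ j"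
  have e: "c 0 + N * ?s = c' 0 + N * ?s'" using Suc.prems(3) unfolding s .
  have 0: "c 0 < N" "c' 0 < N" using Suc.prems by auto
  have c0: "c 0 = c' 0" using arg_cong[OF e, of "\<lambda>t. t mod N"] 0 by simp
  have s': "?s = ?s'" using arg_cong[OF e, of "\<lambda>t. t div N"] 0 by simp
  show ?case
  proof (cases j)
    case (Suc i)
    have "c (Suc i) = c' (Suc i)"
      by (rule Suc.IH[of "\<lambda>j. c (Suc j)" "\<lambda>j. c' (Suc j)", OF _ _ s'])
         (use Suc.prems \<open>j = Suc i\<close> in auto)
    then show ?thesis using Suc by simp
  qed (use c0 in simp)
qed simp

text \<open>Kronecker substitution: the value at \<open>t^(N^i)\<close> in place of the \<open>i\<close>-th variable separates the
  monomials of degree less than \<open>N\<close>.\<close>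

definition kweight :: "nat \<Rightarrow> nat multiset \<Rightarrow> nat" where
  "kweight N m = (\<Sum>j\<in>#m. N ^ j)"

lemma kweight_inject:
  assumes "size m < N" "size m' < N" "kweight N m = kweight N m'"
  shows "m = m'"
proof -
  let ?k = "Suc (Max (insert 0 (set_mset m \<union> set_mset m')))"
  have w: "kweight N m = (\<Sum>j<k. count m j * N ^ j)" if "set_mset m \<subseteq> {..<k}" for m k
    using that
  proof (induction m)
    case (add i m)
    have "(\<Sum>j<k. count (add_mset i m) j * N ^ j)
        = (\<Sum>j<k. count m j * N ^ j + (if j = i then N ^ j else 0))"
      by (intro sum.cong) (auto simp: algebra_simps)
    then show ?case using add by (simp add: kweight_def sum.distrib)
  qed (simp add: kweight_def)
  have k: "set_mset m \<subseteq> {..<?k}" "set_mset m' \<subseteq> {..<?k}"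
    by (auto simp: less_Suc_eq_le intro!: Max_ge)
  have c: "count m j < N" "count m' j < N" for j
    using assms(1,2) count_le_size[of m j] count_le_size[of m' j] by linarith+
  have "count m j = count m' j" for j
  proof (cases "j < ?k")
    case True
    with digits_unique[of "count m" N "count m'" ?k j] c assms(3) w[OF k(1)] w[OF k(2)]
    show ?thesis by simp
  next
    case False
    then have "j \<notin> set_mset m" "j \<notin> set_mset m'" using k by (meson lessThan_iff subsetD)+
    then show ?thesis by (simp add: not_in_iff)
  qed
  then show ?thesis by (rule multiset_eqI)
qed

context dual_bases
begin

text \<open>\<open>emon m\<close> is the monomial with exponents \<open>m\<close> in the basis vectors, and \<open>kron N\<close> is the Kronecker
  substitution, with values in the univariate polynomials over the integers.\<close>

definition emon :: "nat multiset \<Rightarrow> 'u sym" where "emon m = smon (image_mset x m)"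

definition kron :: "nat \<Rightarrow> 'u sym \<Rightarrow> int poly" where
  "kron N = sym_hom (\<lambda>u. \<Sum>i\<in>I. monom (xd i u) (N ^ i))"

lemma kron_gen: "zhom (\<lambda>u. \<Sum>i\<in>I. monom (xd i u) (N ^ i))"
  by (intro zhom_sum_fun zhomI) (simp add: zhom_add[OF zhom_xd] add_monom)

lemmas zhom_kron = zhom_sym_hom[OF kron_gen, folded kron_def]
  and kron_mult = sym_hom_mult[OF kron_gen, folded kron_def]
  and kron_one = sym_hom_one[OF kron_gen, folded kron_def]
  and kron_sym_of = sym_hom_sym_of[OF kron_gen, folded kron_def]

lemma kron_x: "j \<in> I \<Longrightarrow> kron N (sym_of (x j)) = monom 1 (N ^ j)"
proof -
  assume j: "j \<in> I"
  have "(\<Sum>i\<in>I. monom (xd i (x j)) (N ^ i)) = (\<Sum>i\<in>I. if i = j then monom 1 (N ^ i) else 0)"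
    by (intro sum.cong) (auto simp: xd_x j)
  then show ?thesis using j finite_I by (simp add: kron_sym_of)
qed

lemma kron_emon: "set_mset m \<subseteq> I \<Longrightarrow> kron N (emon m) = monom 1 (kweight N m)"
  by (induction m) (simp_all add: emon_def kweight_def kron_one kron_mult kron_x mult_monom)

lemma smon_in_zspan: "smon k \<in> zspan (emon ` {m. set_mset m \<subseteq> I \<and> size m = size k})"
proof (induction k)
  case empty
  show ?case by (rule zmod.span_base) (auto simp: emon_def intro!: image_eqI[of _ _ "{#}"])
next
  case (add u k)
  have "sym_of u * z \<in> zspan (emon ` {m. set_mset m \<subseteq> I \<and> size m = Suc (size k)})"
    if "z \<in> zspan (emon ` {m. set_mset m \<subseteq> I \<and> size m = size k})" for z
  proof (rule zspan_image_subset[OF zhom_mult_left that zmod.subspace_span])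
    fix s assume "s \<in> emon ` {m. set_mset m \<subseteq> I \<and> size m = size k}"
    then obtain m where m: "s = emon m" "set_mset m \<subseteq> I" "size m = size k" by blast
    have "sym_of u = (\<Sum>i\<in>I. zmul (xd i u) (sym_of (x i)))"
      by (subst x_span[of u, symmetric])
        (simp add: zhom_sum[OF additive_sym_of] zhom_zmul[OF additive_sym_of])
    then have "sym_of u * s = (\<Sum>i\<in>I. zmul (xd i u) (emon (add_mset i m)))"
      by (simp add: m(1) emon_def sum_distrib_right zmul_ring mult.assoc)
    also have "\<dots> \<in> zspan (emon ` {m. set_mset m \<subseteq> I \<and> size m = Suc (size k)})"
      by (intro zmod.span_sum zmod.span_scale zmod.span_base imageI) (use m in auto)
    finally show "sym_of u * s \<in> zspan (emon ` {m. set_mset m \<subseteq> I \<and> size m = Suc (size k)})" .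
  qed
  with add show ?case by simp
qed

lemma sym_pow_emon:
  assumes "z \<in> sym_pow UNIV b"
  shows "z \<in> zspan (emon ` {m. set_mset m \<subseteq> I \<and> size m = b})"
  by (rule sym_pow_induct[OF assms zhom_ident(1) zmod.subspace_span]) (use smon_in_zspan in auto)

lemma sym_emon: "z \<in> zspan (emon ` {m. set_mset m \<subseteq> I})"
proof (rule zspan_image_subset[OF zhom_ident(1) sym_induct_products zmod.subspace_span])
  fix s :: "'u sym" assume "s \<in> range smon"
  then obtain k where "s = smon k" by blast
  then show "s \<in> zspan (emon ` {m. set_mset m \<subseteq> I})"
    using smon_in_zspan[of k] by (metis (no_types, lifting) Collect_mono image_mono subsetD zmod.span_mono)
qed

lemma coeff_kron_sum:
  assumes "finite F" "F \<subseteq> {m. set_mset m \<subseteq> I}" "\<And>m. m \<in> F \<Longrightarrow> size m < N" "m0 \<in> F"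
  shows "coeff (kron N (\<Sum>m\<in>F. zmul (a m) (emon m))) (kweight N m0) = a m0"
proof -
  have z: "zhom (\<lambda>p. coeff p (kweight N m0) :: int)" by (simp add: additive_def)
  have "coeff (kron N (\<Sum>m\<in>F. zmul (a m) (emon m))) (kweight N m0)
      = (\<Sum>m\<in>F. a m * coeff (kron N (emon m)) (kweight N m0))"
    by (simp add: zhom_sum[OF zhom_comp[OF z zhom_kron]] zhom_zmul[OF zhom_comp[OF z zhom_kron]])
  also have "\<dots> = (\<Sum>m\<in>F. if m = m0 then a m else 0)"
  proof (intro sum.cong refl)
    fix m assume "m \<in> F"
    then show "a m * coeff (kron N (emon m)) (kweight N m0) = (if m = m0 then a m else 0)"
      using kweight_inject[of m N m0] assms by (auto simp: kron_emon subset_iff)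
  qed
  also have "\<dots> = a m0" using assms by simp
  finally show ?thesis .
qed

lemma emon_sum_zero:
  assumes F: "finite F" "F \<subseteq> {m. set_mset m \<subseteq> I}" and z: "(\<Sum>m\<in>F. zmul (a m) (emon m)) = 0"
    and m: "m \<in> F"
  shows "a m = 0"
proof -
  have "size m' < Suc (\<Sum>m\<in>F. size m)" if "m' \<in> F" for m'
    using member_le_sum[OF that, of size] F(1) by simp
  from coeff_kron_sum[OF F this m, of a] show ?thesis by (simp add: z zhom_zero[OF zhom_kron])
qed

lemma emon_inj: "inj_on emon {m. set_mset m \<subseteq> I}"
proof (rule inj_onI, rule ccontr)
  fix m m' assume m: "m \<in> {m. set_mset m \<subseteq> I}" "m' \<in> {m. set_mset m \<subseteq> I}" "emon m = emon m'" "m \<noteq> m'"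
  have "(\<Sum>k\<in>{m, m'}. zmul (if k = m then 1 else - 1) (emon k)) = 0"
    using m(3,4) by (simp add: zmod.scale_minus_left)
  from emon_sum_zero[OF _ _ this, of m] m show False by simp
qed

text \<open>The monomials form a basis of \<open>Sym U\<close>.\<close>

lemma emon_zfree_ring: "zfree_ring (emon ` {m. set_mset m \<subseteq> I})"
proof
  show "zspan (emon ` {m. set_mset m \<subseteq> I}) = UNIV" using sym_emon by blast
  show "\<not> zmod.dependent (emon ` {m. set_mset m \<subseteq> I})"
  proof
    assume "zmod.dependent (emon ` {m. set_mset m \<subseteq> I})"
    then obtain t u v where t: "finite t" "t \<subseteq> emon ` {m. set_mset m \<subseteq> I}"
      "(\<Sum>v\<in>t. zmul (u v) v) = 0" "v \<in> t" "u v \<noteq> 0"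
      by (auto simp: zmod.dependent_explicit)
    obtain F where F: "F \<subseteq> {m. set_mset m \<subseteq> I}" "t = emon ` F" using t(2) by (meson subset_imageE)
    have inj: "inj_on emon F" using inj_on_subset[OF emon_inj F(1)] .
    have "finite F" using t(1) inj F(2) finite_imageD by blast
    moreover have "(\<Sum>m\<in>F. zmul (u (emon m)) (emon m)) = 0"
      using t(3) by (simp add: F(2) sum.reindex[OF inj])
    ultimately have "\<forall>m\<in>F. u (emon m) = 0"
      using emon_sum_zero[of F "\<lambda>m. u (emon m)"] F(1) by blast
    with t(4,5) F(2) show False by blast
  qed
qed

lemma kron_eq_0:
  assumes "z = (\<Sum>m\<in>F. zmul (a m) (emon m))" "finite F" "F \<subseteq> {m. set_mset m \<subseteq> I}"
    "\<And>m. m \<in> F \<Longrightarrow> size m < N" "kron N z = 0"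
  shows "z = 0"
proof -
  have "a m = 0" if "m \<in> F" for m
    using coeff_kron_sum[OF assms(2,3,4) that, of a] assms(1,5) by simp
  then show ?thesis by (simp add: assms(1))
qed

text \<open>For \<open>N\<close> larger than all degrees that occur in two elements, \<open>kron N\<close> maps their vanishing product
  to a product in the integral domain of univariate polynomials.\<close>

lemma sym_no_zero_divisors:
  fixes r s :: "'u sym"
  assumes "r * s = 0"
  shows "r = 0 \<or> s = 0"
proof -
  obtain F a where F: "finite F" "F \<subseteq> {m. set_mset m \<subseteq> I}" "r = (\<Sum>m\<in>F. zmul (a m) (emon m))"
    by (rule zspan_image_sum[OF sym_emon[of r]])
  obtain G b where G: "finite G" "G \<subseteq> {m. set_mset m \<subseteq> I}" "s = (\<Sum>m\<in>G. zmul (b m) (emon m))"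
    by (rule zspan_image_sum[OF sym_emon[of s]])
  define N where "N = Suc ((\<Sum>m\<in>F. size m) + (\<Sum>m\<in>G. size m))"
  have N: "\<And>m. m \<in> F \<Longrightarrow> size m < N" "\<And>m. m \<in> G \<Longrightarrow> size m < N"
    using member_le_sum[of _ F size] member_le_sum[of _ G size] F(1) G(1)
    by (fastforce simp: N_def)+
  have "kron N r * kron N s = 0"
    using arg_cong[OF assms, of "kron N"] by (simp add: kron_mult zhom_zero[OF zhom_kron])
  then have "kron N r = 0 \<or> kron N s = 0" by simp
  then show ?thesis using kron_eq_0[OF F(3,1,2) N(1)] kron_eq_0[OF G(3,1,2) N(2)] by blast
qed

lemma finite_monomials: "finite {m. set_mset m \<subseteq> I \<and> size m = b}"
  using finite_multisets_of_size[OF finite_I, of b] by (simp add: multisets_of_size_def)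

lemma finitely_separated_sym_pow: "finitely_separated (sym_pow (UNIV :: 'u set) b)"
proof -
  let ?c = "\<lambda>m z. coeff (kron (Suc b) z) (kweight (Suc b) m)"
  let ?M = "{m. set_mset m \<subseteq> I \<and> size m = b}"
  have "zhom (?c m)" for m
    by (rule zhomI) (simp add: zhom_add[OF zhom_kron])
  moreover have "z = 0" if z: "z \<in> sym_pow UNIV b" and c: "\<forall>m\<in>?M. ?c m z = 0" for z
  proof -
    obtain F a where F: "finite F" "F \<subseteq> ?M" "z = (\<Sum>m\<in>F. zmul (a m) (emon m))"
      by (rule zspan_image_sum[OF sym_pow_emon[OF z]])
    have "?c m z = a m" if "m \<in> F" for m
      unfolding F(3) by (rule coeff_kron_sum[OF F(1) _ _ that]) (use F(2) in auto)
    then have "a m = 0" if "m \<in> F" for m using c F(2) that by (metis subsetD)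
    then show ?thesis by (simp add: F(3))
  qed
  ultimately show ?thesis
    unfolding finitely_separated_def
    by (intro exI[of _ "?c ` ?M"]) (simp add: finite_monomials)
qed

text \<open>An integral bilinear form \<open>(\<mu>, \<mu>') \<mapsto> \<phi> (\<mu> * \<mu>')\<close> that is positive definite on a graded piece:
  sum the products of the values at sufficiently many points.\<close>

lemma positive_definite_functional:
  obtains \<phi> :: "'u sym \<Rightarrow> int" where "zhom \<phi>"
    "\<And>\<mu>. \<mu> \<in> sym_pow UNIV b \<Longrightarrow> \<phi> (\<mu> * \<mu>) = 0 \<Longrightarrow> \<mu> = 0"
proof -
  let ?N = "Suc b" and ?M = "{m. set_mset m \<subseteq> I \<and> size m = b}"
  \<comment> \<open>The images under \<open>kron ?N\<close> have degree at most \<open>D\<close>, so they cannot vanish at all of \<open>0, \<dots>, D\<close>.\<close>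
  define D where "D = Max (insert 0 (kweight ?N ` ?M))"
  define \<phi> where "\<phi> \<mu> = (\<Sum>t\<in>{0..int D}. poly (kron ?N \<mu>) t)" for \<mu>
  have "zhom \<phi>" by (rule zhomI) (simp add: \<phi>_def zhom_add[OF zhom_kron] sum.distrib)
  moreover have "\<mu> = 0" if \<mu>: "\<mu> \<in> sym_pow UNIV b" "\<phi> (\<mu> * \<mu>) = 0" for \<mu>
  proof -
    let ?p = "kron ?N \<mu>"
    obtain F a where F: "finite F" "F \<subseteq> ?M" "\<mu> = (\<Sum>m\<in>F. zmul (a m) (emon m))"
      by (rule zspan_image_sum[OF sym_pow_emon[OF \<mu>(1)]])
    have "?p = (\<Sum>m\<in>F. zmul (a m) (monom 1 (kweight ?N m)))"
      using F(2) by (auto simp: F(3) zhom_sum[OF zhom_kron] zhom_zmul[OF zhom_kron] kron_emon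
          intro!: sum.cong)
    also have "degree \<dots> \<le> D"
    proof (rule degree_sum_le[OF F(1)])
      fix m assume "m \<in> F"
      then have "kweight ?N m \<le> D"
        unfolding D_def using F(2) finite_monomials by (intro Max_ge) auto
      then show "degree (zmul (a m) (monom 1 (kweight ?N m) :: int poly)) \<le> D"
        by (simp add: zmul_ring of_int_poly smult_monom degree_monom_eq
            order_trans[OF degree_monom_le])
    qed
    finally have deg: "degree ?p \<le> D" .
    have "(\<Sum>t\<in>{0..int D}. (poly ?p t)\<^sup>2) = 0"
      using \<mu>(2) by (simp add: \<phi>_def kron_mult power2_eq_square)
    then have "\<forall>t\<in>{0..int D}. poly ?p t = 0"
      by (simp add: sum_nonneg_eq_0_iff)
    then have roots: "{0..int D} \<subseteq> {t. poly ?p t = 0}" by blast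
    have "?p = 0"
    proof (rule ccontr)
      assume p: "?p \<noteq> 0"
      have "card {0..int D} \<le> card {t. poly ?p t = 0}"
        by (rule card_mono[OF poly_roots_finite[OF p] roots])
      also have "\<dots> \<le> degree ?p" by (rule card_poly_roots_bound[OF p])
      finally show False using deg by simp
    qed
    then show ?thesis by (intro kron_eq_0[OF F(3,1)]) (use F(2) in auto)
  qed
  ultimately show thesis using that by blast
qed

end

text \<open>A finite basis provides coordinates.\<close>

lemma finitely_separated_dual_bases:
  assumes "finitely_separated (UNIV :: 'a::ab_group_add set)"
  obtains I and x :: "nat \<Rightarrow> 'a::ab_group_add" and xd where "dual_bases I x xd"
proof -
  obtain E :: "'a set" where E: "finite E" "\<not> zmod.dependent E" "zspan E = UNIV"
    by (rule finitely_separated_basis[OF assms zmod.subspace_UNIV])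
  obtain h where h: "bij_betw h {..<card E} E"
    using ex_bij_betw_nat_finite[OF E(1)] by (auto simp: atLeast0LessThan)
  let ?xd = "\<lambda>i u. zmod.representation E u (h i)"
  have hE: "h i \<in> E" if "i \<in> {..<card E}" for i using h that by (rule bij_betwE[THEN bspec])
  have "dual_bases {..<card E} h ?xd"
  proof (rule dual_bases.intro)
    show "zhom (?xd i)" for i
      by (rule zhomI) (simp add: zmod.representation_add E)
    show "?xd i (h j) = (if i = j then 1 else 0)" if "i \<in> {..<card E}" "j \<in> {..<card E}" for i j
      using that hE[OF that(2)] bij_betw_imp_inj_on[OF h]
      by (auto simp: zmod.representation_basis E(2) inj_on_eq_iff)
    show "(\<Sum>i<card E. zmul (?xd i u) (h i)) = u" for u
    proof -
      have "(\<Sum>i<card E. zmul (?xd i u) (h i)) = (\<Sum>v\<in>E. zmul (zmod.representation E u v) v)"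
        by (rule sum.reindex_bij_betw[OF h])
      also have "\<dots> = u" by (rule zmod.sum_representation_eq) (simp_all add: E)
      finally show ?thesis .
    qed
  qed simp
  then show thesis by (rule that)
qed

lemma finitely_separated_tens_span:
  fixes A :: "'a::ab_group_add set" and B :: "'b::ab_group_add set"
  assumes A: "finitely_separated A" "zmod.subspace A" and B: "finitely_separated B" "zmod.subspace B"
  shows "finitely_separated (tens_span A B)"
proof -
  obtain C where C: "finite C" "\<forall>c\<in>C. zhom c" "\<forall>a\<in>A. (\<forall>c\<in>C. c a = (0::int)) \<longrightarrow> a = 0"
    using A(1) unfolding finitely_separated_def by blast
  obtain D where D: "finite D" "\<forall>c\<in>D. zhom c" "\<forall>b\<in>B. (\<forall>c\<in>D. c b = (0::int)) \<longrightarrow> b = 0"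
    using B(1) unfolding finitely_separated_def by blast
  obtain E where E: "finite E" "\<not> zmod.dependent E" "zspan E = A"
    by (rule finitely_separated_basis[OF A])
  have EA: "e \<in> A" if "e \<in> E" for e using E(3) that zmod.span_base by blast
  define cd where "cd c c' = tensor_lift (\<lambda>a b. c a * c' b :: int)" for c :: "'a \<Rightarrow> int" and c' :: "'b \<Rightarrow> int"
  have cd: "zhom (cd c c')" "cd c c' (a \<otimes>\<^sub>t b) = c a * c' b" if "zhom c" "zhom c'" for c c' a b
  proof -
    have "biadditive (\<lambda>a b. c a * c' b :: int)"
      using that by (simp add: biadditive_def additive_def algebra_simps)
    from additive_tensor_lift[OF this] tensor_lift_tens[OF this]
    show "zhom (cd c c')" "cd c c' (a \<otimes>\<^sub>t b) = c a * c' b" by (simp_all add: cd_def)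
  qed
  have "z = 0" if z: "z \<in> tens_span A B" and 0: "\<forall>c\<in>C. \<forall>c'\<in>D. cd c c' z = 0" for z
  proof -
    let ?S = "{z. \<exists>y. (\<forall>e\<in>E. y e \<in> B) \<and> z = (\<Sum>e\<in>E. e \<otimes>\<^sub>t y e)}"
    have "zmod.subspace ?S"
      unfolding zmod.subspace_def
    proof (safe, goal_cases)
      case 1 show ?case
        by (rule exI[of _ "\<lambda>_. 0"]) (simp add: tens_simps zmod.subspace_0[OF B(2)])
    next
      case (2 _ _ y y') then show ?case
        by (intro exI[of _ "\<lambda>e. y e + y' e"]) (simp add: tens_simps sum.distrib zmod.subspace_add[OF B(2)])
    next
      case (3 c _ y) then show ?case
        by (intro exI[of _ "\<lambda>e. zmul c (y e)"])
           (simp add: tens_zmul zmod.scale_sum_right zmod.subspace_scale[OF B(2)])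
    qed
    moreover have "a \<otimes>\<^sub>t b \<in> ?S" if ab: "a \<in> A" "b \<in> B" for a b
    proof -
      obtain k where "a = (\<Sum>e\<in>E. zmul (k e) e)" using zspan_finite_sum[OF E(1)] E(3) ab(1) by metis
      then show ?thesis
        by (intro CollectI exI[of _ "\<lambda>e. zmul (k e) b"])
           (simp add: tens_sum tens_zmul zmod.subspace_scale[OF B(2)] ab)
    qed
    ultimately have "z \<in> ?S"
      using zspan_image_subset[OF zhom_ident(1) z[unfolded tens_span_def]] by blast
    then obtain y where y: "\<forall>e\<in>E. y e \<in> B" "z = (\<Sum>e\<in>E. e \<otimes>\<^sub>t y e)" by blast
    have "c' (y e) = 0" if c': "c' \<in> D" and e: "e \<in> E" for c' e
    proof (rule independent_sum_zero[OF E(1,2) _ e])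
      have "(\<Sum>e\<in>E. zmul (c' (y e)) e) \<in> A"
        by (intro zmod.subspace_sum[OF A(2)] zmod.subspace_scale[OF A(2)] EA)
      moreover have "c (\<Sum>e\<in>E. zmul (c' (y e)) e) = 0" if c: "c \<in> C" for c
      proof -
        have zc: "zhom c" "zhom c'" using c c' C(2) D(2) by auto
        have "c (\<Sum>e\<in>E. zmul (c' (y e)) e) = cd c c' z"
          by (simp add: y(2) zhom_sum[OF cd(1)] zhom_sum[OF zc(1)] zhom_zmul[OF zc(1)] cd(2) zc mult.commute)
        then show ?thesis using 0 c c' by simp
      qed
      ultimately show "(\<Sum>e\<in>E. zmul (c' (y e)) e) = 0" using C(3) by blast
    qed
    then have "y e = 0" if "e \<in> E" for e using D(3) y(1) that by blast
    then show ?thesis by (simp add: y(2) tens_simps)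
  qed
  then show ?thesis
    unfolding finitely_separated_def
    by (intro exI[of _ "(\<lambda>(c, c'). cd c c') ` (C \<times> D)"]) (use C D cd(1) in auto)
qed

section \<open>Divided powers with coefficients\<close>

lemma zhom_dapply: "zhom (dapply \<nu>)"
  using dapply[of \<nu>] by simp

lemma zhom_dapply_left: "zhom (\<lambda>\<nu>. dapply \<nu> \<mu>)"
  by (rule zhomI) (simp add: plus_dpow.rep_eq)

lemma zhom_contract: "zhom (contract \<mu>)"
  by (unfold additive_def, transfer) (simp add: fun_eq_iff)

lemma dpow_eqI: "(\<And>\<mu>. dapply \<nu> \<mu> = dapply \<nu>' \<mu>) \<Longrightarrow> \<nu> = \<nu>'"
  using dapply_inject by blast

lemma dpow_deg_subspace: "zmod.subspace (dpow_deg b)"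
  unfolding zmod.subspace_def dpow_deg_def
  by (simp add: plus_dpow.rep_eq zero_dpow.rep_eq zhom_zmul[OF zhom_dapply_left])

lemma dpow_degD: "\<nu> \<in> dpow_deg b \<Longrightarrow> \<mu> \<in> sym_pow UNIV c \<Longrightarrow> c \<noteq> b \<Longrightarrow> dapply \<nu> \<mu> = 0"
  by (auto simp: dpow_deg_def)

lemma contract_mult: "contract \<mu> (contract \<mu>' \<nu>) = contract (\<mu>' * \<mu>) \<nu>"
  by (rule dpow_eqI) (simp add: contract.rep_eq mult.assoc)

lemma zhom_contract_left: "zhom (\<lambda>\<mu>. contract \<mu> \<nu>)"
  by (rule zhomI, rule dpow_eqI)
     (simp add: contract.rep_eq plus_dpow.rep_eq distrib_right zhom_add[OF zhom_dapply])

lemma dapply_bound: "\<exists>N. \<forall>b>N. \<forall>\<mu>\<in>sym_pow UNIV b. dapply \<nu> \<mu> = 0"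
  using dapply[of \<nu>] by simp

lemma dapply_Abs:
  assumes "zhom g" "\<And>b \<mu>. b > N \<Longrightarrow> \<mu> \<in> sym_pow UNIV b \<Longrightarrow> g \<mu> = 0"
  shows "dapply (Abs_dpow g) \<mu> = g \<mu>"
proof -
  have "dapply (Abs_dpow g) = g" by (rule Abs_dpow_inverse) (use assms in blast)
  then show ?thesis by simp
qed

lemma zhom_dpow_fun:
  assumes "\<And>\<nu> \<mu>. dapply (h \<nu>) \<mu> = dapply \<nu> (k \<mu>)"
  shows "zhom h"
  by (rule zhomI, rule dpow_eqI) (simp add: assms plus_dpow.rep_eq)

text \<open>The homogeneous component of degree \<open>b\<close> of an element of \<open>D(U\<^sup>*)\<close>\<close>

definition dpow_comp :: "nat \<Rightarrow> 'u::ab_group_add dpow \<Rightarrow> 'u dpow" where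
  "dpow_comp b \<nu> = Abs_dpow (\<lambda>\<mu>. dapply \<nu> (sym_comp b \<mu>))"

lemma dapply_dpow_comp: "dapply (dpow_comp b \<nu>) \<mu> = dapply \<nu> (sym_comp b \<mu>)"
  unfolding dpow_comp_def
  by (rule dapply_Abs[of _ b]) (auto simp: zhom_comp[OF zhom_dapply zhom_sym_comp]
      sym_comp_homogeneous zhom_zero[OF zhom_dapply])

lemma dpow_comp_in_dpow_deg: "dpow_comp b \<nu> \<in> dpow_deg b"
  by (auto simp: dpow_deg_def dapply_dpow_comp sym_comp_homogeneous zhom_zero[OF zhom_dapply])

lemma dpow_decomposition:
  fixes \<nu> :: "'u::ab_group_add dpow"
  obtains N where "\<nu> = (\<Sum>b\<le>N. dpow_comp b \<nu>)"
proof -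
  obtain N where N: "\<forall>b>N. \<forall>\<mu>\<in>sym_pow UNIV b. dapply \<nu> \<mu> = 0" using dapply_bound by blast
  have "\<nu> = (\<Sum>b\<le>N. dpow_comp b \<nu>)"
  proof (rule dpow_eqI)
    fix \<mu> :: "'u sym"
    let ?M = "max N (degree (grade \<mu>))"
    have "dapply \<nu> \<mu> = dapply \<nu> (\<Sum>b\<le>?M. sym_comp b \<mu>)" by (simp add: sum_sym_comp)
    also have "\<dots> = (\<Sum>b\<le>?M. dapply \<nu> (sym_comp b \<mu>))" by (rule zhom_sum[OF zhom_dapply])
    also have "\<dots> = (\<Sum>b\<le>N. dapply \<nu> (sym_comp b \<mu>))"
      by (rule sum.mono_neutral_right) (auto intro: N[rule_format, OF _ sym_comp_in_sym_pow])
    finally show "dapply \<nu> \<mu> = dapply (\<Sum>b\<le>N. dpow_comp b \<nu>) \<mu>"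
      by (simp add: zhom_sum[OF zhom_dapply_left] dapply_dpow_comp)
  qed
  then show thesis by (rule that)
qed

text \<open>The transposes of \<open>del\<close> and \<open>rho\<close>\<close>

context splitting
begin

definition ddel :: "'u dpow \<Rightarrow> 'u dpow" where
  "ddel \<nu> = Abs_dpow (\<lambda>\<mu>. dapply \<nu> (del \<mu>))"

definition drho :: "'u dpow \<Rightarrow> 'u dpow" where
  "drho \<nu> = Abs_dpow (\<lambda>\<mu>. dapply \<nu> (rho \<mu>))"

lemma dapply_ddel: "dapply (ddel \<nu>) \<mu> = dapply \<nu> (del \<mu>)"
proof -
  obtain N where N: "\<forall>b>N. \<forall>\<mu>\<in>sym_pow UNIV b. dapply \<nu> \<mu> = 0" using dapply_bound by blast
  show ?thesis
    unfolding ddel_def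
  proof (rule dapply_Abs[of _ "Suc N"])
    fix b and \<mu> :: "'u sym" assume "b > Suc N" "\<mu> \<in> sym_pow UNIV b"
    then show "dapply \<nu> (del \<mu>) = 0" 
      using N[rule_format, of "b - 1" "del \<mu>"] del_in_sym_pow[of \<mu> "b - 1"] by simp
  qed (rule zhom_comp[OF zhom_dapply zhom_del])
qed

lemma rho_sym_pow_UNIV: "\<mu> \<in> sym_pow UNIV b \<Longrightarrow> rho \<mu> \<in> sym_pow UNIV b"
  using rho_in_sym_pow sym_pow_mono[of "{u. f u = 0}" UNIV] by blast

lemma dapply_drho: "dapply (drho \<nu>) \<mu> = dapply \<nu> (rho \<mu>)"
proof -
  obtain N where N: "\<forall>b>N. \<forall>\<mu>\<in>sym_pow UNIV b. dapply \<nu> \<mu> = 0" using dapply_bound by blast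
  show ?thesis
    unfolding drho_def
    by (rule dapply_Abs[of _ N]) (use N rho_sym_pow_UNIV zhom_comp[OF zhom_dapply zhom_rho] in auto)
qed

lemmas zhom_ddel = zhom_dpow_fun[of ddel, OF dapply_ddel]
  and zhom_drho = zhom_dpow_fun[of drho, OF dapply_drho]

lemma dpow_split: "drho \<nu> + ddel (contract (sym_of e) \<nu>) = \<nu>"
proof (rule dpow_eqI)
  fix \<mu>
  have "dapply \<nu> (rho \<mu>) + dapply \<nu> (sym_of e * del \<mu>) = dapply \<nu> \<mu>"
    by (simp add: rho_del flip: zhom_add[OF zhom_dapply])
  then show "dapply (drho \<nu> + ddel (contract (sym_of e) \<nu>)) \<mu> = dapply \<nu> \<mu>"
    by (simp add: plus_dpow.rep_eq dapply_ddel dapply_drho contract.rep_eq)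
qed

lemma drho_in_dpow_deg0:
  assumes "\<nu> \<in> dpow_deg b"
  shows "drho \<nu> \<in> dpow_deg0 e b"
proof -
  have "contract (sym_of e) (drho \<nu>) = 0"
    by (rule dpow_eqI)
       (simp add: contract.rep_eq dapply_drho rho_mult rho_e zero_dpow.rep_eq zhom_zero[OF zhom_dapply])
  moreover have "drho \<nu> \<in> dpow_deg b"
    using dpow_degD[OF assms rho_sym_pow_UNIV] by (auto simp: dpow_deg_def dapply_drho)
  ultimately show ?thesis by (simp add: dpow_deg0_def)
qed

end

lemma contract_in_dpow_deg:
  assumes "\<mu> \<in> sym_pow UNIV a" "\<nu> \<in> dpow_deg (a + b)"
  shows "contract \<mu> \<nu> \<in> dpow_deg b"
  using dpow_degD[OF assms(2) sym_pow_mult[OF assms(1)]] by (auto simp: dpow_deg_def contract.rep_eq)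

lemma biadditive_reval: "biadditive (\<lambda>r \<nu>. r * of_int (dapply \<nu> \<mu>) :: 'r::comm_ring_1)"
  by (simp add: biadditive_def additive_def plus_dpow.rep_eq algebra_simps)

lemma zhom_reval: "zhom (\<lambda>\<phi>. reval \<phi> \<mu>)"
  unfolding reval_def by (rule additive_tensor_lift[OF biadditive_reval])

lemma reval_tens: "reval (r \<otimes>\<^sub>t \<nu>) \<mu> = r * of_int (dapply \<nu> \<mu>)"
  unfolding reval_def by (rule tensor_lift_tens[OF biadditive_reval])

lemma zhom_reval_right: "zhom (reval \<phi>)"
proof (rule zhomI)
  fix a b
  show "reval \<phi> (a + b) = reval \<phi> a + reval \<phi> b"
    by (rule tensor_zhom_eqI[OF zhom_reval zhom_plus[OF zhom_reval zhom_reval]])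
       (simp add: reval_tens zhom_add[OF zhom_dapply] distrib_left)
qed

lemma reval_tscale: "reval (tscale r \<phi>) \<mu> = r * reval \<phi> \<mu>"
  by (rule tensor_zhom_eqI[OF zhom_comp[OF zhom_reval zhom_tscale] zhom_comp[OF zhom_mult_left zhom_reval]])
     (simp add: tscale_tens reval_tens mult.assoc)

lemma reval_rmap:
  assumes "\<And>\<nu> \<mu>. dapply (h \<nu>) \<mu> = dapply \<nu> (k \<mu>)"
  shows "reval (rmap h \<phi>) \<mu> = reval \<phi> (k \<mu>)"
  by (rule tensor_zhom_eqI[OF zhom_comp[OF zhom_reval zhom_rmap[OF zhom_dpow_fun[OF assms]]] zhom_reval])
     (simp add: rmap_tens[OF zhom_dpow_fun[OF assms]] reval_tens assms)

lemma reval_rcontract: "reval (rcontract \<mu> \<phi>) \<mu>' = reval \<phi> (\<mu> * \<mu>')"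
  unfolding rcontract_def by (rule reval_rmap) (simp add: contract.rep_eq)

lemma zhom_rcontract: "zhom (rcontract \<mu>)"
  unfolding rcontract_def by (intro zhom_rmap zhom_contract)

lemma rcontract_tens: "rcontract \<mu> (r \<otimes>\<^sub>t \<nu>) = r \<otimes>\<^sub>t contract \<mu> \<nu>"
  unfolding rcontract_def by (intro rmap_tens zhom_contract)

lemma zhom_rcontract_left:
  fixes \<phi> :: "('r::comm_ring_1, 'u::ab_group_add dpow) tensor"
  shows "zhom (\<lambda>\<mu>. rcontract \<mu> \<phi>)"
proof (rule zhomI)
  fix a b :: "'u sym"
  show "rcontract (a + b) \<phi> = rcontract a \<phi> + rcontract b \<phi>"
    by (rule tensor_zhom_eqI[OF zhom_rcontract zhom_plus[OF zhom_rcontract zhom_rcontract]])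
       (simp add: rcontract_tens zhom_add[OF zhom_contract_left] tens_simps)
qed

lemma rcontract_mult: "rcontract \<mu> (rcontract \<mu>' \<phi>) = rcontract (\<mu>' * \<mu>) \<phi>"
  by (rule tensor_zhom_eqI[OF zhom_comp[OF zhom_rcontract zhom_rcontract] zhom_rcontract])
     (simp add: rcontract_tens contract_mult)

lemma reval_degree:
  assumes "\<phi> \<in> base_change (dpow_deg b)" "\<mu> \<in> sym_pow UNIV c" "c \<noteq> b"
  shows "reval \<phi> \<mu> = 0"
  by (rule base_change_eqI[OF assms(1) zhom_reval zhom_const_zero])
     (simp add: reval_tens dpow_degD[OF _ assms(2,3)])

lemma reval_components:
  assumes "\<And>b. reval \<phi> (sym_comp b \<mu>) = 0"
  shows "reval \<phi> \<mu> = 0"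
proof -
  have "reval \<phi> \<mu> = reval \<phi> (\<Sum>b\<le>degree (grade \<mu>). sym_comp b \<mu>)" by (simp add: sum_sym_comp)
  also have "\<dots> = 0" by (simp add: zhom_sum[OF zhom_reval_right] assms)
  finally show ?thesis .
qed

context zfree_ring
begin

lemma dapply_tcoord:
  fixes \<phi> :: "('r, 'u::ab_group_add dpow) tensor"
  shows "dapply (tcoord b \<phi>) \<mu> = rcoord b (reval \<phi> \<mu>)"
proof (rule tensor_zhom_eqI[OF zhom_comp[OF zhom_dapply_left zhom_tcoord] zhom_comp[OF zhom_rcoord zhom_reval]])
  fix r :: 'r and \<nu> :: "'u dpow"
  have "r * of_int (dapply \<nu> \<mu>) = zmul (dapply \<nu> \<mu>) r" by (simp add: zmul_ring mult.commute)
  then show "dapply (tcoord b (r \<otimes>\<^sub>t \<nu>)) \<mu> = rcoord b (reval (r \<otimes>\<^sub>t \<nu>) \<mu>)"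
    by (simp add: tcoord_tens zhom_zmul[OF zhom_dapply_left] reval_tens zhom_zmul[OF zhom_rcoord])
qed

text \<open>An element of \<open>R \<otimes> D(U\<^sup>*)\<close> is determined by its values on \<open>Sym U\<close>.\<close>

lemma reval_eqI:
  fixes \<phi> \<psi> :: "('r, 'u::ab_group_add dpow) tensor"
  assumes "\<And>\<mu>. reval \<phi> \<mu> = reval \<psi> \<mu>"
  shows "\<phi> = \<psi>"
proof -
  have "\<phi> - \<psi> = 0"
    by (rule tcoord_eq_0, rule dpow_eqI)
       (simp add: dapply_tcoord zhom_diff[OF zhom_reval] assms zhom_zero[OF zhom_rcoord] zero_dpow.rep_eq)
  then show ?thesis by simp
qed

lemma base_change_dpow_degI:
  fixes \<phi> :: "('r, 'u::ab_group_add dpow) tensor"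
  assumes "\<And>c \<mu>. c \<noteq> b \<Longrightarrow> \<mu> \<in> sym_pow UNIV c \<Longrightarrow> reval \<phi> \<mu> = 0"
  shows "\<phi> \<in> base_change (dpow_deg b)"
  unfolding base_change_iff_tcoord[OF dpow_deg_subspace]
  by (simp add: dpow_deg_def dapply_tcoord assms zhom_zero[OF zhom_rcoord])

lemma reval_eqI_degree:
  fixes \<phi> \<psi> :: "('r, 'u::ab_group_add dpow) tensor"
  assumes "\<phi> \<in> base_change (dpow_deg b)" "\<psi> \<in> base_change (dpow_deg b)"
    "\<And>\<mu>. \<mu> \<in> sym_pow UNIV b \<Longrightarrow> reval \<phi> \<mu> = reval \<psi> \<mu>"
  shows "\<phi> = \<psi>"
proof (rule reval_eqI)
  fix \<mu> :: "'u sym"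
  have "reval \<phi> (sym_comp c \<mu>) = reval \<psi> (sym_comp c \<mu>)" for c
    using assms(3)[OF sym_comp_in_sym_pow] reval_degree[OF assms(1) sym_comp_in_sym_pow, of c \<mu>]
      reval_degree[OF assms(2) sym_comp_in_sym_pow, of c \<mu>] by (cases "c = b") simp_all
  then have "reval (\<phi> - \<psi>) (sym_comp c \<mu>) = 0" for c by (simp add: zhom_diff[OF zhom_reval])
  then have "reval (\<phi> - \<psi>) \<mu> = 0" by (rule reval_components)
  then show "reval \<phi> \<mu> = reval \<psi> \<mu>" by (simp add: zhom_diff[OF zhom_reval])
qed

lemma rcontract_in_base_change:
  fixes \<phi> :: "('r, 'u::ab_group_add dpow) tensor"
  assumes "\<phi> \<in> base_change (dpow_deg (a + b))" "\<mu> \<in> sym_pow UNIV a"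
  shows "rcontract \<mu> \<phi> \<in> base_change (dpow_deg b)"
  unfolding rcontract_def
  by (rule rmap_in_base_change[OF zhom_contract assms(1)]) (rule contract_in_dpow_deg[OF assms(2)])

end

lemma dpow_deg0_subspace: "zmod.subspace (dpow_deg0 e b)"
  unfolding dpow_deg0_def by (rule subspace_ker[OF zhom_contract dpow_deg_subspace])

context dual_bases
begin

lemma sym_pow_basis:
  obtains E :: "'u sym set"
  where "finite E" "\<not> zmod.dependent E" "zspan E = sym_pow UNIV b"
  by (rule finitely_separated_basis[OF finitely_separated_sym_pow sym_pow_subspace])

text \<open>\<open>R \<otimes> D\<^sub>b(U\<^sup>*)\<close> is the group of all additive maps from \<open>Sym\<^sub>b U\<close> to \<open>R\<close>.\<close>

lemma reval_exists:
  fixes g :: "'u sym \<Rightarrow> 'r::comm_ring_1"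
  assumes g: "zhom g"
  obtains \<phi> where "\<phi> \<in> base_change (dpow_deg b)" "\<And>\<mu>. \<mu> \<in> sym_pow UNIV b \<Longrightarrow> reval \<phi> \<mu> = g \<mu>"
proof -
  obtain E :: "'u sym set" where E: "finite E" "\<not> zmod.dependent E" "zspan E = sym_pow UNIV b"
    by (rule sym_pow_basis)
  let ?r = "\<lambda>e \<mu>. zmod.representation E (sym_comp b \<mu>) e"
  let ?e = "\<lambda>e. Abs_dpow (?r e)"
  have e: "dapply (?e e) \<mu> = ?r e \<mu>" for e \<mu>
  proof (rule dapply_Abs[of _ b])
    show "zhom (?r e)"
      by (rule zhomI) (simp add: zhom_add[OF zhom_sym_comp] zmod.representation_add E sym_comp_in_sym_pow)
  qed (simp add: sym_comp_homogeneous zmod.representation_zero)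
  have "?e e \<in> dpow_deg b" for e
    by (auto simp: dpow_deg_def e sym_comp_homogeneous zmod.representation_zero)
  then have "(\<Sum>e\<in>E. g e \<otimes>\<^sub>t ?e e) \<in> base_change (dpow_deg b)"
    by (intro zmod.subspace_sum[OF base_change_subspace] tens_in_base_change)
  moreover have "reval (\<Sum>e\<in>E. g e \<otimes>\<^sub>t ?e e) \<mu> = g \<mu>" if \<mu>: "\<mu> \<in> sym_pow UNIV b" for \<mu>
  proof -
    have "reval (\<Sum>e\<in>E. g e \<otimes>\<^sub>t ?e e) \<mu> = (\<Sum>e\<in>E. zmul (zmod.representation E \<mu> e) (g e))"
      by (simp add: zhom_sum[OF zhom_reval] reval_tens e sym_comp_homogeneous[OF \<mu>] zmul_ring mult.commute)
    also have "\<dots> = g (\<Sum>e\<in>E. zmul (zmod.representation E \<mu> e) e)"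
      by (simp add: zhom_sum[OF g] zhom_zmul[OF g])
    also have "(\<Sum>e\<in>E. zmul (zmod.representation E \<mu> e) e) = \<mu>"
      by (rule zmod.sum_representation_eq) (simp_all add: E \<mu>)
    finally show ?thesis .
  qed
  ultimately show thesis by (rule that)
qed

lemma finitely_separated_dpow_deg: "finitely_separated (dpow_deg b :: 'u dpow set)"
proof -
  obtain E :: "'u sym set" where E: "finite E" "\<not> zmod.dependent E" "zspan E = sym_pow UNIV b"
    by (rule sym_pow_basis)
  have "\<nu> = 0" if \<nu>: "\<nu> \<in> dpow_deg b" and 0: "\<forall>e\<in>E. dapply \<nu> e = 0" for \<nu>
  proof -
    have b: "dapply \<nu> \<mu> = 0" if "\<mu> \<in> sym_pow UNIV b" for \<mu>
      by (rule additive_eq_on_zspan[OF zhom_dapply zhom_const_zero, of E]) (use 0 E(3) that in auto)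
    obtain N where "\<nu> = (\<Sum>c\<le>N. dpow_comp c \<nu>)" by (rule dpow_decomposition)
    moreover have "dpow_comp c \<nu> = 0" for c
    proof (rule dpow_eqI)
      fix \<mu>
      have "dapply \<nu> (sym_comp c \<mu>) = 0"
        using b[OF sym_comp_in_sym_pow] dpow_degD[OF \<nu> sym_comp_in_sym_pow, of c]
        by (cases "c = b") simp_all
      then show "dapply (dpow_comp c \<nu>) \<mu> = dapply 0 \<mu>" by (simp add: dapply_dpow_comp zero_dpow.rep_eq)
    qed
    ultimately show ?thesis by simp
  qed
  then show ?thesis
    unfolding finitely_separated_def
    by (intro exI[of _ "(\<lambda>e \<nu>. dapply \<nu> e) ` E"]) (auto simp: E(1) zhom_dapply_left)
qed

end

section \<open>The generic inverse system\<close>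

text \<open>The standing assumptions: \<open>x 1, \<dots>, x d\<close> is a basis of \<open>U\<close> with dual basis \<open>xd 1, \<dots>, xd d\<close>, and \<open>ms\<close>
  is a basis of \<open>Sym\<^bsub>n-1\<^esub> U\<close>. The parameter \<open>N\<close> serves only to fix the type \<open>'n\<close> with \<open>n\<close> elements.\<close>

locale inverse_system = dual_bases "{1..d}" x xd
  for d :: nat and x :: "nat \<Rightarrow> 'u::ab_group_add" and xd :: "nat \<Rightarrow> 'u \<Rightarrow> int" +
  fixes ms :: "'u sym list" and N :: "'n::finite itself"
  assumes d: "1 \<le> d"
    and n: "2 \<le> CARD('n)"
    and ms: "zbasis {..<length ms} ((!) ms) (sym_pow (UNIV :: 'u set) (CARD('n) - 1))"
begin

declare One_nat_def [simp del]

sublocale one: splitting "x 1" "xd 1"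
  using splitting[of 1] d by simp

subsection \<open>The coefficient ring\<close>

lemma hsym_zhom: "zhom (sym_of_hsym :: ('u, 'n) hsym \<Rightarrow> 'u sym)"
  by (rule zhomI) (simp add: plus_hsym.rep_eq)

lemma finitely_separated_generators: "finitely_separated (UNIV :: ('u \<times> ('u, 'n) hsym) set)"
proof -
  obtain C :: "('u sym \<Rightarrow> int) set" where C: "finite C" "\<forall>c\<in>C. zhom c"
    "\<forall>a\<in>sym_pow UNIV (2 * CARD('n) - 2). (\<forall>c\<in>C. c a = 0) \<longrightarrow> a = 0"
    using finitely_separated_sym_pow[of "2 * CARD('n) - 2"] unfolding finitely_separated_def by blast
  let ?C1 = "(\<lambda>i (u, \<eta> :: ('u, 'n) hsym). xd i u) ` {1..d}"
  let ?C2 = "(\<lambda>c (u :: 'u, \<eta> :: ('u, 'n) hsym). c (sym_of_hsym \<eta>)) ` C"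
  have "zhom (\<lambda>(u, \<eta> :: ('u, 'n) hsym). xd i u)" if "i \<in> {1..d}" for i
    by (rule zhomI) (auto simp: zhom_add[OF zhom_xd[OF that]])
  moreover have "zhom (\<lambda>(u :: 'u, \<eta> :: ('u, 'n) hsym). c (sym_of_hsym \<eta>))" if "c \<in> C" for c
    by (rule zhomI) (auto simp: zhom_add[OF hsym_zhom] zhom_add[OF C(2)[rule_format, OF that]])
  moreover have "a = 0" if a: "\<forall>c\<in>?C1 \<union> ?C2. c a = 0" for a :: "'u \<times> ('u, 'n) hsym"
  proof -
    obtain u \<eta> where a': "a = (u, \<eta>)" by (cases a)
    have "\<forall>i\<in>{1..d}. xd i u = 0" and c: "\<forall>c\<in>C. c (sym_of_hsym \<eta>) = 0"
      using a by (simp_all add: a' ball_Un)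
    then have "u = 0" using x_span[of u] by simp
    moreover have "sym_of_hsym \<eta> = 0" using C(3) c sym_of_hsym[of \<eta>] by blast
    then have "\<eta> = 0" by (simp add: sym_of_hsym_inject[symmetric] zero_hsym.rep_eq)
    ultimately show ?thesis by (simp add: a' zero_prod_def)
  qed
  ultimately show ?thesis
    unfolding finitely_separated_def
    by (intro exI[of _ "?C1 \<union> ?C2"]) (auto simp: C(1) ball_Un)
qed

text \<open>Some basis of \<open>\<RR>\<close> over the integers; the monomials form one.\<close>

definition Rbasis :: "('u, 'n) RR set" where
  "Rbasis = (SOME Bs. zfree_ring Bs)"

sublocale R: zfree_ring Rbasis
proof -
  obtain I y and yd where "dual_bases I (y :: nat \<Rightarrow> 'u \<times> ('u, 'n) hsym) yd"
    by (rule finitely_separated_dual_bases[OF finitely_separated_generators])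
  then have "zfree_ring (dual_bases.emon y ` {m. set_mset m \<subseteq> I})" by (rule dual_bases.emon_zfree_ring)
  then show "zfree_ring Rbasis" unfolding Rbasis_def by (rule someI)
qed

lemma R_no_zero_divisors:
  fixes r s :: "('u, 'n) RR"
  assumes "r * s = 0"
  shows "r = 0 \<or> s = 0"
proof -
  obtain I y and yd where "dual_bases I (y :: nat \<Rightarrow> 'u \<times> ('u, 'n) hsym) yd"
    by (rule finitely_separated_dual_bases[OF finitely_separated_generators])
  then show ?thesis using dual_bases.sym_no_zero_divisors assms by blast
qed

subsection \<open>The element \<open>\<Phi>\<close> and the determinant \<open>\<delta>\<close>\<close>

text \<open>The element \<open>\<Phi>\<close>, the map \<open>p\<close>, the determinant \<open>\<delta>\<close> and the adjoint \<open>q\<close>, at the types of this context\<close>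

abbreviation PHI :: "(('u, 'n) RR, 'u dpow) tensor" where "PHI \<equiv> Phi"

abbreviation pm :: "'u sym \<Rightarrow> (('u, 'n) RR, 'u dpow) tensor" where "pm \<equiv> p_map"

abbreviation dlt :: "('u, 'n) RR" where "dlt \<equiv> delta ms"

abbreviation qm :: "'u dpow \<Rightarrow> (('u, 'n) RR, 'u sym) tensor" where "qm \<equiv> q_map ms"

text \<open>The description that defines \<open>\<Phi>\<close> is satisfied by exactly one element.\<close>

lemma Phi_spec:
  "PHI \<in> base_change (dpow_deg (2 * CARD('n) - 2)) \<and>
     (\<forall>\<mu> :: ('u, 'n) hsym. reval PHI (sym_of_hsym \<mu>) = sym_of (0, \<mu>))"
proof -
  let ?b = "2 * CARD('n) - 2"
  let ?g = "\<lambda>\<mu>. sym_of (0 :: 'u, Abs_hsym (sym_comp ?b \<mu>) :: ('u, 'n) hsym)"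
  have "zhom (\<lambda>\<mu>. Abs_hsym (sym_comp ?b \<mu>) :: ('u, 'n) hsym)"
  proof (rule zhomI)
    fix a b :: "'u sym"
    show "(Abs_hsym (sym_comp ?b (a + b)) :: ('u, 'n) hsym)
        = Abs_hsym (sym_comp ?b a) + Abs_hsym (sym_comp ?b b)"
      using zmod.subspace_add[OF sym_pow_subspace sym_comp_in_sym_pow sym_comp_in_sym_pow, of ?b a b]
      by (simp add: sym_of_hsym_inject[symmetric] plus_hsym.rep_eq Abs_hsym_inverse sym_comp_in_sym_pow
          zhom_add[OF zhom_sym_comp])
  qed
  then have g: "zhom ?g"
    by (intro zhomI) (simp add: additive_def zhom_add[OF additive_sym_of, symmetric])
  obtain \<phi> where \<phi>: "\<phi> \<in> base_change (dpow_deg ?b)"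
    "\<And>\<mu>. \<mu> \<in> sym_pow UNIV ?b \<Longrightarrow> reval \<phi> \<mu> = ?g \<mu>"
    using reval_exists[OF g, of ?b] by blast
  have \<phi>': "\<forall>\<mu> :: ('u, 'n) hsym. reval \<phi> (sym_of_hsym \<mu>) = sym_of (0, \<mu>)"
    by (simp add: \<phi>(2) sym_of_hsym sym_comp_homogeneous[OF sym_of_hsym] sym_of_hsym_inverse)
  show ?thesis
    unfolding Phi_def
  proof (rule theI[of _ \<phi>])
    fix \<psi> :: "(('u, 'n) RR, 'u dpow) tensor"
    assume \<psi>: "\<psi> \<in> base_change (dpow_deg ?b) \<and>
      (\<forall>\<mu> :: ('u, 'n) hsym. reval \<psi> (sym_of_hsym \<mu>) = sym_of (0, \<mu>))"
    show "\<psi> = \<phi>"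
    proof (rule R.reval_eqI_degree[OF _ \<phi>(1)])
      fix \<mu> :: "'u sym" assume "\<mu> \<in> sym_pow UNIV ?b"
      then have "\<mu> = sym_of_hsym (Abs_hsym \<mu> :: ('u, 'n) hsym)" by (simp add: Abs_hsym_inverse)
      then show "reval \<psi> \<mu> = reval \<phi> \<mu>" using \<psi> \<phi>' by metis
    qed (use \<psi> in blast)
  qed (use \<phi>(1) \<phi>' in blast)
qed

lemmas Phi_degree = Phi_spec[THEN conjunct1] and reval_Phi = Phi_spec[THEN conjunct2, rule_format]

lemma zhom_pm: "zhom pm"
  unfolding p_map_def by (rule zhom_rcontract_left)

lemma reval_pm: "reval (pm \<mu>) \<mu>' = reval PHI (\<mu> * \<mu>')"
  by (simp add: p_map_def reval_rcontract)

lemma pm_degree: "\<mu> \<in> sym_pow UNIV (CARD('n) - 1) \<Longrightarrow> pm \<mu> \<in> base_change (dpow_deg (CARD('n) - 1))"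
  unfolding p_map_def using n
  by (intro R.rcontract_in_base_change[of _ "CARD('n) - 1"]) (simp_all add: Phi_degree mult_2[symmetric]
      diff_mult_distrib2)

text \<open>The matrix of \<open>p\<close> with respect to the basis \<open>ms\<close> and its dual basis\<close>

definition pmat :: "('u, 'n) RR mat" where
  "pmat = mat (length ms) (length ms) (\<lambda>(i, j). reval (pm (ms ! j)) (ms ! i))"

lemma pmat_carrier: "pmat \<in> carrier_mat (length ms) (length ms)"
  by (simp add: pmat_def)

lemma dim_pmat [simp]: "dim_row pmat = length ms" "dim_col pmat = length ms"
  by (simp_all add: pmat_def)

lemma dlt_def: "dlt = Determinant.det pmat"
  by (simp add: delta_def pmat_def)

lemma ms_inj: "inj_on ((!) ms) {..<length ms}"
  and ms_indep: "\<not> zmod.dependent ((!) ms ` {..<length ms})"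
  and ms_span: "zspan ((!) ms ` {..<length ms}) = sym_pow (UNIV :: 'u set) (CARD('n) - 1)"
  using ms by (simp_all add: zbasis_def)

lemma ms_in: "j < length ms \<Longrightarrow> ms ! j \<in> sym_pow UNIV (CARD('n) - 1)"
  unfolding ms_span[symmetric] by (rule zmod.span_base) simp

lemma ms_sum_zero:
  assumes "(\<Sum>j<length ms. zmul (a j) (ms ! j)) = 0" "j < length ms"
  shows "a j = 0"
proof -
  let ?b = "\<lambda>v. a (inv_into {..<length ms} ((!) ms) v)"
  have "(\<Sum>v\<in>(!) ms ` {..<length ms}. zmul (?b v) v) = (\<Sum>j<length ms. zmul (a j) (ms ! j))"
    by (simp add: sum.reindex[OF ms_inj] ms_inj inv_into_f_f)
  then have "?b (ms ! j) = 0"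
    using independent_sum_zero[OF _ ms_indep, of ?b "ms ! j"] assms by simp
  then show ?thesis using assms(2) by (simp add: ms_inj inv_into_f_f)
qed

lemma ms_eqI:
  assumes "zhom f" "zhom g" "\<And>i. i < length ms \<Longrightarrow> f (ms ! i) = g (ms ! i)"
    "\<mu> \<in> sym_pow UNIV (CARD('n) - 1)"
  shows "f \<mu> = g \<mu>"
  by (rule additive_eq_on_zspan[OF assms(1,2), of "(!) ms ` {..<length ms}"])
     (use assms(3,4) ms_span in auto)

lemma ms_coefficients:
  assumes "y \<in> base_change (sym_pow UNIV (CARD('n) - 1))"
  obtains a :: "nat \<Rightarrow> ('u, 'n) RR" where "y = (\<Sum>j<length ms. a j \<otimes>\<^sub>t (ms ! j))"
proof -
  obtain a where "y = (\<Sum>e\<in>(!) ms ` {..<length ms}. (a e :: ('u, 'n) RR) \<otimes>\<^sub>t e)"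
    using R.base_change_basis(1)[OF _ ms_indep ms_span assms] by auto
  then have "y = (\<Sum>j<length ms. a (ms ! j) \<otimes>\<^sub>t (ms ! j))" by (simp add: sum.reindex[OF ms_inj])
  then show thesis by (rule that)
qed

text \<open>A ring homomorphism from \<open>\<RR>\<close> to the integers specialises \<open>\<Phi>\<close> to a functional that makes
  \<open>Sym\<^bsub>n-1\<^esub> U\<close> a positive definite lattice. The Gram matrix of \<open>ms\<close> is then nonsingular, and its
  determinant is the image of \<open>\<delta>\<close>.\<close>

lemma dlt_nonzero: "dlt \<noteq> 0"
proof
  assume "dlt = 0"
  obtain \<phi> :: "'u sym \<Rightarrow> int" where \<phi>: "zhom \<phi>"
    "\<And>\<mu>. \<mu> \<in> sym_pow UNIV (CARD('n) - 1) \<Longrightarrow> \<phi> (\<mu> * \<mu>) = 0 \<Longrightarrow> \<mu> = 0"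
    using positive_definite_functional[of "CARD('n) - 1"] by blast
  let ?f = "\<lambda>(u :: 'u, \<eta> :: ('u, 'n) hsym). \<phi> (sym_of_hsym \<eta>)"
  have f: "zhom ?f" by (rule zhomI) (auto simp: zhom_add[OF hsym_zhom] zhom_add[OF \<phi>(1)])
  let ?h = "sym_hom ?f"
  interpret h: comm_ring_hom ?h
    by unfold_locales (simp_all add: zhom_add[OF zhom_sym_hom[OF f]] sym_hom_mult[OF f]
        zhom_zero[OF zhom_sym_hom[OF f]] sym_hom_one[OF f])
  have h_Phi: "?h (reval PHI \<mu>) = \<phi> \<mu>" if "\<mu> \<in> sym_pow UNIV (2 * CARD('n) - 2)" for \<mu>
  proof -
    have "\<mu> = sym_of_hsym (Abs_hsym \<mu> :: ('u, 'n) hsym)" using that by (simp add: Abs_hsym_inverse)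
    moreover have "?h (reval PHI (sym_of_hsym \<eta>)) = \<phi> (sym_of_hsym \<eta>)" for \<eta> :: "('u, 'n) hsym"
      by (simp add: reval_Phi sym_hom_sym_of[OF f])
    ultimately show ?thesis by metis
  qed
  let ?k = "length ms"
  let ?A = "map_mat ?h pmat"
  have A: "?A \<in> carrier_mat ?k ?k" using pmat_carrier by simp
  have entry: "?h (pmat $$ (i, j)) = \<phi> (ms ! i * ms ! j)" if "i < ?k" "j < ?k" for i j
  proof -
    have "CARD('n) - 1 + (CARD('n) - 1) = 2 * CARD('n) - 2" by linarith
    then have "ms ! j * ms ! i \<in> sym_pow UNIV (2 * CARD('n) - 2)"
      using sym_pow_mult[OF ms_in[OF that(2)] ms_in[OF that(1)]] by (simp only:)
    from h_Phi[OF this] show ?thesis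
      using that by (simp add: pmat_def reval_pm mult.commute[of "ms ! i"])
  qed
  have "Determinant.det ?A = 0"
    using \<open>dlt = 0\<close> by (simp add: dlt_def)
  then obtain v where v: "v \<in> carrier_vec ?k" "v \<noteq> 0\<^sub>v ?k" "?A *\<^sub>v v = 0\<^sub>v ?k"
    using det_0_iff_vec_prod_zero[OF A] by blast
  define \<mu> where "\<mu> = (\<Sum>j<?k. zmul (v $ j) (ms ! j))"
  have \<mu>: "\<mu> \<in> sym_pow UNIV (CARD('n) - 1)"
    unfolding \<mu>_def
    by (intro zmod.subspace_sum[OF sym_pow_subspace] zmod.subspace_scale[OF sym_pow_subspace] ms_in) simp
  have z: "\<phi> (ms ! i * \<mu>) = 0" if i: "i < ?k" for i
  proof -
    have "0 = (?A *\<^sub>v v) $ i" using v(3) i by simp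
    also have "\<dots> = (\<Sum>j<?k. \<phi> (ms ! i * ms ! j) * v $ j)"
      using i v(1) by (auto simp: scalar_prod_def atLeast0LessThan entry intro!: sum.cong)
    also have "\<dots> = \<phi> (ms ! i * \<mu>)"
      by (simp add: \<mu>_def zhom_sum[OF zhom_comp[OF \<phi>(1) zhom_mult_left]]
          zhom_zmul[OF zhom_comp[OF \<phi>(1) zhom_mult_left]] mult.commute)
    finally show ?thesis by simp
  qed
  have "zhom (\<lambda>\<nu>. \<phi> (\<nu> * \<mu>))"
    by (rule zhomI) (simp add: distrib_right zhom_add[OF \<phi>(1)])
  from ms_eqI[OF this zhom_const_zero z \<mu>] have "\<phi> (\<mu> * \<mu>) = 0" .
  then have "\<mu> = 0" using \<phi>(2)[OF \<mu>] by blast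
  then have "v $ j = 0" if "j < ?k" for j
    using ms_sum_zero[of "\<lambda>j. v $ j" j] that by (simp add: \<mu>_def)
  then have "v = 0\<^sub>v ?k" using v(1) by (intro eq_vecI) auto
  with v(2) show False ..
qed

lemma dlt_cancel: "dlt ^ k * s = 0 \<Longrightarrow> s = 0"
proof (induction k)
  case (Suc k)
  then have "dlt * (dlt ^ k * s) = 0" by (simp add: mult.assoc)
  then show ?case using R_no_zero_divisors dlt_nonzero Suc.IH by blast
qed simp

subsection \<open>The adjoint \<open>q\<close>\<close>

text \<open>Multiplying by the classical adjoint of the matrix of \<open>p\<close> reduces injectivity of \<open>p\<close> to
  cancellation of \<open>\<delta>\<close>.\<close>

lemma pm_inj:
  assumes y: "y \<in> base_change (sym_pow UNIV (CARD('n) - 1))" and 0: "rext pm y = 0"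
  shows "y = 0"
proof -
  let ?k = "length ms"
  obtain a :: "nat \<Rightarrow> ('u, 'n) RR" where a: "y = (\<Sum>j<?k. a j \<otimes>\<^sub>t (ms ! j))"
    by (rule ms_coefficients[OF y])
  have "pmat *\<^sub>v vec ?k a = 0\<^sub>v ?k"
  proof (rule eq_vecI)
    fix i assume i: "i < dim_vec (0\<^sub>v ?k :: ('u, 'n) RR vec)"
    have "(pmat *\<^sub>v vec ?k a) $ i = (\<Sum>j<?k. reval (pm (ms ! j)) (ms ! i) * a j)"
      using i by (simp add: pmat_def scalar_prod_def atLeast0LessThan)
    also have "\<dots> = reval (rext pm y) (ms ! i)"
      by (simp add: a zhom_sum[OF zhom_comp[OF zhom_reval zhom_rext[OF zhom_pm]]] rext_tens[OF zhom_pm]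
          reval_tscale mult.commute)
    also have "\<dots> = 0" by (simp add: 0 zhom_zero[OF zhom_reval])
    finally show "(pmat *\<^sub>v vec ?k a) $ i = 0\<^sub>v ?k $ i" using i by simp
  qed (simp add: pmat_def)
  then have "adj_mat pmat *\<^sub>v (pmat *\<^sub>v vec ?k a) = adj_mat pmat *\<^sub>v 0\<^sub>v ?k" by simp
  also have "adj_mat pmat *\<^sub>v (pmat *\<^sub>v vec ?k a) = (adj_mat pmat * pmat) *\<^sub>v vec ?k a"
    by (rule assoc_mult_mat_vec[symmetric, OF adj_mat(1)[OF pmat_carrier] pmat_carrier]) simp
  also have "\<dots> = (dlt \<cdot>\<^sub>m 1\<^sub>m ?k) *\<^sub>v vec ?k a" by (simp add: adj_mat(3)[OF pmat_carrier] dlt_def)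
  finally have e: "(dlt \<cdot>\<^sub>m 1\<^sub>m ?k) *\<^sub>v vec ?k a = adj_mat pmat *\<^sub>v 0\<^sub>v ?k" .
  have "dlt * a j = 0" if j: "j < ?k" for j
  proof -
    have "((dlt \<cdot>\<^sub>m 1\<^sub>m ?k) *\<^sub>v vec ?k a) $ j = dlt * a j"
      using j by (simp add: scalar_prod_def if_distrib[of "\<lambda>t. t * _"] if_distrib[of "\<lambda>t. _ * t"] cong: if_cong)
    moreover have "(adj_mat pmat *\<^sub>v 0\<^sub>v ?k) $ j = 0"
      using j adj_mat(1)[OF pmat_carrier] by (simp add: carrier_matD)
    ultimately show ?thesis using e by simp
  qed
  then have "a j = 0" if "j < ?k" for j using dlt_cancel[of 1] that by simp
  then show ?thesis by (simp add: a tens_simps)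
qed

text \<open>The classical adjoint of the matrix of \<open>p\<close> satisfies the conditions that define \<open>q\<close>. They determine
  \<open>q\<close>, because \<open>p\<close> is injective and \<open>D(U\<^sup>*)\<close> is the sum of its homogeneous components.\<close>

lemma q_spec:
  "zhom qm \<and>
   (\<forall>\<nu> \<in> dpow_deg (CARD('n) - 1).
      qm \<nu> \<in> base_change (sym_pow UNIV (CARD('n) - 1)) \<and> rext pm (qm \<nu>) = dlt \<otimes>\<^sub>t \<nu>) \<and>
   (\<forall>c. c \<noteq> CARD('n) - 1 \<longrightarrow> (\<forall>\<nu> \<in> dpow_deg c. qm \<nu> = 0))"
proof -
  let ?k = "length ms" and ?m = "CARD('n) - 1"
  let ?P = "\<lambda>q :: 'u dpow \<Rightarrow> (('u, 'n) RR, 'u sym) tensor. zhom q \<and>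
   (\<forall>\<nu> \<in> dpow_deg ?m. q \<nu> \<in> base_change (sym_pow UNIV ?m) \<and> rext pm (q \<nu>) = dlt \<otimes>\<^sub>t \<nu>) \<and>
   (\<forall>c. c \<noteq> ?m \<longrightarrow> (\<forall>\<nu> \<in> dpow_deg c. q \<nu> = 0))"
  define c where "c j \<nu> = (\<Sum>i<?k. adj_mat pmat $$ (j, i) * of_int (dapply \<nu> (ms ! i)))" for j \<nu>
  define q where "q \<nu> = (\<Sum>j<?k. c j \<nu> \<otimes>\<^sub>t (ms ! j))" for \<nu>
  have "zhom (c j)" for j
    by (rule zhomI) (simp add: c_def plus_dpow.rep_eq distrib_left sum.distrib)
  then have "zhom q"
    by (intro zhomI) (simp add: q_def zhom_add tens_simps sum.distrib)
  moreover have "q \<nu> \<in> base_change (sym_pow UNIV ?m)" for \<nu>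
    unfolding q_def
    by (intro zmod.subspace_sum[OF base_change_subspace] tens_in_base_change ms_in) simp
  moreover have "rext pm (q \<nu>) = dlt \<otimes>\<^sub>t \<nu>" if \<nu>: "\<nu> \<in> dpow_deg ?m" for \<nu>
  proof (rule R.reval_eqI_degree[of _ ?m])
    have e: "rext pm (q \<nu>) = (\<Sum>j<?k. tscale (c j \<nu>) (pm (ms ! j)))"
      by (simp add: q_def zhom_sum[OF zhom_rext[OF zhom_pm]] rext_tens[OF zhom_pm])
    show "rext pm (q \<nu>) \<in> base_change (dpow_deg ?m)"
      unfolding e
      by (intro zmod.subspace_sum[OF base_change_subspace] base_change_tscale pm_degree ms_in) simp
    show "dlt \<otimes>\<^sub>t \<nu> \<in> base_change (dpow_deg ?m)" by (rule tens_in_base_change[OF \<nu>])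
    fix \<mu> :: "'u sym" assume \<mu>: "\<mu> \<in> sym_pow UNIV ?m"
    show "reval (rext pm (q \<nu>)) \<mu> = reval (dlt \<otimes>\<^sub>t \<nu>) \<mu>"
    proof (rule ms_eqI[OF zhom_reval_right zhom_reval_right _ \<mu>])
      fix l assume l: "l < ?k"
      have "reval (rext pm (q \<nu>)) (ms ! l) = (\<Sum>j<?k. c j \<nu> * pmat $$ (l, j))"
        using l by (simp add: e zhom_sum[OF zhom_reval] reval_tscale pmat_def)
      also have "\<dots> = (\<Sum>j<?k. \<Sum>i<?k. pmat $$ (l, j) * adj_mat pmat $$ (j, i) * of_int (dapply \<nu> (ms ! i)))"
        by (simp add: c_def sum_distrib_left sum_distrib_right mult.commute mult.left_commute)
      also have "\<dots> = (\<Sum>i<?k. (\<Sum>j<?k. pmat $$ (l, j) * adj_mat pmat $$ (j, i)) * of_int (dapply \<nu> (ms ! i)))"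
        by (subst sum.swap) (simp add: sum_distrib_right)
      also have "\<dots> = (\<Sum>i<?k. (pmat * adj_mat pmat) $$ (l, i) * of_int (dapply \<nu> (ms ! i)))"
        using l pmat_carrier adj_mat(1)[OF pmat_carrier]
        by (intro sum.cong refl) (simp add: scalar_prod_def atLeast0LessThan carrier_matD)
      also have "\<dots> = (\<Sum>i<?k. if i = l then dlt * of_int (dapply \<nu> (ms ! i)) else 0)"
        using l by (intro sum.cong refl) (simp add: adj_mat(2)[OF pmat_carrier] dlt_def)
      also have "\<dots> = reval (dlt \<otimes>\<^sub>t \<nu>) (ms ! l)" using l by (simp add: reval_tens)
      finally show "reval (rext pm (q \<nu>)) (ms ! l) = reval (dlt \<otimes>\<^sub>t \<nu>) (ms ! l)" .
    qed
  qed
  moreover have "q \<nu> = 0" if "b \<noteq> ?m" "\<nu> \<in> dpow_deg b" for b \<nu>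
    using dpow_degD[OF that(2) ms_in] that(1) by (simp add: q_def c_def tens_simps)
  ultimately have q: "?P q" by blast
  have "q' = q" if q': "?P q'" for q'
  proof (rule ext)
    fix \<nu>
    have "q' \<nu> = q \<nu>" if "\<nu> \<in> dpow_deg b" for b \<nu>
    proof (cases "b = ?m")
      case True
      have "q' \<nu> - q \<nu> = 0"
      proof (rule pm_inj)
        show "q' \<nu> - q \<nu> \<in> base_change (sym_pow UNIV ?m)"
          using q q' that True zmod.subspace_diff[OF base_change_subspace] by blast
        show "rext pm (q' \<nu> - q \<nu>) = 0"
          using q q' that True by (simp add: zhom_diff[OF zhom_rext[OF zhom_pm]])
      qed
      then show ?thesis by simp
    next
      case False
      then show ?thesis using q q' that by simp
    qed
    then have c: "q' (dpow_comp b \<nu>) = q (dpow_comp b \<nu>)" for b using dpow_comp_in_dpow_deg by blast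
    obtain M where M: "\<nu> = (\<Sum>b\<le>M. dpow_comp b \<nu>)" by (rule dpow_decomposition)
    show "q' \<nu> = q \<nu>"
      by (subst (1 2) M) (use q q' in \<open>simp add: zhom_sum c\<close>)
  qed
  with q show ?thesis unfolding q_map_def by (rule theI)
qed

lemmas zhom_qm = q_spec[THEN conjunct1]

lemma qm_degree: "\<nu> \<in> dpow_deg (CARD('n) - 1) \<Longrightarrow> qm \<nu> \<in> base_change (sym_pow UNIV (CARD('n) - 1))"
  and pm_qm: "\<nu> \<in> dpow_deg (CARD('n) - 1) \<Longrightarrow> rext pm (qm \<nu>) = dlt \<otimes>\<^sub>t \<nu>"
  using q_spec by blast+

lemma qm_pm:
  assumes \<mu>: "\<mu> \<in> sym_pow UNIV (CARD('n) - 1)"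
  shows "rext qm (pm \<mu>) = dlt \<otimes>\<^sub>t \<mu>"
proof -
  let ?m = "CARD('n) - 1"
  have "rext qm (pm \<mu>) - dlt \<otimes>\<^sub>t \<mu> = 0"
  proof (rule pm_inj)
    have "rext qm (pm \<mu>) \<in> base_change (sym_pow UNIV ?m)"
      by (rule base_change_induct[OF pm_degree[OF \<mu>] zhom_rext[OF zhom_qm] base_change_subspace])
         (simp add: rext_tens[OF zhom_qm] base_change_tscale qm_degree)
    then show "rext qm (pm \<mu>) - dlt \<otimes>\<^sub>t \<mu> \<in> base_change (sym_pow UNIV ?m)"
      by (intro zmod.subspace_diff[OF base_change_subspace] tens_in_base_change \<mu>)
    have "rext pm (rext qm (pm \<mu>)) = tscale dlt (pm \<mu>)"
      by (rule base_change_eqI[OF pm_degree[OF \<mu>] zhom_comp[OF zhom_rext[OF zhom_pm] zhom_rext[OF zhom_qm]]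
            zhom_tscale])
         (simp add: rext_tens[OF zhom_qm] rext_tscale[OF zhom_pm] pm_qm tscale_tens mult.commute)
    then show "rext pm (rext qm (pm \<mu>) - dlt \<otimes>\<^sub>t \<mu>) = 0"
      by (simp add: zhom_diff[OF zhom_rext[OF zhom_pm]] rext_tens[OF zhom_pm])
  qed
  then show ?thesis by simp
qed

subsection \<open>The lift of \<open>\<Phi>\<close> along \<open>x\<^sub>1\<close>\<close>

text \<open>\<open>U0\<close> is the kernel of \<open>x\<^sub>1\<^sup>*\<close>, and \<open>PHIT\<close> is the lift of \<open>\<Phi>\<close> that vanishes on \<open>Sym U0\<close>.\<close>

abbreviation U0 :: "'u set" where "U0 \<equiv> {u. xd 1 u = 0}"

abbreviation PHIT :: "(('u, 'n) RR, 'u dpow) tensor" where "PHIT \<equiv> Phi_tilde (x 1) U0"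

text \<open>The functional \<open>\<mu> \<mapsto> \<Phi>(del \<mu>)\<close> satisfies the defining conditions. It is the only one to do so, since
  they prescribe the values at \<open>rho \<mu>\<close> and at \<open>x\<^sub>1 del \<mu>\<close>, whose sum is \<open>\<mu>\<close>.\<close>

lemma Phi_tilde_spec:
  "PHIT \<in> base_change (dpow_deg (2 * CARD('n) - 1)) \<and> rcontract (sym_of (x 1)) PHIT = PHI \<and>
   (\<forall>\<mu> \<in> sym_pow U0 (2 * CARD('n) - 1). rcontract \<mu> PHIT = 0)"
proof -
  let ?b = "2 * CARD('n) - 1"
  let ?\<phi> = "rmap one.ddel PHI"
  have rev: "reval ?\<phi> \<mu> = reval PHI (one.del \<mu>)" for \<mu>
    by (rule reval_rmap) (rule one.dapply_ddel)
  have b: "?b = Suc (2 * CARD('n) - 2)" using n by simp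
  have deg: "reval ?\<phi> \<mu> = 0" if "c \<noteq> ?b" "\<mu> \<in> sym_pow UNIV c" for c \<mu>
  proof (cases c)
    case 0
    then show ?thesis using that by (simp add: rev one.del_degree_0 zhom_zero[OF zhom_reval_right])
  next
    case (Suc c')
    then show ?thesis
      using that b unfolding rev
      by (intro reval_degree[OF Phi_degree one.del_in_sym_pow]) auto
  qed
  have \<phi>: "?\<phi> \<in> base_change (dpow_deg ?b)" by (rule R.base_change_dpow_degI) (rule deg)
  moreover have "rcontract (sym_of (x 1)) ?\<phi> = PHI"
    by (rule R.reval_eqI) (simp add: reval_rcontract rev one.del_e)
  moreover have "rcontract \<mu> ?\<phi> = 0" if \<mu>: "\<mu> \<in> sym_pow U0 ?b" for \<mu>
  proof -
    have \<mu>': "\<mu> \<in> sym_pow UNIV ?b" using \<mu> sym_pow_mono[of U0 UNIV] by blast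
    have 0: "reval ?\<phi> (\<mu> * sym_comp c \<mu>'') = 0" for c \<mu>''
    proof (cases "c = 0")
      case True
      \<comment> \<open>Constants are fixed by \<open>rho\<close>, so the product involves no \<open>x\<^sub>1\<close>.\<close>
      have "one.rho (sym_comp 0 \<mu>'') = sym_comp 0 \<mu>''"
        by (rule sym_pow_eqI[OF sym_comp_in_sym_pow one.zhom_rho zhom_ident(1)]) (simp add: one.rho_one)
      then have "\<mu> * sym_comp c \<mu>'' = one.rho (\<mu> * sym_comp c \<mu>'')"
        by (simp add: True one.rho_mult one.rho_ker[OF \<mu>])
      then have "one.del (\<mu> * sym_comp c \<mu>'') = 0" by (metis one.del_rho)
      then show ?thesis by (simp add: rev zhom_zero[OF zhom_reval_right])
    next
      case False
      then show ?thesis by (intro deg[OF _ sym_pow_mult[OF \<mu>' sym_comp_in_sym_pow]]) simp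
    qed
    have "reval (rcontract \<mu> ?\<phi>) \<mu>'' = 0" for \<mu>''
      by (rule reval_components) (simp add: reval_rcontract 0)
    then show ?thesis by (intro R.reval_eqI) (simp add: zhom_zero[OF zhom_reval])
  qed
  ultimately have P: "?\<phi> \<in> base_change (dpow_deg ?b) \<and> rcontract (sym_of (x 1)) ?\<phi> = PHI \<and>
    (\<forall>\<mu> \<in> sym_pow U0 ?b. rcontract \<mu> ?\<phi> = 0)" by blast
  then show ?thesis
    unfolding Phi_tilde_def
  proof (rule theI)
    fix \<psi> :: "(('u, 'n) RR, 'u dpow) tensor"
    assume \<psi>: "\<psi> \<in> base_change (dpow_deg ?b) \<and> rcontract (sym_of (x 1)) \<psi> = PHI \<and>
      (\<forall>\<mu> \<in> sym_pow U0 ?b. rcontract \<mu> \<psi> = 0)"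
    show "\<psi> = ?\<phi>"
    proof (rule R.reval_eqI_degree[OF _ \<phi>])
      fix \<mu> :: "'u sym" assume \<mu>: "\<mu> \<in> sym_pow UNIV ?b"
      have r: "reval \<theta> \<mu> = reval PHI (one.del \<mu>)"
        if "rcontract (sym_of (x 1)) \<theta> = PHI" "\<forall>\<mu> \<in> sym_pow U0 ?b. rcontract \<mu> \<theta> = 0" for \<theta>
      proof -
        have "reval \<theta> \<mu> = reval \<theta> (one.rho \<mu> * 1) + reval \<theta> (sym_of (x 1) * one.del \<mu>)"
          by (simp add: one.rho_del flip: zhom_add[OF zhom_reval_right])
        also have "\<dots> = reval PHI (one.del \<mu>)"
          unfolding reval_rcontract[symmetric] that(1)
          using that(2) one.rho_in_sym_pow[OF \<mu>] by (simp add: zhom_zero[OF zhom_reval])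
        finally show ?thesis .
      qed
      show "reval \<psi> \<mu> = reval ?\<phi> \<mu>" using r[of \<psi>] r[of ?\<phi>] \<psi> P by simp
    qed (use \<psi> in blast)
  qed
qed

lemmas Phi_tilde_degree = Phi_tilde_spec[THEN conjunct1]
  and x1_Phi_tilde = Phi_tilde_spec[THEN conjunct2, THEN conjunct1]

end

section \<open>Free submodules that become everything after inverting \<open>\<delta>\<close>\<close>

text \<open>A linear map that is injective on a free module, and whose image contains a multiple \<open>\<delta>\<^sup>k g\<close> of each
  \<open>g\<close> in \<open>G\<close>, is as required: the fraction \<open>g / \<delta>\<^sup>i\<close> is equal to \<open>\<delta>\<^sup>k g / \<delta>\<^sup>i\<^sup>+\<^sup>k\<close>.\<close>

lemma free_iso_generically_ontoI:
  fixes scB :: "'r::comm_ring_1 \<Rightarrow> 'b::ab_group_add \<Rightarrow> 'b"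
    and scG :: "'r \<Rightarrow> 'g::ab_group_add \<Rightarrow> 'g"
  assumes h: "Modules.module_hom scB scG \<tau>"
    and E: "\<not> Modules.module.dependent scB E" "Modules.module.span scB E = B"
    and inj: "\<And>b. b \<in> B \<Longrightarrow> \<tau> b = 0 \<Longrightarrow> b = 0"
    and im: "\<And>b. b \<in> B \<Longrightarrow> \<tau> b \<in> G"
    and onto: "\<And>g. g \<in> G \<Longrightarrow> \<exists>k. scG (\<delta> ^ k) g \<in> \<tau> ` B"
  shows "free_iso_generically_onto scB scG \<delta> \<tau> B G"
proof -
  interpret h: Modules.module_hom scB scG \<tau> by (rule h)
  have B: "h.m1.subspace B" using h.m1.subspace_span[of E] E(2) by simp
  have inj': "inj_on \<tau> B" using h.inj_on_iff_eq_0[OF B] inj by blast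
  have span: "h.m2.span (\<tau> ` E) = \<tau> ` B" by (simp add: h.span_image E(2))
  have "\<not> h.m2.dependent (\<tau> ` E)"
    by (rule h.independent_injective_image[OF E(1)]) (simp add: E(2) inj')
  then have free: "free_submodule scG (\<tau> ` B) G"
    unfolding free_submodule_def using span h.subspace_image[OF B] im by blast
  have iso: "module_iso_on scB scG \<tau> B (\<tau> ` B)"
    unfolding module_iso_on_def by (simp add: inj_on_imp_bij_betw[OF inj'] h.add h.scale)
  have "frac_rel scG \<delta> G `` {(g, i)} \<in> localized_submodule scG \<delta> (\<tau> ` B) G" if g: "g \<in> G" for g i
  proof -
    obtain k where k: "scG (\<delta> ^ k) g \<in> \<tau> ` B" using onto[OF g] by blast
    have kG: "scG (\<delta> ^ k) g \<in> G" using k by (auto dest: im)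
    have e: "scG (\<delta> ^ l) (scG (\<delta> ^ j) (scG (\<delta> ^ k) g) - scG (\<delta> ^ (i + k)) m)
        = scG (\<delta> ^ k) (scG (\<delta> ^ l) (scG (\<delta> ^ j) g - scG (\<delta> ^ i) m))" for l j m
      by (simp add: h.m2.scale_right_diff_distrib power_add mult.commute mult.left_commute)
    have e': "scG (\<delta> ^ k) (scG (\<delta> ^ l) u) = scG (\<delta> ^ (k + l)) u" for l u
      by (simp add: power_add)
    have iff: "(\<exists>l. scG (\<delta> ^ l) (scG (\<delta> ^ j) (scG (\<delta> ^ k) g) - scG (\<delta> ^ (i + k)) m) = 0)
        \<longleftrightarrow> (\<exists>l. scG (\<delta> ^ l) (scG (\<delta> ^ j) g - scG (\<delta> ^ i) m) = 0)" for j m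
    proof
      assume "\<exists>l. scG (\<delta> ^ l) (scG (\<delta> ^ j) (scG (\<delta> ^ k) g) - scG (\<delta> ^ (i + k)) m) = 0"
      then show "\<exists>l. scG (\<delta> ^ l) (scG (\<delta> ^ j) g - scG (\<delta> ^ i) m) = 0" unfolding e e' by blast
    next
      assume "\<exists>l. scG (\<delta> ^ l) (scG (\<delta> ^ j) g - scG (\<delta> ^ i) m) = 0"
      then show "\<exists>l. scG (\<delta> ^ l) (scG (\<delta> ^ j) (scG (\<delta> ^ k) g) - scG (\<delta> ^ (i + k)) m) = 0"
        unfolding e by (metis h.m2.scale_zero_right)
    qed
    have cls: "frac_rel scG \<delta> G `` {(h, i)}
        = {(m, j). m \<in> G \<and> (\<exists>l. scG (\<delta> ^ l) (scG (\<delta> ^ j) h - scG (\<delta> ^ i) m) = 0)}"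
      if "h \<in> G" for h i
      using that by (auto simp: frac_rel_def)
    have "frac_rel scG \<delta> G `` {(scG (\<delta> ^ k) g, i + k)} = frac_rel scG \<delta> G `` {(g, i)}"
      by (simp only: cls[OF g] cls[OF kG] iff)
    then show ?thesis
      unfolding localized_submodule_def using k
      by (intro image_eqI[of _ _ "(scG (\<delta> ^ k) g, i + k)"]) auto
  qed
  then have "localization scG \<delta> G \<subseteq> localized_submodule scG \<delta> (\<tau> ` B) G"
    unfolding localization_def by (auto elim!: quotientE)
  moreover have "localized_submodule scG \<delta> (\<tau> ` B) G \<subseteq> localization scG \<delta> G"
    unfolding localization_def localized_submodule_def using im by (auto intro!: quotientI)
  ultimately show ?thesis
    unfolding free_iso_generically_onto_def using free iso by blast
qed

lemma id_free_iso:
  fixes \<delta> :: "'r::comm_ring_1"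
  shows "free_iso_generically_onto (*) (*) \<delta> id UNIV UNIV"
proof -
  have m: "Modules.module ((*) :: 'r \<Rightarrow> 'r \<Rightarrow> 'r)"
    by (rule Modules.module.intro) (simp_all add: algebra_simps)
  interpret m: Modules.module "(*) :: 'r \<Rightarrow> 'r \<Rightarrow> 'r" by (rule m)
  have h: "Modules.module_hom (*) (*) (id :: 'r \<Rightarrow> 'r)"
    by (intro Modules.module_hom.intro m module_hom_axioms.intro) simp_all
  have "\<not> m.dependent {1}" by (subst m.dependent_finite) simp_all
  moreover have "m.span {1} = UNIV"
    using m.span_scale[OF m.span_base[of 1 "{1}"]] by (auto simp: set_eq_iff)
  ultimately show ?thesis
    by (rule free_iso_generically_ontoI[OF h]) simp_all
qed

lemma module_pscale: "Modules.module (pscale :: 'r::comm_ring_1 \<Rightarrow> _ \<Rightarrow>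
    ('r, 'm::ab_group_add) tensor \<times> ('r, 'k::ab_group_add) tensor)"
  by (rule Modules.module.intro)
     (auto simp: pscale_def tsc.scale_right_distrib tsc.scale_left_distrib)

interpretation psc: Modules.module "pscale :: 'r::comm_ring_1 \<Rightarrow> _ \<Rightarrow>
    ('r, 'm::ab_group_add) tensor \<times> ('r, 'k::ab_group_add) tensor"
  by (rule module_pscale)

lemma base_change_subspace_tscale: "tsc.subspace (base_change N)"
  unfolding tsc.subspace_def
  by (auto simp: base_change_tscale intro: zmod.subspace_0[OF base_change_subspace]
      zmod.subspace_add[OF base_change_subspace])

context zfree_ring
begin

lemma base_change_free:
  fixes N :: "'m::ab_group_add set"
  assumes N: "finitely_separated N" "zmod.subspace N"
  obtains F :: "('r, 'm) tensor set"
  where "finite F" "\<not> tsc.dependent F" "tsc.span F = base_change N"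
proof -
  obtain E where E: "finite E" "\<not> zmod.dependent E" "zspan E = N"
    by (rule finitely_separated_basis[OF N])
  let ?f = "\<lambda>e. (1 :: 'r) \<otimes>\<^sub>t e"
  have ind: "a e = 0" if "(\<Sum>e\<in>E. tscale (a e) (?f e)) = 0" "e \<in> E" for a :: "'m \<Rightarrow> 'r" and e
    using base_change_basis(2)[OF E _ that(2), of a] that(1) by (simp add: tscale_tens)
  have inj: "inj_on ?f E"
  proof (rule inj_onI, rule ccontr)
    fix e e' assume e: "e \<in> E" "e' \<in> E" "?f e = ?f e'" "e \<noteq> e'"
    let ?a = "\<lambda>u. if u = e then 1 else if u = e' then - 1 else (0 :: 'r)"
    have "(\<Sum>u\<in>E. tscale (?a u) (?f u)) = (\<Sum>u\<in>{e, e'}. tscale (?a u) (?f u))"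
      by (rule sum.mono_neutral_right) (use e E(1) in auto)
    also have "\<dots> = 0" using e(3,4) by simp
    finally show False using ind[of ?a e] e(1) by simp
  qed
  have "\<not> tsc.dependent (?f ` E)"
  proof
    assume "tsc.dependent (?f ` E)"
    then obtain u v where u: "v \<in> ?f ` E" "u v \<noteq> (0 :: 'r)" "(\<Sum>v\<in>?f ` E. tscale (u v) v) = 0"
      unfolding tsc.dependent_finite[OF finite_imageI[OF E(1)]] by blast
    then have "(\<Sum>e\<in>E. tscale (u (?f e)) (?f e)) = 0" by (simp add: sum.reindex[OF inj])
    then show False using ind[of "\<lambda>e. u (?f e)"] u(1,2) by auto
  qed
  moreover have "tsc.span (?f ` E) = base_change N"
  proof
    have "?f ` E \<subseteq> base_change N"
      using E(3) zmod.span_base[of _ E] by (auto intro: tens_in_base_change)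
    then show "tsc.span (?f ` E) \<subseteq> base_change N"
      by (rule tsc.span_minimal[OF _ base_change_subspace_tscale])
    show "base_change N \<subseteq> tsc.span (?f ` E)"
    proof
      fix z :: "('r, 'm) tensor" assume "z \<in> base_change N"
      then obtain a :: "'m \<Rightarrow> 'r" where "z = (\<Sum>e\<in>E. a e \<otimes>\<^sub>t e)" using base_change_basis(1)[OF E] by blast
      then have "z = (\<Sum>e\<in>E. tscale (a e) (?f e))" by (simp add: tscale_tens)
      also have "\<dots> \<in> tsc.span (?f ` E)"
        by (intro tsc.span_sum tsc.span_scale tsc.span_base imageI)
      finally show "z \<in> tsc.span (?f ` E)" .
    qed
  qed
  ultimately show thesis using that E(1) by blast
qed

lemma base_change_Times_free:
  fixes N :: "'m::ab_group_add set" and N' :: "'k::ab_group_add set"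
  assumes N: "finitely_separated N" "zmod.subspace N" and N': "finitely_separated N'" "zmod.subspace N'"
  obtains E :: "(('r, 'm) tensor \<times> ('r, 'k) tensor) set"
  where "\<not> psc.dependent E" "psc.span E = base_change N \<times> base_change N'"
proof -
  obtain F :: "('r, 'm) tensor set" where F: "finite F" "\<not> tsc.dependent F" "tsc.span F = base_change N"
    by (rule base_change_free[OF N])
  obtain F' :: "('r, 'k) tensor set" where F': "finite F'" "\<not> tsc.dependent F'" "tsc.span F' = base_change N'"
    by (rule base_change_free[OF N'])
  let ?i = "\<lambda>e :: ('r, 'm) tensor. (e, 0 :: ('r, 'k) tensor)" and ?j = "\<lambda>e :: ('r, 'k) tensor. (0 :: ('r, 'm) tensor, e)"
  let ?E = "?i ` F \<union> ?j ` F'"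
  have i: "Modules.module_hom tscale pscale ?i" and j: "Modules.module_hom tscale pscale ?j"
    by (unfold_locales; simp add: pscale_def tsc.scale_right_distrib tsc.scale_left_distrib)+
  have fst: "Modules.module_hom pscale tscale (fst :: ('r, 'm) tensor \<times> ('r, 'k) tensor \<Rightarrow> _)"
    and snd: "Modules.module_hom pscale tscale (snd :: ('r, 'm) tensor \<times> ('r, 'k) tensor \<Rightarrow> _)"
    by (unfold_locales; auto simp: pscale_def tsc.scale_right_distrib tsc.scale_left_distrib)+
  have "0 \<notin> F'" using F'(2) tsc.dependent_zero by blast
  then have disj: "?i ` F \<inter> ?j ` F' = {}" by auto
  have "\<not> psc.dependent ?E"
  proof
    assume "psc.dependent ?E"
    then obtain u v where u: "v \<in> ?E" "u v \<noteq> (0 :: 'r)" "(\<Sum>v\<in>?E. pscale (u v) v) = 0"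
      unfolding psc.dependent_finite[OF finite_UnI[OF finite_imageI[OF F(1)] finite_imageI[OF F'(1)]]]
      by blast
    have s: "(\<Sum>e\<in>F. pscale (u (?i e)) (?i e)) + (\<Sum>e\<in>F'. pscale (u (?j e)) (?j e)) = 0"
      using u(3) F(1) F'(1) disj by (simp add: sum.union_disjoint sum.reindex inj_on_def)
    have 1: "(\<Sum>e\<in>F. tscale (u (?i e)) e) = 0"
      using arg_cong[OF s, of fst] by (simp add: fst_sum pscale_def)
    have 2: "(\<Sum>e\<in>F'. tscale (u (?j e)) e) = 0"
      using arg_cong[OF s, of snd] by (simp add: snd_sum pscale_def)
    have "\<forall>e\<in>F. u (?i e) = 0" "\<forall>e\<in>F'. u (?j e) = 0"
      using tsc.independentD[OF F(2,1) subset_refl 1] tsc.independentD[OF F'(2,1) subset_refl 2]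
      by simp_all
    with u(1,2) show False by auto
  qed
  moreover have "psc.span ?E = base_change N \<times> base_change N'"
    unfolding psc.span_Un module_hom.span_image[OF i] module_hom.span_image[OF j] F(3) F'(3)
    by (force simp: image_iff)
  ultimately show thesis by (rule that)
qed

end

section \<open>Koszul operators\<close>

lemma opm_intertwine:
  assumes "zhom F" "zhom f" "zhom g" "zhom g'" "\<And>\<mu>. F (g \<mu>) = rmap g' (F \<mu>)"
  shows "opm F (lmap f g z) = lmap f g' (opm F z)"
  by (rule tensor_zhom_eqI3[OF zhom_comp[OF zhom_opm zhom_lmap] zhom_comp[OF zhom_lmap zhom_opm]])
     (simp_all add: assms lmap_tens opm_tens lmap_tscale lmap_tens_left)

context dual_bases
begin

text \<open>The common form of \<open>kappa\<close> and \<open>eta\<close>: the sum of the products of contraction by \<open>xd i\<close> with an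
  action \<open>g i\<close> of \<open>x i\<close> on the second factor.\<close>

definition koz :: "nat set \<Rightarrow> (nat \<Rightarrow> 'b \<Rightarrow> 'b) \<Rightarrow>
    ('r::comm_ring_1, ('u ext, 'b::ab_group_add) tensor) tensor \<Rightarrow> ('r, ('u ext, 'b) tensor) tensor" where
  "koz J g z = (\<Sum>i\<in>J. lmap (ext_contract (xd i)) (g i) z)"

lemma zhom_ext: "i \<in> I \<Longrightarrow> zhom (ext_contract (xd i))"
  by (rule zhom_ext_contract[OF zhom_xd])

lemma zhom_koz:
  assumes "J \<subseteq> I" "\<And>i. i \<in> I \<Longrightarrow> zhom (g i)"
  shows "zhom (koz J g)"
  unfolding koz_def[abs_def] using assms by (intro zhom_sum_fun zhom_lmap zhom_ext) auto

lemma koz_tscale: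
  assumes "J \<subseteq> I" "\<And>i. i \<in> I \<Longrightarrow> zhom (g i)"
  shows "koz J g (tscale r z) = tscale r (koz J g z)"
  unfolding koz_def using assms
  by (auto simp: zhom_sum[OF zhom_tscale] intro!: sum.cong lmap_tscale zhom_ext)

lemma rmap_kappa:
  assumes "J \<subseteq> I"
  shows "rmap (kappa J x xd) z = koz J (\<lambda>i \<mu>. sym_of (x i) * \<mu>) z"
proof -
  have J: "\<And>i. i \<in> J \<Longrightarrow> zhom (xd i)" using assms zhom_xd by blast
  show ?thesis
    by (rule tensor_zhom_eqI3[OF zhom_rmap[OF additive_kappa[OF J]] zhom_koz[OF assms zhom_mult_left]])
       (simp_all add: rmap_tens[OF additive_kappa[OF J]] kappa_tens[OF J] tens_sum koz_def
          lmap_tens[OF zhom_ext_contract[OF J] zhom_mult_left])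
qed

lemma rmap_eta:
  assumes "J \<subseteq> I"
  shows "rmap (eta J x xd) z = koz J (\<lambda>i. contract (sym_of (x i))) z"
proof -
  have J: "\<And>i. i \<in> J \<Longrightarrow> zhom (xd i)" using assms zhom_xd by blast
  show ?thesis
    by (rule tensor_zhom_eqI3[OF zhom_rmap[OF additive_eta[OF J]] zhom_koz[OF assms zhom_contract]])
       (simp_all add: rmap_tens[OF additive_eta[OF J]] eta_tens[OF J] tens_sum koz_def
          lmap_tens[OF zhom_ext_contract[OF J] zhom_contract])
qed

text \<open>The summands anticommute and square to zero.\<close>

lemma koz_koz:
  assumes J: "J \<subseteq> I" and g: "\<And>i. i \<in> I \<Longrightarrow> zhom (g i)"
    and comm: "\<And>i j b. g i (g j b) = g j (g i b)"
  shows "koz J g (koz J g z) = 0"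
proof -
  let ?a = "\<lambda>i. lmap (ext_contract (xd i)) (g i)"
  have za: "zhom (?a i)" if "i \<in> I" for i using that by (intro zhom_lmap zhom_ext g)
  have sq: "?a i (?a i z) = 0" if i: "i \<in> I" for i z
    by (simp add: lmap_lmap zhom_ext i g ext_contract_square zhom_xd lmap_zero_left zhom_comp[OF g g])
  have anti: "?a i (?a j z) + ?a j (?a i z) = 0" if ij: "i \<in> I" "j \<in> I" for i j z
  proof -
    have "?a i (?a j z) + ?a j (?a i z)
      = lmap (\<lambda>a. ext_contract (xd i) (ext_contract (xd j) a) + ext_contract (xd j) (ext_contract (xd i) a))
          (\<lambda>b. g i (g j b)) z"
      by (subst lmap_plus_left)
         (simp_all add: lmap_lmap zhom_ext ij g zhom_comp[OF g g] zhom_comp[OF zhom_ext zhom_ext] comm[of j i])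
    also have "\<dots> = 0"
      by (simp add: ext_contract_anticommute zhom_xd ij lmap_zero_left zhom_comp[OF g g])
    finally show ?thesis .
  qed
  have "finite J" using J finite_I finite_subset by blast
  then show ?thesis using J
  proof (induction rule: finite_induct)
    case empty
    show ?case by (simp add: koz_def)
  next
    case (insert i J)
    then have i: "i \<in> I" and J: "J \<subseteq> I" by simp_all
    have k: "koz (insert i J) g z = ?a i z + koz J g z" for z
      using insert.hyps by (simp add: koz_def)
    have "?a i (koz J g z) + koz J g (?a i z) = (\<Sum>j\<in>J. ?a i (?a j z) + ?a j (?a i z))"
      by (simp add: koz_def zhom_sum[OF za[OF i]] sum.distrib)
    also have "\<dots> = 0" using anti[OF i] J by (intro sum.neutral) auto
    finally have 0: "?a i (koz J g z) + koz J g (?a i z) = 0" .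
    have "koz (insert i J) g (koz (insert i J) g z)
        = ?a i (?a i z) + (?a i (koz J g z) + koz J g (?a i z)) + koz J g (koz J g z)"
      unfolding k by (simp add: zhom_add[OF za[OF i]] zhom_add[OF zhom_koz[OF J g]] algebra_simps)
    then show ?case using sq[OF i] 0 insert.IH[OF J] by simp
  qed
qed

text \<open>The graded Leibniz rule for multiplication by \<open>x k\<close>\<close>

lemma koz_wedge_left:
  assumes k: "k \<in> I" and g: "\<And>i. i \<in> I \<Longrightarrow> zhom (g i)"
  shows "koz I g (lmap (wedge_left (x k)) (\<lambda>b. b) z)
    = lmap (\<lambda>a. a) (g k) z - lmap (wedge_left (x k)) (\<lambda>b. b) (koz I g z)"
proof -
  let ?W = "lmap (wedge_left (x k)) (\<lambda>b. b)"
  have "lmap (ext_contract (xd i)) (g i) (?W z)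
      = (if i = k then lmap (\<lambda>a. a) (g k) z else 0) - ?W (lmap (ext_contract (xd i)) (g i) z)"
    if i: "i \<in> I" for i
  proof -
    have "lmap (ext_contract (xd i)) (g i) (?W z)
      = lmap (\<lambda>a. (if i = k then a else 0) - wedge_left (x k) (ext_contract (xd i) a)) (g i) z"
      by (subst lmap_lmap)
         (simp_all add: zhom_ext i g zhom_wedge_left ext_contract_wedge_left zhom_xd xd_x k if_distribR
            if_distrib[of "\<lambda>t. zmul t _"] cong: if_cong)
    also have "\<dots> = lmap (\<lambda>a. if i = k then a else 0) (g i) z - lmap (\<lambda>a. wedge_left (x k) (ext_contract (xd i) a)) (g i) z"
      by (rule lmap_minus_left[OF _ g[OF i]]) (auto simp: i additive_def zhom_add[OF zhom_wedge_left] zhom_add[OF zhom_ext])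
    also have "lmap (\<lambda>a. wedge_left (x k) (ext_contract (xd i) a)) (g i) z = ?W (lmap (ext_contract (xd i)) (g i) z)"
      by (simp add: lmap_lmap zhom_ext i g zhom_wedge_left)
    finally show ?thesis using g[OF i] by (cases "i = k") (simp_all add: lmap_zero_left)
  qed
  then have "koz I g (?W z) = (\<Sum>i\<in>I. if i = k then lmap (\<lambda>a. a) (g k) z else 0)
      - (\<Sum>i\<in>I. ?W (lmap (ext_contract (xd i)) (g i) z))"
    by (simp add: koz_def sum_subtractf)
  also have "\<dots> = lmap (\<lambda>a. a) (g k) z - ?W (koz I g z)"
    using k finite_I by (simp add: koz_def zhom_sum[OF zhom_lmap[OF zhom_wedge_left zhom_ident(1)]])
  finally show ?thesis .
qed

lemma koz_lmap_right:
  assumes J: "J \<subseteq> I" and g: "\<And>i. i \<in> I \<Longrightarrow> zhom (g i)" "\<And>i. i \<in> I \<Longrightarrow> zhom (g' i)" and h: "zhom h"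
    and c: "\<And>i b. i \<in> J \<Longrightarrow> h (g i b) = g' i (h b)"
  shows "lmap (\<lambda>a. a) h (koz J g z) = koz J g' (lmap (\<lambda>a. a) h z)"
  unfolding koz_def zhom_sum[OF zhom_lmap[OF zhom_ident(1) h]]
proof (rule sum.cong[OF refl])
  fix i assume i: "i \<in> J"
  then have "i \<in> I" using J by blast
  then show "lmap (\<lambda>a. a) h (lmap (ext_contract (xd i)) (g i) z)
      = lmap (ext_contract (xd i)) (g' i) (lmap (\<lambda>a. a) h z)"
    using i by (simp add: lmap_lmap zhom_ext g h c)
qed

text \<open>On exterior forms that do not involve \<open>x k\<close> the summand with index \<open>k\<close> is zero, and the others do not
  introduce \<open>x k\<close>.\<close>

lemma koz_wprj:
  assumes k: "k \<in> I" and g: "\<And>i. i \<in> I \<Longrightarrow> zhom (g i)"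
  shows "koz I g (lmap (splitting.wprj (x k) (xd k)) (\<lambda>b. b) z)
      = koz (I - {k}) g (lmap (splitting.wprj (x k) (xd k)) (\<lambda>b. b) z)"
    and "lmap (splitting.wprj (x k) (xd k)) (\<lambda>b. b)
        (koz I g (lmap (splitting.wprj (x k) (xd k)) (\<lambda>b. b) z))
      = koz I g (lmap (splitting.wprj (x k) (xd k)) (\<lambda>b. b) z)"
proof -
  interpret splitting "x k" "xd k" by (rule splitting[OF k])
  let ?A = "lmap wprj (\<lambda>b. b)"
  have "lmap (ext_contract (xd k)) (g k) (?A z) = 0"
    by (simp add: lmap_lmap zhom_ext k g zhom_wprj contract_wprj lmap_zero_left)
  then show 1: "koz I g (?A z) = koz (I - {k}) g (?A z)"
    using k finite_I by (simp add: koz_def sum.remove)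
  have "?A (lmap (ext_contract (xd i)) (g i) (?A z)) = lmap (ext_contract (xd i)) (g i) (?A z)"
    if i: "i \<in> I - {k}" for i
  proof -
    have w: "wprj (ext_contract (xd i) (wprj a)) = ext_contract (xd i) (wprj a)" for a
      using i k by (subst wprj_contract) (auto simp: zhom_xd xd_x wprj_wprj)
    show ?thesis using i
      by (simp add: lmap_lmap zhom_ext g zhom_wprj w zhom_comp[OF zhom_ext zhom_wprj])
  qed
  then show "?A (koz I g (?A z)) = koz I g (?A z)"
    unfolding 1 by (simp add: koz_def zhom_sum[OF zhom_lmap[OF zhom_wprj zhom_ident(1)]])
qed

lemma opm_koz:
  assumes J: "J \<subseteq> I" and F: "zhom F" and g: "\<And>i. i \<in> I \<Longrightarrow> zhom (g i)" "\<And>i. i \<in> I \<Longrightarrow> zhom (g' i)"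
    and c: "\<And>i \<mu>. i \<in> I \<Longrightarrow> F (g i \<mu>) = rmap (g' i) (F \<mu>)"
  shows "opm F (koz J g z) = koz J g' (opm F z)"
  unfolding koz_def zhom_sum[OF zhom_opm[OF F]]
  by (rule sum.cong[OF refl], rule opm_intertwine) (use J in \<open>auto simp: F g c zhom_ext\<close>)

end

section \<open>The maps \<open>\<tau>\<^sub>r\<close>\<close>

lemma rmap_ident: "rmap (\<lambda>b. b) z = z"
  by (rule tensor_zhom_eqI[OF zhom_rmap]) (simp_all add: rmap_tens)

context inverse_system
begin

subsection \<open>Relations between the operators\<close>

text \<open>On the exterior factor, \<open>W\<close> is multiplication by \<open>x\<^sub>1\<close>, \<open>A\<close> is the projection onto forms free of
  \<open>x\<^sub>1\<close>, and \<open>C\<close> is contraction by \<open>x\<^sub>1\<^sup>*\<close>.\<close>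

abbreviation W where "W \<equiv> lmap (wedge_left (x 1)) (\<lambda>b. b)"
abbreviation A where "A \<equiv> lmap one.wprj (\<lambda>b. b)"
abbreviation C where "C \<equiv> lmap (ext_contract (xd 1)) (\<lambda>b. b)"

text \<open>On the second factor, \<open>X1S\<close> and \<open>X1D\<close> are the actions of \<open>x\<^sub>1\<close> on \<open>Sym U\<close> and on \<open>D(U\<^sup>*)\<close>, while \<open>Pm\<close>
  takes the part free of \<open>x\<^sub>1\<close> and \<open>Dm\<close> divides the rest by \<open>x\<^sub>1\<close>.\<close>

abbreviation X1S where "X1S \<equiv> lmap (\<lambda>a. a) ((*) (sym_of (x 1)))"
abbreviation X1D where "X1D \<equiv> lmap (\<lambda>a. a) (contract (sym_of (x 1)))"
abbreviation Pm where "Pm \<equiv> lmap (\<lambda>a. a) one.rho"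
abbreviation Dm where "Dm \<equiv> lmap (\<lambda>a. a) one.del"

text \<open>\<open>KS\<close> and \<open>KD\<close> are \<open>\<kappa>\<close> and \<open>\<eta>\<close> for \<open>U\<close>.\<close>

abbreviation KS where "KS \<equiv> koz {1..d} (\<lambda>i. (*) (sym_of (x i)))"
abbreviation KD where "KD \<equiv> koz {1..d} (\<lambda>i. contract (sym_of (x i)))"

text \<open>The maps \<open>\<theta> \<otimes> \<mu> \<mapsto> \<theta> \<otimes> \<mu>(\<Phi>)\<close>, its analogue for the lift of \<open>\<Phi>\<close>, and \<open>\<theta> \<otimes> \<nu> \<mapsto> \<theta> \<otimes> q(\<nu>)\<close>. In degree
  \<open>n\<close> of \<open>Sym U\<close> the map \<open>V\<close> restricts to the map that cuts out \<open>G\<^sub>r\<close>, in degree \<open>n - 1\<close> it is given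
  by \<open>p\<close>.\<close>

abbreviation V where "V \<equiv> opm pm"
abbreviation Vt where "Vt \<equiv> opm (\<lambda>\<mu>. rcontract \<mu> PHIT)"
abbreviation Q where "Q \<equiv> opm qm"

lemma one_in: "1 \<in> {1..d}" using d by simp

lemma xd1: "zhom (xd 1)" by (rule zhom_xd[OF one_in])

lemmas zhoms = zhom_wedge_left one.zhom_wprj zhom_ext_contract[OF xd1] zhom_ident(1)
  zhom_mult_left zhom_contract one.zhom_rho one.zhom_del

lemmas zhom_W = zhom_lmap[OF zhom_wedge_left zhom_ident(1)]
  and zhom_A = zhom_lmap[OF one.zhom_wprj zhom_ident(1)]
  and zhom_C = zhom_lmap[OF zhom_ext_contract[OF xd1] zhom_ident(1)]
  and zhom_X1S = zhom_lmap[OF zhom_ident(1) zhom_mult_left]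
  and zhom_X1D = zhom_lmap[OF zhom_ident(1) zhom_contract]
  and zhom_Pm = zhom_lmap[OF zhom_ident(1) one.zhom_rho]
  and zhom_Dm = zhom_lmap[OF zhom_ident(1) one.zhom_del]
  and zhom_KS = zhom_koz[OF subset_refl zhom_mult_left]
  and zhom_KD = zhom_koz[OF subset_refl zhom_contract]
  and zhom_V = zhom_opm[OF zhom_pm]
  and zhom_Vt = zhom_opm[OF zhom_rcontract_left]
  and zhom_Q = zhom_opm[OF zhom_qm]

lemma A_W: "A (W z) = 0"
  by (simp add: lmap_lmap zhoms one.wprj_e lmap_zero_left)

lemma C_W: "C (W z) = z - W (C z)"
proof -
  have "C (W z) = lmap (\<lambda>a. a - wedge_left (x 1) (ext_contract (xd 1) a)) (\<lambda>b. b) z"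
    by (simp add: lmap_lmap zhoms one.contract_e)
  also have "\<dots> = z - lmap (\<lambda>a. wedge_left (x 1) (ext_contract (xd 1) a)) (\<lambda>b. b) z"
    by (subst lmap_minus_left) (simp_all add: zhoms zhom_comp[OF zhom_wedge_left zhom_ext_contract[OF xd1]] lmap_ident)
  finally show ?thesis by (simp add: lmap_lmap zhoms)
qed

lemma C_A: "C (A z) = 0"
  by (simp add: lmap_lmap zhoms one.contract_wprj lmap_zero_left)

lemma A_split: "A z + W (C z) = z"
proof -
  have "A z + W (C z) = A z + lmap (\<lambda>a. wedge_left (x 1) (ext_contract (xd 1) a)) (\<lambda>b. b) z"
    by (simp add: lmap_lmap zhoms)
  also have "\<dots> = lmap (\<lambda>a. one.wprj a + wedge_left (x 1) (ext_contract (xd 1) a)) (\<lambda>b. b) z"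
    by (rule lmap_plus_left[symmetric]) (simp_all add: zhoms zhom_comp[OF zhom_wedge_left zhom_ext_contract[OF xd1]])
  also have "\<dots> = z" by (simp add: one.wprj_split lmap_ident)
  finally show ?thesis .
qed

lemma A_C: "A (C z) = C z"
proof -
  have "C (C z) = 0"
    by (simp add: lmap_lmap zhoms ext_contract_square xd1 lmap_zero_left)
  then show ?thesis using A_split[of "C z"] by (simp add: zhom_zero[OF zhom_W])
qed

lemma A_lmap_right: "zhom g \<Longrightarrow> A (lmap (\<lambda>a. a) g z) = lmap (\<lambda>a. a) g (A z)"
  by (simp add: lmap_lmap zhoms)

lemma A_A: "A (A z) = A z"
  by (simp add: lmap_lmap zhoms one.wprj_wprj)

lemma A_fixed: "z \<in> base_change (tens_span (ext_pow U0 a) B) \<Longrightarrow> A z = z"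
  by (erule base_change_tens_span_eqI[OF _ zhom_A zhom_ident(1)])
     (simp add: lmap_tens zhoms one.wprj_ker)

lemma A_koz:
  assumes g: "\<And>i. i \<in> {1..d} \<Longrightarrow> zhom (g i)" and z: "A z = z"
  shows "koz {1..d} g z = koz {2..d} g z" and "A (koz {1..d} g z) = koz {1..d} g z"
proof -
  have e: "{1..d} - {1} = {2..d}" by auto
  show "koz {1..d} g z = koz {2..d} g z" and "A (koz {1..d} g z) = koz {1..d} g z"
    using koz_wprj[OF one_in g, where z = z] unfolding z e by simp_all
qed

lemma KS_W: "KS (W z) = X1S z - W (KS z)"
  by (rule koz_wedge_left[OF one_in zhom_mult_left])

lemma KD_W: "KD (W z) = X1D z - W (KD z)"
  by (rule koz_wedge_left[OF one_in zhom_contract])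

lemma KS_X1S: "KS (X1S z) = X1S (KS z)"
  by (rule koz_lmap_right[symmetric]) (simp_all add: zhoms mult.left_commute)

lemma KS_KS: "KS (KS z) = 0"
  by (rule koz_koz) (simp_all add: zhoms mult.left_commute)

lemma Pm_split: "Pm z + X1S (Dm z) = z"
proof -
  have "Pm z + X1S (Dm z) = lmap (\<lambda>a. a) (\<lambda>b. one.rho b + sym_of (x 1) * one.del b) z"
    by (subst lmap_plus_right) (simp_all add: lmap_lmap zhoms zhom_comp[OF zhom_mult_left one.zhom_del])
  then show ?thesis by (simp add: one.rho_del lmap_ident)
qed

lemma Pm_X1S: "Pm (X1S z) = 0"
  by (simp add: lmap_lmap zhoms one.rho_mult one.rho_e lmap_zero_right)

lemma Pm_Pm: "Pm (Pm z) = Pm z"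
  by (simp add: lmap_lmap zhoms one.rho_rho)

lemma Dm_X1S: "Dm (X1S z) = z"
  by (simp add: lmap_lmap zhoms one.del_e lmap_ident)

lemma Pm_fixed: "z \<in> base_change (tens_span B (sym_pow U0 b)) \<Longrightarrow> Pm z = z"
  by (erule base_change_tens_span_eqI[OF _ zhom_Pm zhom_ident(1)])
     (simp add: lmap_tens zhoms one.rho_ker)

lemma Pm_koz:
  "Pm (koz {2..d} (\<lambda>i. (*) (sym_of (x i))) z) = koz {2..d} (\<lambda>i. (*) (sym_of (x i))) (Pm z)"
  using d by (intro koz_lmap_right) (auto simp: zhoms xd_x intro!: one.rho_sym_of_ker)

lemma V_KS: "V (KS z) = KD (V z)"
  by (rule opm_koz)
     (auto simp: zhoms zhom_pm p_map_def rcontract_mult mult.commute simp flip: rcontract_def)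

lemma Vt_KS: "Vt (KS z) = KD (Vt z)"
  by (rule opm_koz)
     (auto simp: zhoms zhom_rcontract_left rcontract_mult mult.commute simp flip: rcontract_def)

lemma opm_lmap_left: "zhom F \<Longrightarrow> zhom f \<Longrightarrow> opm F (lmap f (\<lambda>b. b) z) = lmap f (\<lambda>b. b) (opm F z)"
  by (rule opm_intertwine) (simp_all add: rmap_ident)

lemmas V_W = opm_lmap_left[OF zhom_pm zhom_wedge_left]
  and V_A = opm_lmap_left[OF zhom_pm one.zhom_wprj]
  and Vt_A = opm_lmap_left[OF zhom_rcontract_left one.zhom_wprj]
  and Q_A = opm_lmap_left[OF zhom_qm one.zhom_wprj]

lemma X1D_Vt: "X1D (Vt z) = V z"
proof -
  have "rmap (contract (sym_of (x 1))) (rcontract \<mu> PHIT) = pm \<mu>" for \<mu>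
    unfolding p_map_def x1_Phi_tilde[symmetric] rcontract_mult
    by (simp add: rcontract_mult mult.commute flip: rcontract_def)
  then show ?thesis by (simp add: lmap_opm zhom_rcontract_left zhom_contract)
qed

lemma V_Q:
  "z \<in> base_change (tens_span B (dpow_deg (CARD('n) - 1))) \<Longrightarrow> V (Q z) = tscale dlt z"
  unfolding opm_opm[OF zhom_pm zhom_qm]
  by (erule opm_scalar[OF _ zhom_comp[OF zhom_rext[OF zhom_pm] zhom_qm]]) (rule pm_qm)

lemma Q_V:
  "z \<in> base_change (tens_span B (sym_pow UNIV (CARD('n) - 1))) \<Longrightarrow> Q (V z) = tscale dlt z"
  unfolding opm_opm[OF zhom_qm zhom_pm]
  by (erule opm_scalar[OF _ zhom_comp[OF zhom_rext[OF zhom_qm] zhom_pm]]) (rule qm_pm)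

lemma V_in:
  "z \<in> base_change (tens_span B (sym_pow UNIV (CARD('n) - 1))) \<Longrightarrow>
    V z \<in> base_change (tens_span B (dpow_deg (CARD('n) - 1)))"
  by (erule opm_in_base_change[OF zhom_pm]) (rule pm_degree)

lemma Vt_in:
  assumes "z \<in> base_change (tens_span B (sym_pow U0 (CARD('n))))"
  shows "Vt z \<in> base_change (tens_span B (dpow_deg (CARD('n) - 1)))"
proof (rule opm_in_base_change[OF zhom_rcontract_left assms])
  fix \<mu> assume \<mu>: "\<mu> \<in> sym_pow U0 (CARD('n))"
  have "CARD('n) + (CARD('n) - 1) = 2 * CARD('n) - 1" by simp
  then have "PHIT \<in> base_change (dpow_deg (CARD('n) + (CARD('n) - 1)))" using Phi_tilde_degree by simp
  moreover have "\<mu> \<in> sym_pow UNIV (CARD('n))" using \<mu> sym_pow_mono[of U0 UNIV] by blast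
  ultimately show "rcontract \<mu> PHIT \<in> base_change (dpow_deg (CARD('n) - 1))"
    by (rule R.rcontract_in_base_change)
qed

lemma Q_in:
  "z \<in> base_change (tens_span B (dpow_deg (CARD('n) - 1))) \<Longrightarrow>
    Q z \<in> base_change (tens_span B (sym_pow UNIV (CARD('n) - 1)))"
  by (erule opm_in_base_change[OF zhom_qm]) (rule qm_degree)

lemma KS_W_in:
  assumes z: "z \<in> base_change (tens_span (ext_pow U0 a) (sym_pow UNIV b))"
  shows "KS (W z) \<in> base_change (tens_span (ext_pow UNIV a) (sym_pow UNIV (Suc b)))"
  unfolding koz_def
proof (intro zmod.subspace_sum[OF base_change_subspace])
  fix i assume i: "i \<in> {1..d}"
  have "W z \<in> base_change (tens_span (ext_pow UNIV (Suc a)) (sym_pow UNIV b))"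
  proof (rule lmap_in_base_change[OF zhom_wedge_left zhom_ident(1) z])
    fix \<theta> assume "\<theta> \<in> ext_pow U0 a"
    then have "\<theta> \<in> ext_pow UNIV a" using ext_pow_mono[of U0 UNIV] by blast
    then show "wedge_left (x 1) \<theta> \<in> ext_pow UNIV (Suc a)" by (rule wedge_left_in_ext_pow) simp
  qed
  then show "lmap (ext_contract (xd i)) ((*) (sym_of (x i))) (W z)
      \<in> base_change (tens_span (ext_pow UNIV a) (sym_pow UNIV (Suc b)))"
  proof (rule lmap_in_base_change[OF zhom_ext[OF i] zhom_mult_left])
    fix \<mu> :: "'u sym" assume "\<mu> \<in> sym_pow UNIV b"
    from sym_pow_mult[OF sym_of_in_sym_pow[of "x i", OF UNIV_I] this]
    show "sym_of (x i) * \<mu> \<in> sym_pow UNIV (Suc b)" by (simp add: One_nat_def)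
  qed (rule ext_contract_in_ext_pow[OF zhom_xd[OF i]])
qed

subsection \<open>The modules\<close>

lemma kappa_zhom: "J \<subseteq> {1..d} \<Longrightarrow> zhom (kappa J x xd)"
  by (rule additive_kappa) (use zhom_xd in blast)

lemma eta_zhom: "J \<subseteq> {1..d} \<Longrightarrow> zhom (eta J x xd)"
  by (rule additive_eta) (use zhom_xd in blast)

lemma base_change_L_mod:
  assumes "J \<subseteq> {1..d}"
  shows "(z :: (('u, 'n) RR, _) tensor) \<in> base_change (L_mod J x xd U a b) \<longleftrightarrow>
    z \<in> base_change (tens_span (ext_pow U a) (sym_pow U b)) \<and>
    koz J (\<lambda>i. (*) (sym_of (x i))) z = 0"
  unfolding L_mod_def R.base_change_ker[OF tens_span_subspace kappa_zhom[OF assms]]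
  by (simp add: rmap_kappa[OF assms])

lemma base_change_K_mod0:
  assumes "J \<subseteq> {1..d}"
  shows "(z :: (('u, 'n) RR, _) tensor) \<in> base_change (K_mod0 J x xd e U a b) \<longleftrightarrow>
    z \<in> base_change (tens_span (ext_pow U a) (dpow_deg0 e b)) \<and>
    koz J (\<lambda>i. contract (sym_of (x i))) z = 0"
  unfolding K_mod0_def R.base_change_ker[OF tens_span_subspace eta_zhom[OF assms]]
  by (simp add: rmap_eta[OF assms])

lemma L_mod_subspace: "J \<subseteq> {1..d} \<Longrightarrow> zmod.subspace (L_mod J x xd U a b)"
  unfolding L_mod_def by (intro subspace_ker kappa_zhom tens_span_subspace)

lemma K_mod0_subspace: "J \<subseteq> {1..d} \<Longrightarrow> zmod.subspace (K_mod0 J x xd e U a b)"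
  unfolding K_mod0_def by (intro subspace_ker eta_zhom tens_span_subspace)

lemma finitely_separated_ext_pow': "finitely_separated (ext_pow (U :: 'u set) a)"
  by (rule finitely_separated_subset[OF finitely_separated_ext_pow ext_pow_mono]) simp

lemma finitely_separated_sym_pow': "finitely_separated (sym_pow (U :: 'u set) a)"
  by (rule finitely_separated_subset[OF finitely_separated_sym_pow sym_pow_mono]) simp

lemma finitely_separated_dpow_deg0: "finitely_separated (dpow_deg0 (e :: 'u) a)"
  by (rule finitely_separated_subset[OF finitely_separated_dpow_deg]) (auto simp: dpow_deg0_def)

lemma finitely_separated_L_mod: "finitely_separated (L_mod J x xd U a b)"
  by (rule finitely_separated_subset[OF finitely_separated_tens_span[OF
        finitely_separated_ext_pow' ext_pow_subspace finitely_separated_sym_pow' sym_pow_subspace]])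
     (auto simp: L_mod_def)

lemma finitely_separated_K_mod0: "finitely_separated (K_mod0 J x xd e U a b)"
  by (rule finitely_separated_subset[OF finitely_separated_tens_span[OF
        finitely_separated_ext_pow' ext_pow_subspace finitely_separated_dpow_deg0 dpow_deg0_subspace]])
     (auto simp: K_mod0_def)

subsection \<open>The structure of \<open>G\<^sub>r\<close>\<close>

text \<open>After base change, \<open>L\<^sub>a\<^sub>,\<^sub>b\<^sub>+\<^sub>1 U\<close> is the sum of \<open>L\<^sub>a\<^sub>,\<^sub>b\<^sub>+\<^sub>1 U\<^sub>0\<close> and the image of \<open>\<And>\<^sup>a U\<^sub>0 \<otimes> Sym\<^sub>b U\<close>
  under \<open>\<theta> \<otimes> \<mu> \<mapsto> \<kappa>((x\<^sub>1 \<and> \<theta>) \<otimes> \<mu>)\<close>.\<close>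

lemma L_decomposition:
  fixes z :: "(('u, 'n) RR, ('u ext, 'u sym) tensor) tensor"
  assumes z: "z \<in> base_change (tens_span (ext_pow UNIV a) (sym_pow UNIV (Suc b)))" and 0: "KS z = 0"
  obtains b0 b1 where "b0 \<in> base_change (tens_span (ext_pow U0 a) (sym_pow U0 (Suc b)))" "KS b0 = 0"
    "b1 \<in> base_change (tens_span (ext_pow U0 a) (sym_pow UNIV b))" "z = b0 + KS (W b1)"
proof -
  define \<beta> where "\<beta> = A z"
  define b0 where "b0 = Pm \<beta>"
  define b1 where "b1 = Dm \<beta>"
  have \<beta>: "A \<beta> = \<beta>" by (simp add: \<beta>_def A_A)
  have zs: "z = \<beta> + W (C z)" by (simp add: \<beta>_def A_split)
  have \<beta>s: "\<beta> = b0 + X1S b1" by (simp add: b0_def b1_def Pm_split)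
  have Ab0: "A b0 = b0" by (simp add: b0_def A_lmap_right zhoms \<beta>)
  have in\<beta>: "\<beta> \<in> base_change (tens_span (ext_pow U0 a) (sym_pow UNIV (Suc b)))"
    unfolding \<beta>_def
    by (rule lmap_in_base_change[OF one.zhom_wprj zhom_ident(1) z])
       (auto intro: one.wprj_in_ext_pow simp: one.f_prj)
  have in0: "b0 \<in> base_change (tens_span (ext_pow U0 a) (sym_pow U0 (Suc b)))"
    unfolding b0_def
    by (rule lmap_in_base_change[OF zhom_ident(1) one.zhom_rho in\<beta>]) (auto intro: one.rho_in_sym_pow)
  have in1: "b1 \<in> base_change (tens_span (ext_pow U0 a) (sym_pow UNIV b))"
    unfolding b1_def
    by (rule lmap_in_base_change[OF zhom_ident(1) one.zhom_del in\<beta>]) (auto intro: one.del_in_sym_pow)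
  \<comment> \<open>Compare the parts of \<open>\<kappa> z = 0\<close> without \<open>x\<^sub>1\<close>, first in the exterior and then in the symmetric factor.\<close>
  have "KS z = KS \<beta> + (X1S (C z) - W (KS (C z)))"
    by (subst zs) (simp add: zhom_add[OF zhom_KS] KS_W)
  then have "A (KS \<beta> + (X1S (C z) - W (KS (C z)))) = 0" by (simp add: 0 zhom_zero[OF zhom_A])
  then have 1: "KS \<beta> + X1S (C z) = 0"
    by (simp add: zhom_add[OF zhom_A] zhom_diff[OF zhom_A] A_W A_lmap_right zhoms A_C
        A_koz(2)[OF zhom_mult_left \<beta>])
  then have 2: "KS b0 + X1S (KS b1) + X1S (C z) = 0"
    by (simp add: \<beta>s zhom_add[OF zhom_KS] KS_X1S)
  have "Pm (KS b0) = KS b0"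
    unfolding A_koz(1)[OF zhom_mult_left Ab0] Pm_koz by (simp add: b0_def Pm_Pm)
  then have k0: "KS b0 = 0"
    using arg_cong[OF 2, of Pm] by (simp add: zhom_add[OF zhom_Pm] Pm_X1S zhom_zero[OF zhom_Pm])
  then have "X1S (KS b1 + C z) = 0" using 2 by (simp add: zhom_add[OF zhom_X1S])
  then have "KS b1 + C z = 0" using Dm_X1S[of "KS b1 + C z"] by (simp add: zhom_zero[OF zhom_Dm])
  then have "C z = - KS b1" by (simp add: eq_neg_iff_add_eq_0 add.commute)
  then have "z = b0 + X1S b1 - W (KS b1)"
    using zs by (simp add: \<beta>s zhom_minus[OF zhom_W])
  then have "z = b0 + KS (W b1)" by (simp add: KS_W algebra_simps)
  with in0 k0 in1 show thesis by (rule that)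
qed

text \<open>If \<open>z = b0 + KS (W b1)\<close> is killed by \<open>V\<close>, then \<open>g = V b1 + Vt b0\<close> is annihilated by \<open>x\<^sub>1\<close> and by
  \<open>\<eta>\<close>. The pair \<open>(g, b0)\<close> is an element of \<open>B\<^sub>r\<close>, and it will be seen that \<open>\<tau>\<^sub>r (g, b0) = \<delta>\<^sup>r z\<close>.\<close>

lemma V_kernel:
  assumes b0: "b0 \<in> base_change (tens_span (ext_pow U0 a) (sym_pow U0 (CARD('n))))" "KS b0 = 0"
    and b1: "b1 \<in> base_change (tens_span (ext_pow U0 a) (sym_pow UNIV (CARD('n) - 1)))"
    and v: "V (b0 + KS (W b1)) = 0"
  shows "V b1 + Vt b0 \<in> base_change (K_mod0 {2..d} x xd (x 1) U0 a (CARD('n) - 1))"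
proof -
  let ?g = "V b1" and ?g' = "V b1 + Vt b0"
  have A: "A ?g = ?g" "A ?g' = ?g'"
    by (simp_all add: zhom_add[OF zhom_A] A_fixed[OF b0(1)] A_fixed[OF b1] flip: V_A Vt_A)
  have "V (b0 + KS (W b1)) = X1D (Vt b0) + (X1D ?g - W (KD ?g))"
    by (simp add: zhom_add[OF zhom_V] X1D_Vt V_KS V_W KD_W)
  then have 1: "X1D ?g' - W (KD ?g) = 0" using v by (simp add: zhom_add[OF zhom_X1D] algebra_simps)
  have "A (X1D ?g' - W (KD ?g)) = X1D ?g'"
    by (simp only: zhom_diff[OF zhom_A] A_W A_lmap_right[OF zhom_contract] A diff_zero)
  then have x1: "X1D ?g' = 0" using 1 by (simp add: zhom_zero[OF zhom_A])
  then have "W (KD ?g) = 0" using 1 by simp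
  moreover have "C (KD ?g) = 0"
    using C_A[of "KD ?g"] A_koz(2)[OF zhom_contract A(1)] by simp
  ultimately have "KD ?g = 0" using C_W[of "KD ?g"] by (simp add: zhom_zero[OF zhom_C] zhom_zero[OF zhom_W])
  moreover have "KD (Vt b0) = 0" by (simp add: b0(2) zhom_zero[OF zhom_Vt] flip: Vt_KS)
  ultimately have "KD ?g' = 0" by (simp add: zhom_add[OF zhom_KD])
  then have kd: "koz {2..d} (\<lambda>i. contract (sym_of (x i))) ?g' = 0"
    using A_koz(1)[OF zhom_contract A(2)] by simp
  have g: "?g' \<in> base_change (tens_span (ext_pow U0 a) (dpow_deg (CARD('n) - 1)))"
    by (intro zmod.subspace_add[OF base_change_subspace] V_in b1 Vt_in b0(1))
  \<comment> \<open>An element of \<open>D(U\<^sup>*)\<close> annihilated by \<open>x\<^sub>1\<close> is fixed by the transpose of \<open>rho\<close>.\<close>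
  have "?g' = lmap (\<lambda>a. a) (\<lambda>\<nu>. one.drho \<nu> + one.ddel (contract (sym_of (x 1)) \<nu>)) ?g'"
    by (simp add: one.dpow_split lmap_ident)
  also have "\<dots> = lmap (\<lambda>a. a) one.drho ?g' + lmap (\<lambda>a. a) one.ddel (X1D ?g')"
    by (simp add: lmap_plus_right lmap_lmap zhoms one.zhom_drho one.zhom_ddel
        zhom_comp[OF one.zhom_ddel zhom_contract])
  also have "\<dots> = lmap (\<lambda>a. a) one.drho ?g'"
    by (simp add: x1 zhom_zero[OF zhom_lmap[OF zhom_ident(1) one.zhom_ddel]])
  also have "\<dots> \<in> base_change (tens_span (ext_pow U0 a) (dpow_deg0 (x 1) (CARD('n) - 1)))"
    by (rule lmap_in_base_change[OF zhom_ident(1) one.zhom_drho g]) (auto intro: one.drho_in_dpow_deg0)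
  finally show ?thesis using kd base_change_K_mod0[of "{2..d}"] by (simp add: subset_iff)
qed

text \<open>The sum in the decomposition of \<open>L\<^sub>a\<^sub>,\<^sub>b\<^sub>+\<^sub>1 U\<close> is direct, and the map onto its second summand is
  injective.\<close>

lemma KS_W_injective:
  assumes "A u = u" "A w = w" "Pm w = w" "KS (W u) + w = 0"
  shows "u = 0" "w = 0"
proof -
  have "A (X1S u - W (KS u) + w) = 0" using assms(4) by (simp add: KS_W zhom_zero[OF zhom_A])
  then have 1: "X1S u + w = 0"
    by (simp add: zhom_add[OF zhom_A] zhom_diff[OF zhom_A] A_W A_lmap_right zhoms assms(1,2))
  have "Pm (X1S u + w) = w" by (simp add: zhom_add[OF zhom_Pm] Pm_X1S assms(3))
  with 1 show w: "w = 0" by (simp add: zhom_zero[OF zhom_Pm])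
  have "Dm (X1S u) = 0" using 1 w by (simp add: zhom_zero[OF zhom_Dm])
  then show "u = 0" by (simp add: Dm_X1S)
qed

end

context inverse_system
begin

subsection \<open>The maps in terms of the operators\<close>

lemma v_map_eq: "v_map z = V z"
  by (simp add: v_map_def opm_def p_map_def)

lemma biadditive_tens_left:
  assumes "zhom h" "zhom F"
  shows "biadditive (\<lambda>\<theta> \<mu>. h (tens_left (wedge_left (x 1) \<theta>) (F \<mu>)))"
  unfolding biadditive_def
  by (intro conjI allI zhom_comp[OF assms(1)] zhom_comp[OF zhom_tens_left_left zhom_wedge_left]
      zhom_comp[OF zhom_tens_left assms(2)])

lemma kappa_UNIV: "rmap (kappa {1..d} x xd) z = KS z"
  by (rule rmap_kappa) simp

lemma KS_tscale: "KS (tscale r z) = tscale r (KS z)"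
  by (rule koz_tscale[OF subset_refl zhom_mult_left])

lemma W_tens_left: "W (tens_left \<theta> y) = tens_left (wedge_left (x 1) \<theta>) y"
  by (simp add: lmap_tens_left zhoms rmap_ident)

lemma tau_K_eq: "tau_K d x xd ms r y = tscale (dlt ^ (r - 1)) (KS (W (Q y)))"
proof -
  let ?f = "\<lambda>\<theta> \<nu>. tscale (dlt ^ (r - 1)) (KS (tens_left (wedge_left (x 1) \<theta>) (qm \<nu>)))"
  have b: "biadditive ?f"
    by (rule biadditive_tens_left[OF zhom_comp[OF zhom_tscale zhom_KS] zhom_qm])
  have t: "tau_K d x xd ms r = rext (tensor_lift ?f)"
    by (simp add: tau_K_def kappa_UNIV)
  show ?thesis
    unfolding t
  proof (rule tensor_zhom_eqI3[OF zhom_rext[OF additive_tensor_lift[OF b]]])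
    show "zhom (\<lambda>y. tscale (dlt ^ (r - 1)) (KS (W (Q y))))"
      by (intro zhom_comp[OF zhom_tscale] zhom_comp[OF zhom_KS] zhom_comp[OF zhom_W zhom_Q])
  next
    fix s :: "('u, 'n) RR" and \<theta> :: "'u ext" and \<nu> :: "'u dpow"
    show "rext (tensor_lift ?f) (s \<otimes>\<^sub>t (\<theta> \<otimes>\<^sub>t \<nu>)) = tscale (dlt ^ (r - 1)) (KS (W (Q (s \<otimes>\<^sub>t (\<theta> \<otimes>\<^sub>t \<nu>)))))"
      by (simp add: rext_tens[OF additive_tensor_lift[OF b]] tensor_lift_tens[OF b] opm_tens zhom_qm
          lmap_tscale zhoms W_tens_left KS_tscale mult.commute)
  qed
qed

lemma tau_L_eq:
  "tau_L d x xd ms r z = tscale (dlt ^ (r - 1)) (tscale dlt z - KS (W (Q (Vt z))))"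
proof -
  let ?F = "\<lambda>\<mu>. rext qm (rcontract \<mu> PHIT)"
  let ?g = "\<lambda>\<theta> \<mu>. tscale (dlt ^ (r - 1)) (KS (tens_left (wedge_left (x 1) \<theta>) (?F \<mu>)))"
  let ?f = "\<lambda>\<theta> \<mu>. tscale (dlt ^ (r - 1)) (dlt \<otimes>\<^sub>t (\<theta> \<otimes>\<^sub>t \<mu>) - KS (tens_left (wedge_left (x 1) \<theta>) (?F \<mu>)))"
  have g: "biadditive ?g"
    by (rule biadditive_tens_left[OF zhom_comp[OF zhom_tscale zhom_KS]
          zhom_comp[OF zhom_rext[OF zhom_qm] zhom_rcontract_left]])
  have b: "biadditive ?f"
    unfolding biadditive_def tsc.scale_right_diff_distrib
    by (intro conjI allI zhom_minus2 zhom_comp[OF zhom_tscale] zhom_comp[OF tens_zhom(2)] tens_zhom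
        g[unfolded biadditive_def, THEN conjunct1, rule_format]
        g[unfolded biadditive_def, THEN conjunct2, rule_format])
  have t: "tau_L d x xd ms r = rext (tensor_lift ?f)"
    by (simp add: tau_L_def kappa_UNIV)
  show ?thesis
    unfolding t
  proof (rule tensor_zhom_eqI3[OF zhom_rext[OF additive_tensor_lift[OF b]]])
    show "zhom (\<lambda>z. tscale (dlt ^ (r - 1)) (tscale dlt z - KS (W (Q (Vt z)))))"
      by (intro zhom_comp[OF zhom_tscale] zhom_minus2 zhom_tscale zhom_comp[OF zhom_KS] zhom_comp[OF zhom_W]
          zhom_comp[OF zhom_Q zhom_Vt])
  next
    fix s :: "('u, 'n) RR" and \<theta> :: "'u ext" and \<mu> :: "'u sym"
    have e: "rext (tensor_lift ?f) (s \<otimes>\<^sub>t (\<theta> \<otimes>\<^sub>t \<mu>)) = tscale s (?f \<theta> \<mu>)"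
      by (simp only: rext_tens[OF additive_tensor_lift[OF b]] tensor_lift_tens[OF b])
    show "rext (tensor_lift ?f) (s \<otimes>\<^sub>t (\<theta> \<otimes>\<^sub>t \<mu>))
      = tscale (dlt ^ (r - 1)) (tscale dlt (s \<otimes>\<^sub>t (\<theta> \<otimes>\<^sub>t \<mu>)) - KS (W (Q (Vt (s \<otimes>\<^sub>t (\<theta> \<otimes>\<^sub>t \<mu>))))))"
      unfolding e
      by (simp add: opm_tens zhom_qm zhom_rcontract_left opm_tscale opm_tens_left
          lmap_tscale zhoms W_tens_left KS_tscale tsc.scale_right_diff_distrib tscale_tens mult.assoc mult.commute mult.left_commute)
  qed
qed

lemma tau_eq:
  "tau d x xd ms r (y, w)
    = tscale (dlt ^ (r - 1)) (KS (W (Q (y - Vt w))) + tscale dlt w)"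
  by (simp add: tau_def tau_K_eq tau_L_eq zhom_diff[OF zhom_Q] zhom_diff[OF zhom_W] zhom_diff[OF zhom_KS]
      tsc.scale_right_distrib tsc.scale_right_diff_distrib algebra_simps)

lemma tau_module_hom:
  "Modules.module_hom pscale tscale (tau d x xd ms r :: (('u, 'n) RR, ('u ext, 'u dpow) tensor) tensor \<times> _ \<Rightarrow> _)"
proof (intro Modules.module_hom.intro module_pscale module_tscale module_hom_axioms.intro)
  fix b1 b2 :: "(('u, 'n) RR, ('u ext, 'u dpow) tensor) tensor \<times>
      (('u, 'n) RR, ('u ext, 'u sym) tensor) tensor" and c :: "('u, 'n) RR"
  show "tau d x xd ms r (b1 + b2) = tau d x xd ms r b1 + tau d x xd ms r b2"
    by (cases b1; cases b2)
       (simp add: tau_eq zhom_add[OF zhom_Vt] add_diff_add zhom_add[OF zhom_Q] zhom_add[OF zhom_W]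
         zhom_add[OF zhom_KS] tsc.scale_right_distrib)
  show "tau d x xd ms r (pscale c b1) = tscale c (tau d x xd ms r b1)"
    by (cases b1)
       (simp add: tau_eq pscale_def opm_tscale zhom_rcontract_left zhom_qm lmap_tscale zhoms KS_tscale
         tsc.scale_right_distrib zhom_diff[OF zhom_Q] zhom_diff[OF zhom_W] zhom_diff[OF zhom_KS]
         tsc.scale_right_diff_distrib mult.assoc mult.commute mult.left_commute)
qed

subsection \<open>The case \<open>1 \<le> r \<le> d - 1\<close>\<close>

context
  fixes r :: nat
  assumes r: "r \<in> {1..d - 1}"
begin

lemma sub: "{2..d} \<subseteq> {1..d}" by auto

lemma B_mod_eq: "(B_mod d x xd r :: ((('u, 'n) RR, ('u ext, 'u dpow) tensor) tensor \<times> _) set) =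
    base_change (K_mod0 {2..d} x xd (x 1) U0 (r - 1) (CARD('n) - 1)) \<times> base_change (L_mod {2..d} x xd U0 (r - 1) (CARD('n)))"
  by (simp add: B_mod_def)

lemma G_mod_iff:
  "z \<in> G_mod d x xd r \<longleftrightarrow>
    z \<in> base_change (tens_span (ext_pow UNIV (r - 1)) (sym_pow UNIV (CARD('n)))) \<and> KS z = 0 \<and> V z = 0"
  by (simp add: G_mod_def base_change_L_mod v_map_eq)

lemma K0D:
  fixes y :: "(('u, 'n) RR, ('u ext, 'u dpow) tensor) tensor"
  assumes "y \<in> base_change (K_mod0 {2..d} x xd (x 1) U0 (r - 1) (CARD('n) - 1))"
  shows "y \<in> base_change (tens_span (ext_pow U0 (r - 1)) (dpow_deg (CARD('n) - 1)))"
    and "A y = y" "X1D y = 0" "KD y = 0"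
proof -
  have y: "y \<in> base_change (tens_span (ext_pow U0 (r - 1)) (dpow_deg0 (x 1) (CARD('n) - 1)))"
    and k: "koz {2..d} (\<lambda>i. contract (sym_of (x i))) y = 0"
    using assms unfolding base_change_K_mod0[OF sub] by auto
  have "lmap (\<lambda>a. a) (\<lambda>b. b) y \<in> base_change (tens_span (ext_pow U0 (r - 1)) (dpow_deg (CARD('n) - 1)))"
    by (rule lmap_in_base_change[OF zhom_ident(1) zhom_ident(1) y]) (simp_all add: dpow_deg0_def)
  then show "y \<in> base_change (tens_span (ext_pow U0 (r - 1)) (dpow_deg (CARD('n) - 1)))"
    by (simp add: lmap_ident)
  show A: "A y = y" by (rule A_fixed[OF y])
  show "X1D y = 0"
    by (rule base_change_tens_span_eqI[OF y zhom_X1D zhom_const_zero])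
       (simp add: lmap_tens zhoms dpow_deg0_def tens_simps)
  show "KD y = 0" unfolding A_koz(1)[OF zhom_contract A] by (rule k)
qed

lemma L0D:
  fixes w :: "(('u, 'n) RR, ('u ext, 'u sym) tensor) tensor"
  assumes "w \<in> base_change (L_mod {2..d} x xd U0 (r - 1) (CARD('n)))"
  shows "w \<in> base_change (tens_span (ext_pow U0 (r - 1)) (sym_pow U0 (CARD('n))))"
    and "A w = w" "Pm w = w" "KS w = 0"
proof -
  show w: "w \<in> base_change (tens_span (ext_pow U0 (r - 1)) (sym_pow U0 (CARD('n))))"
    using assms unfolding base_change_L_mod[OF sub] by blast
  show A: "A w = w" by (rule A_fixed[OF w])
  show "Pm w = w" by (rule Pm_fixed[OF w])
  show "KS w = 0"
    unfolding A_koz(1)[OF zhom_mult_left A] using assms unfolding base_change_L_mod[OF sub] by blast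
qed

lemma tau_in_G_mod:
  fixes b :: "(('u, 'n) RR, ('u ext, 'u dpow) tensor) tensor \<times> _"
  assumes "b \<in> B_mod d x xd r"
  shows "tau d x xd ms r b \<in> G_mod d x xd r"
proof -
  obtain y w where b: "b = (y, w)" and y: "y \<in> base_change (K_mod0 {2..d} x xd (x 1) U0 (r - 1) (CARD('n) - 1))" and w: "w \<in> base_change (L_mod {2..d} x xd U0 (r - 1) (CARD('n)))"
    using assms unfolding B_mod_eq by blast
  note y = K0D[OF y] and w = L0D[OF w]
  let ?t = "y - Vt w"
  have n1: "Suc (CARD('n) - 1) = CARD('n)" using n by simp
  have t: "?t \<in> base_change (tens_span (ext_pow U0 (r - 1)) (dpow_deg (CARD('n) - 1)))"
    by (intro zmod.subspace_diff[OF base_change_subspace] y(1) Vt_in w(1))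
  let ?z = "KS (W (Q ?t)) + tscale dlt w"
  have "lmap (\<lambda>a. a) (\<lambda>b. b) w \<in> base_change (tens_span (ext_pow UNIV (r - 1)) (sym_pow UNIV (CARD('n))))"
    by (rule lmap_in_base_change[OF zhom_ident(1) zhom_ident(1) w(1)])
       (use ext_pow_mono[of U0 UNIV] sym_pow_mono[of U0 UNIV] in auto)
  then have 1: "?z \<in> base_change (tens_span (ext_pow UNIV (r - 1)) (sym_pow UNIV (CARD('n))))"
    using KS_W_in[OF Q_in[OF t]]
    by (intro zmod.subspace_add[OF base_change_subspace] base_change_tscale) (simp_all add: lmap_ident n1)
  have 2: "KS ?z = 0"
    by (simp add: zhom_add[OF zhom_KS] KS_KS KS_tscale w(4))
  have "KD ?t = 0"
    by (simp add: zhom_diff[OF zhom_KD] y(4) zhom_zero[OF zhom_Vt] w(4) flip: Vt_KS)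
  then have "V (KS (W (Q ?t))) = tscale dlt (X1D ?t)"
    by (simp add: V_KS V_W V_Q[OF t] lmap_tscale zhoms KD_W zhom_zero[OF zhom_W]
        koz_tscale[OF subset_refl zhom_contract])
  also have "X1D ?t = - V w" by (simp add: zhom_diff[OF zhom_X1D] y(3) X1D_Vt)
  finally have 3: "V ?z = 0" by (simp add: zhom_add[OF zhom_V] opm_tscale zhom_pm)
  have "tscale c ?z \<in> G_mod d x xd r" for c
    using 1 2 3 unfolding G_mod_iff by (simp add: base_change_tscale KS_tscale opm_tscale zhom_pm)
  then show ?thesis unfolding b tau_eq .
qed

lemma tau_injective:
  fixes b :: "(('u, 'n) RR, ('u ext, 'u dpow) tensor) tensor \<times> _"
  assumes "b \<in> B_mod d x xd r" "tau d x xd ms r b = 0"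
  shows "b = 0"
proof -
  obtain y w where b: "b = (y, w)" and y0: "y \<in> base_change (K_mod0 {2..d} x xd (x 1) U0 (r - 1) (CARD('n) - 1))" and w0: "w \<in> base_change (L_mod {2..d} x xd U0 (r - 1) (CARD('n)))"
    using assms(1) unfolding B_mod_eq by blast
  note y = K0D[OF y0] and w = L0D[OF w0]
  let ?c = "dlt ^ (r - 1)" and ?t = "y - Vt w"
  have t: "?t \<in> base_change (tens_span (ext_pow U0 (r - 1)) (dpow_deg (CARD('n) - 1)))"
    by (intro zmod.subspace_diff[OF base_change_subspace] y(1) Vt_in w(1))
  let ?u = "tscale ?c (Q ?t)" and ?w = "tscale (?c * dlt) w"
  have e: "KS (W ?u) + ?w = 0"
    using assms(2) unfolding b tau_eq
    by (simp add: tsc.scale_right_distrib KS_tscale lmap_tscale zhoms)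
  have "A ?t = ?t" by (rule A_fixed[OF t])
  then have Au: "A ?u = ?u" by (simp add: lmap_tscale zhoms flip: Q_A)
  have Aw: "A ?w = ?w" "Pm ?w = ?w" by (simp_all add: lmap_tscale zhoms w)
  from KS_W_injective[OF Au Aw e] have u: "?u = 0" and w': "?w = 0" .
  have cancel: "s = 0" if "?c * dlt * s = 0" for s
    using dlt_cancel[of "Suc (r - 1)" s] that by (simp add: mult.commute)
  have wz: "w = 0"
    by (rule R.base_change_nonzerodivisor[OF finitely_separated_L_mod L_mod_subspace[OF sub] w0 w' cancel])
  have "V ?u = tscale (?c * dlt) ?t" by (simp add: opm_tscale zhom_pm V_Q[OF t])
  then have "tscale (?c * dlt) ?t = 0" by (simp only: u zhom_zero[OF zhom_V])
  then have "tscale (?c * dlt) y = 0" by (simp add: wz zhom_zero[OF zhom_Vt])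
  then have "y = 0"
    by (rule R.base_change_nonzerodivisor[OF finitely_separated_K_mod0 K_mod0_subspace[OF sub] y0 _ cancel])
  with wz b show ?thesis by (simp add: zero_prod_def)
qed

lemma tau_generically_onto:
  fixes z :: "(('u, 'n) RR, ('u ext, 'u sym) tensor) tensor"
  assumes "z \<in> G_mod d x xd r"
  shows "tscale (dlt ^ r) z \<in> tau d x xd ms r ` B_mod d x xd r"
proof -
  have n1: "Suc (CARD('n) - 1) = CARD('n)" using n by simp
  have z: "z \<in> base_change (tens_span (ext_pow UNIV (r - 1)) (sym_pow UNIV (Suc (CARD('n) - 1))))"
    "KS z = 0" "V z = 0"
    using assms unfolding G_mod_iff n1 by auto
  obtain b0 b1 where b: "b0 \<in> base_change (tens_span (ext_pow U0 (r - 1)) (sym_pow U0 (CARD('n))))" "KS b0 = 0"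
    "b1 \<in> base_change (tens_span (ext_pow U0 (r - 1)) (sym_pow UNIV (CARD('n) - 1)))" "z = b0 + KS (W b1)"
    using L_decomposition[OF z(1,2)] unfolding n1 by blast
  let ?g = "V b1 + Vt b0"
  have "?g \<in> base_change (K_mod0 {2..d} x xd (x 1) U0 (r - 1) (CARD('n) - 1))" using V_kernel[OF b(1-3)] z(3) b(4) by simp
  moreover have "b0 \<in> base_change (L_mod {2..d} x xd U0 (r - 1) (CARD('n)))"
    unfolding base_change_L_mod[OF sub]
    using b(1,2) A_koz(1)[OF zhom_mult_left A_fixed[OF b(1)]] by simp
  ultimately have B: "(?g, b0) \<in> B_mod d x xd r" by (simp add: B_mod_eq)
  have "tau d x xd ms r (?g, b0) = tscale (dlt ^ (r - 1)) (tscale dlt z)"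
    by (simp add: tau_eq Q_V[OF b(3)] lmap_tscale zhoms KS_tscale b(4) tsc.scale_right_distrib add.commute)
  also have "\<dots> = tscale (dlt ^ r) z"
    using r by (cases r) (simp_all add: mult.commute)
  finally have "tau d x xd ms r (?g, b0) = tscale (dlt ^ r) z" .
  from imageI[OF B, of "tau d x xd ms r", unfolded this] show ?thesis .
qed

lemma tau_free_iso:
  "free_iso_generically_onto pscale tscale dlt
    (tau d x xd ms r) (B_mod d x xd r) (G_mod d x xd r)"
proof -
  obtain E :: "((('u, 'n) RR, ('u ext, 'u dpow) tensor) tensor \<times> (('u, 'n) RR, ('u ext, 'u sym) tensor) tensor) set"
    where E: "\<not> psc.dependent E" "psc.span E = base_change (K_mod0 {2..d} x xd (x 1) U0 (r - 1) (CARD('n) - 1)) \<times> base_change (L_mod {2..d} x xd U0 (r - 1) (CARD('n)))"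
    using R.base_change_Times_free[OF finitely_separated_K_mod0 K_mod0_subspace[OF sub]
        finitely_separated_L_mod L_mod_subspace[OF sub]] by metis
  show ?thesis
    by (rule free_iso_generically_ontoI[OF tau_module_hom E(1) E(2)[folded B_mod_eq] tau_injective tau_in_G_mod])
       (use tau_generically_onto in blast)+
qed

end

subsection \<open>The case \<open>r = d\<close>\<close>

lemma tau_top_eq:
  fixes z :: "(('u, 'n) RR, 'u ext) tensor"
  shows "tau_top d x ms z = tscale (dlt ^ (d - 1)) (rmap (wedge_left (x 1)) z)"
proof (rule tensor_zhom_eqI[of "tau_top d x ms"])
  have h: "zhom (\<lambda>\<omega>. (dlt ^ (d - 1)) \<otimes>\<^sub>t wedge_left (x 1) \<omega>)"
    by (rule zhom_comp[OF tens_zhom(2) zhom_wedge_left])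
  show "zhom (tau_top d x ms :: _ \<Rightarrow> (('u, 'n) RR, 'u ext) tensor)"
    unfolding tau_top_def by (rule zhom_rext[OF h])
  show "zhom (\<lambda>z. tscale (dlt ^ (d - 1)) (rmap (wedge_left (x 1)) z))"
    by (rule zhom_comp[OF zhom_tscale zhom_rmap[OF zhom_wedge_left]])
  show "tau_top d x ms (a \<otimes>\<^sub>t b) = tscale (dlt ^ (d - 1)) (rmap (wedge_left (x 1)) (a \<otimes>\<^sub>t b))"
    for a :: "('u, 'n) RR" and b :: "'u ext"
    by (simp add: tau_top_def rext_tens[OF h] rmap_tens zhom_wedge_left tscale_tens mult.commute)
qed

lemma tau_top_module_hom:
  "Modules.module_hom tscale tscale (tau_top d x ms :: (('u, 'n) RR, 'u ext) tensor \<Rightarrow> _)"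
proof (intro Modules.module_hom.intro module_tscale module_hom_axioms.intro)
  fix b1 b2 :: "(('u, 'n) RR, 'u ext) tensor" and c :: "('u, 'n) RR"
  show "tau_top d x ms (b1 + b2) = tau_top d x ms b1 + tau_top d x ms b2"
    by (simp add: tau_top_eq zhom_add[OF zhom_rmap[OF zhom_wedge_left]] tsc.scale_right_distrib)
  show "tau_top d x ms (tscale c b1) = tscale c (tau_top d x ms b1)"
    by (simp add: tau_top_eq rmap_tscale zhom_wedge_left mult.commute)
qed

lemma U0_below: "U0 = below {2..d}" "(UNIV :: 'u set) = below (insert 1 {2..d})"
proof -
  have e: "{1..d} - {2..d} = {1}" "{1..d} - insert 1 {2..d} = {}" using d by auto
  show "U0 = below {2..d}" "(UNIV :: 'u set) = below (insert 1 {2..d})"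
    unfolding below_def e by simp_all
qed

lemma tau_top_free_iso:
  "free_iso_generically_onto tscale tscale dlt (tau_top d x ms)
    (B_top d xd :: (('u, 'n) RR, 'u ext) tensor set) (G_top d)"
proof -
  obtain E :: "(('u, 'n) RR, 'u ext) tensor set" where E: "\<not> tsc.dependent E" "tsc.span E = B_top d xd"
    using R.base_change_free[OF finitely_separated_ext_pow' ext_pow_subspace] unfolding B_top_def by metis
  note w = zhom_rmap[OF zhom_wedge_left] and c = zhom_rmap[OF zhom_ext_contract[OF xd1]]
  have d1: "Suc (d - 1) = d" using d by simp
  show ?thesis
  proof (rule free_iso_generically_ontoI[OF tau_top_module_hom E])
    fix z :: "(('u, 'n) RR, 'u ext) tensor" assume z: "z \<in> B_top d xd"
    have wz: "rmap (wedge_left (x 1)) z \<in> G_top d"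
      unfolding G_top_def
    proof (rule rmap_in_base_change[OF zhom_wedge_left z[unfolded B_top_def]])
      fix \<theta> assume "\<theta> \<in> ext_pow U0 (d - 1)"
      then have "\<theta> \<in> ext_pow UNIV (d - 1)" using ext_pow_mono[of U0 UNIV] by blast
      from wedge_left_in_ext_pow[OF this UNIV_I] show "wedge_left (x 1) \<theta> \<in> ext_pow UNIV d"
        by (simp add: d1)
    qed
    then show "tau_top d x ms z \<in> G_top d"
      unfolding tau_top_eq G_top_def by (rule base_change_tscale)
    assume 0: "tau_top d x ms z = 0"
    have "rmap (ext_contract (xd 1)) (rmap (wedge_left (x 1)) z) = z"
      by (rule base_change_eqI[OF z[unfolded B_top_def] zhom_comp[OF c w] zhom_ident(1)])
         (simp add: rmap_tens zhom_wedge_left zhom_ext_contract xd1 one.contract_e one.contract_ker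
           wedge_left_simps)
    moreover have "rmap (wedge_left (x 1)) z = 0"
      by (rule R.base_change_nonzerodivisor[OF finitely_separated_ext_pow' ext_pow_subspace wz[unfolded G_top_def]
            0[unfolded tau_top_eq] dlt_cancel])
    ultimately show "z = 0" by (simp add: zhom_zero[OF c])
  next
    fix z :: "(('u, 'n) RR, 'u ext) tensor" assume z: "z \<in> G_top d"
    have c0: "ext_contract (xd 1) \<theta> \<in> ext_pow U0 (d - 1)" if "\<theta> \<in> ext_pow UNIV d" for \<theta>
      unfolding U0_below(1) by (rule contract_below[OF one_in]) (use that in \<open>simp flip: U0_below(2)\<close>)
    have "rmap (wedge_left (x 1)) (rmap (ext_contract (xd 1)) z) = z"
    proof (rule base_change_eqI[OF z[unfolded G_top_def] zhom_comp[OF w c] zhom_ident(1)])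
      fix s :: "('u, 'n) RR" and \<theta> :: "'u ext" assume \<theta>: "\<theta> \<in> ext_pow UNIV d"
      have "one.wprj \<theta> \<in> ext_pow (below {2..d}) d"
        by (rule wprj_below[OF one_in]) (use \<theta> in \<open>simp flip: U0_below(2)\<close>)
      then have "one.wprj \<theta> = 0"
        using d by (intro ext_pow_below_eq_0[of "{2..d}" d]) auto
      then show "rmap (wedge_left (x 1)) (rmap (ext_contract (xd 1)) (s \<otimes>\<^sub>t \<theta>)) = s \<otimes>\<^sub>t \<theta>"
        using one.wprj_split[of \<theta>] by (simp add: rmap_tens zhom_wedge_left zhom_ext_contract xd1)
    qed
    then have "tscale (dlt ^ (d - 1)) z = tau_top d x ms (rmap (ext_contract (xd 1)) z)"
      by (simp add: tau_top_eq)
    moreover have "rmap (ext_contract (xd 1)) z \<in> B_top d xd"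
      unfolding B_top_def
      by (rule rmap_in_base_change[OF zhom_ext_contract[OF xd1] z[unfolded G_top_def] c0])
    ultimately show "\<exists>k. tscale (dlt ^ k) z \<in> tau_top d x ms ` B_top d xd" by blast
  qed
qed

end

theorem theorem6p1:
  fixes x1 :: "'u::ab_group_add" and x1s :: "'u \<Rightarrow> int" and d n :: nat
    and x :: "nat \<Rightarrow> 'u" and xd :: "nat \<Rightarrow> 'u \<Rightarrow> int" and ms :: "'u sym list"
    and \<delta> :: "('u, 'n::finite) RR"
  assumes n: "n = CARD('n)" "n \<ge> 2"
    and U_free: "\<exists>b. zbasis {1..d} b (UNIV :: 'u set)"
    and x1s: "Modules.additive x1s" "x1s x1 = 1"
    and x_basis: "x 1 = x1" "zbasis {2..d} x {u. x1s u = 0}"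
    and dual_basis: "xd 1 = x1s"
      "\<forall>i\<in>{1..d}. Modules.additive (xd i)"
      "\<forall>i\<in>{1..d}. \<forall>j\<in>{1..d}. xd i (x j) = (if i = j then 1 else 0)"
    and ms_basis: "zbasis {..<length ms} (\<lambda>i. ms ! i) (sym_pow (UNIV :: 'u set) (n - 1))"
    and delta: "\<delta> = delta ms"
  shows "free_iso_generically_onto (*) (*) \<delta> id (UNIV :: ('u, 'n) RR set) UNIV \<and>
         (\<forall>r\<in>{1..d - 1}. free_iso_generically_onto pscale tscale \<delta>
           (tau d x xd ms r) (B_mod d x xd r) (G_mod d x xd r)) \<and>
         free_iso_generically_onto tscale tscale \<delta> (tau_top d x ms) (B_top d xd) (G_top d)"
proof -
  \<comment> \<open>\<open>U\<close> contains \<open>x\<^sub>1 \<noteq> 0\<close>.\<close>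
  have d: "1 \<le> d"
  proof (rule ccontr)
    assume "\<not> 1 \<le> d"
    then have "{1..d} = {}" by simp
    then have "(UNIV :: 'u set) = {0}" using U_free by (simp add: zbasis_def)
    then have "x1 = 0" by blast
    then show False using x1s additive.zero[OF x1s(1)] by simp
  qed
  have I: "{1..d} = insert 1 {2..d}" using d by auto
  \<comment> \<open>Together with \<open>x\<^sub>1\<close> the basis of the kernel of \<open>x\<^sub>1\<^sup>*\<close> spans \<open>U\<close>.\<close>
  have "dual_bases {1..d} x xd"
  proof (rule dual_bases.intro)
    fix u
    let ?v = "u - zmul (x1s u) x1"
    have "x1s ?v = 0" by (simp add: zhom_diff[OF x1s(1)] zhom_zmul[OF x1s(1)] x1s(2))
    then have "?v \<in> zspan (x ` {2..d})" using x_basis(2) by (simp add: zbasis_def)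
    then have "(\<Sum>i\<in>{1..d}. zmul (xd i ?v) (x i)) = ?v"
    proof (rule additive_eq_on_zspan[of "\<lambda>v. \<Sum>i\<in>{1..d}. zmul (xd i v) (x i)" "\<lambda>v. v", rotated -1])
      show "zhom (\<lambda>v. \<Sum>i\<in>{1..d}. zmul (xd i v) (x i))"
        using dual_basis(2) by (intro zhom_sum_fun zhom_comp[OF zhom_zmul_left]) blast
      fix s assume "s \<in> x ` {2..d}"
      then obtain j where j: "j \<in> {2..d}" "s = x j" by blast
      then have "(\<Sum>i\<in>{1..d}. zmul (xd i s) (x i)) = (\<Sum>i\<in>{1..d}. if i = j then x i else 0)"
        using dual_basis(3) by (intro sum.cong) auto
      then show "(\<Sum>i\<in>{1..d}. zmul (xd i s) (x i)) = s" using j by simp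
    qed simp
    moreover have "(\<Sum>i\<in>{1..d}. zmul (xd i x1) (x i)) = x1"
    proof -
      have "(\<Sum>i\<in>{1..d}. zmul (xd i (x 1)) (x i)) = (\<Sum>i\<in>{1..d}. if i = 1 then x i else 0)"
        using dual_basis(3) d by (intro sum.cong) auto
      then show ?thesis using d x_basis(1) by simp
    qed
    moreover have "xd i u = xd i ?v + x1s u * xd i x1" if "i \<in> {1..d}" for i
      using dual_basis(2) that by (simp add: zhom_diff zhom_zmul)
    ultimately show "(\<Sum>i\<in>{1..d}. zmul (xd i u) (x i)) = u"
      by (simp add: zmod.scale_left_distrib sum.distrib flip: zmod.scale_scale zmod.scale_sum_right)
  qed (use dual_basis in auto)
  then have "inverse_system TYPE('n) d x xd ms"
    using d n ms_basis by (simp add: inverse_system_def inverse_system_axioms_def)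
  then interpret inverse_system d x xd ms "TYPE('n)" .
  show ?thesis
    using tau_free_iso tau_top_free_iso id_free_iso[of \<delta>] unfolding delta by blast
qed

end
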